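(* Let $N\ge 2$, $d\ge 1$, and let $\mathcal L=\sum_{l=1}^{N-1}\mathcal L^{[l,l+1]}$ be a nearest-neighbor Liouvillian on a chain of $N$ spins of local dimension $d$, where each $\mathcal L^{[l,l+1]}$ is a (time-independent) Liouvillian acting non-trivially only on sites $l,l+1$ and satisfies $\|\mathcal L^{[l,l+1]}\|_\diamond\le b$. Let $\rho=XX^\dagger$ be an initial state with purification operator $X$ given in locally purified form. Let $t\ge 0$ and let $m\ge 1$ be an integer. Denote by $\rho_t:=e^{t\mathcal L}(\rho)$ the exact time-evolved state and by $\tilde\rho_t$ the output of the locally purified simulation algorithm (defined in the context) run on $X$ with $m$ time steps of size $\Delta t=t/m$ in the second order Trotter-Suzuki approximation. Assume that all discarded weights occurring in the compression steps of the algorithm are bounded by $\delta_{\max}$. Then $$\|\rho_t-\tilde\rho_t\|_1\le \frac{(tb)^3N^2}{4m^2}+6(2m+1)N\,\delta_{\max}.$$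
   Context: All Hilbert spaces are finite-dimensional. $\|R\|_1=\mathrm{Tr}\sqrt{R^\dagger R}$ is the trace norm and $\|R\|_2=\sqrt{\mathrm{Tr}(R^\dagger R)}$ the Frobenius norm. For a linear map $T$ on operators, $\|T\|_{1\to1}=\sup_{\|R\|_1=1}\|T(R)\|_1$ and the diamond norm is $\|T\|_\diamond=\sup_{n\ge1}\|T\otimes\mathrm{id}_n\|_{1\to1}$, where $\mathrm{id}_n$ is the identity map on operators on $\mathbb C^n$. A Liouvillian is a linear map on operators of Lindblad form $\mathcal L(\rho)=-i[H,\rho]+\sum_\alpha\bigl(L_\alpha\rho L_\alpha^\dagger-\tfrac12(L_\alpha^\dagger L_\alpha\rho+\rho L_\alpha^\dagger L_\alpha)\bigr)$ with $H$ Hermitian. Locally purified form: a state $\rho$ on $(\mathbb C^d)^{\otimes N}$ (positive, trace one) is written as $\rho=XX^\dagger$, where the purification operator $X$ has entries $$[X]^{s_1,\dots,s_N}_{r_1,\dots,r_N}=\sum_{m_1,\dots,m_{N-1}}A^{[1]s_1,r_1}_{m_1}A^{[2]s_2,r_2}_{m_1,m_2}\cdots A^{[N]s_N,r_N}_{m_{N-1}},$$ with physical indices $s_l\in\{1,\dots,d\}$, Kraus indices $r_l$ and bond indices $m_l$ ranging over finite sets (the left bond index of site $1$ and the right bond index of site $N$ are regarded as trivial, of dimension one). Since $\mathrm{Tr}\rho=1$, $\|X\|_2=1$. The three virtual indices of a local tensor $A^{[l]}$ are its left bond index, its Kraus index and its right bond index. The tensors are in mixed canonical form with respect to site $l_0$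 if $\sum_{s,r,n}A^{[l]s,r}_{n,m}\overline{A^{[l]s,r}_{n,m'}}=\delta_{m,m'}$ for all $l<l_0$ and $\sum_{s,r,m}A^{[l]s,r}_{n,m}\overline{A^{[l]s,r}_{n',m}}=\delta_{n,n'}$ for all $l>l_0$. A given $X$ can be brought to this form by gauge transformations, which do not change $X$. Compression step: with the tensors in mixed canonical form with respect to site $l_0$, one of the three virtual indices of $A^{[l_0]}$ is chosen, $A^{[l_0]}$ is regarded as a matrix (chosen index versus the remaining three indices), and a singular value decomposition $VSU^\dagger$ is taken. Some number (possibly zero, not all of the nonzero ones) of the smallest singular values $s_i$ are set to zero and the result is rescaled so that the new purification operator has Frobenius norm $1$. The discarded weight of the step is $\delta=\bigl(\sum_{s_i\text{ discarded}}s_i^2\bigr)^{1/2}\in[0,1)$. After compressing a Kraus index one may additionally apply a unitary or isometry to that Kraus index; this does not change the state $XX^\dagger$. Algorithm: let $\mathcal L_o=\sum_l\mathcal L^{[2l-1,2l]}$ and $\mathcal L_e=\sum_l\mathcal L^{[2l,2l+1]}$ (sums over all terms present in the chain). The second order Trotter-Suzuki approximation with $m$ steps of size $\Delta t=t/m$ is $$\bigl(e^{\Delta t\mathcal L_o/2}e^{\Delta t\mathcal L_e}e^{\Delta t\mathcal L_o/2}\bigr)^m=e^{\Delta t\mathcal L_o/2}\bigl(e^{\Delta t\mathcal L_e}e^{\Delta t\mathcal L_o}\bigr)^{m-1}e^{\Delta t\mathcal L_e}e^{\Delta t\mathcal L_o/2},$$ that is, a product of $2m+1$ layers $e^{\Delta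 t\mathcal K^{(k)}}$, $k=1,\dots,2m+1$, numbered in order of application, with $\mathcal K^{(k)}\in\{\mathcal L_e,\mathcal L_o,\mathcal L_o/2\}$. Start with $\tilde X^{(0)}=X$. For $k=1,\dots,2m+1$: first update $\tilde X^{(k-1)}$, without error, to a locally purified $X^{(k)}$ with $X^{(k)}X^{(k)\dagger}=e^{\Delta t\mathcal K^{(k)}}\bigl(\tilde X^{(k-1)}\tilde X^{(k-1)\dagger}\bigr)$, by contracting Kraus operators of the two-site channels into the local tensors and joining the Kraus index of the channels with the Kraus indices of the tensors; second, successively for $l=1,\dots,N$ and $j=1,2,3$, apply a compression step to the $j$-th virtual index of the tensor at site $l$, with discarded weight $\delta_{k,l,j}$. The resulting purification operator is $\tilde X^{(k)}$. The output is $\tilde\rho_t=\tilde X^{(2m+1)}\tilde X^{(2m+1)\dagger}$. The hypothesis on discarded weights is $\delta_{k,l,j}\le\delta_{\max}$ for all $k,l,j$. *)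

theory Defs
  imports
    "Jordan_Normal_Form.Schur_Decomposition"
    "HOL-Library.Extended_Real"
    "HOL-Library.FuncSet"
begin

definition mtr :: "complex mat \<Rightarrow> complex" where
  "mtr A = (\<Sum>i<dim_row A. A $$ (i, i))"

definition mat_sum :: "nat \<Rightarrow> nat \<Rightarrow> ('a \<Rightarrow> complex mat) \<Rightarrow> 'a set \<Rightarrow> complex mat" where
  "mat_sum r c f I = mat r c (\<lambda>ij. \<Sum>a\<in>I. f a $$ ij)"

definition kron :: "complex mat \<Rightarrow> complex mat \<Rightarrow> complex mat" where
  "kron A B = mat (dim_row A * dim_row B) (dim_col A * dim_col B)
     (\<lambda>(i, j). A $$ (i div dim_row B, j div dim_col B) * B $$ (i mod dim_row B, j mod dim_col B))"

definition hermitian_mat :: "nat \<Rightarrow> complex mat \<Rightarrow> bool" where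
  "hermitian_mat n A \<longleftrightarrow> A \<in> carrier_mat n n \<and> mat_adjoint A = A"

definition psd :: "nat \<Rightarrow> complex mat \<Rightarrow> bool" where
  "psd n A \<longleftrightarrow> hermitian_mat n A \<and> (\<forall>v\<in>carrier_vec n. 0 \<le> Re ((A *\<^sub>v v) \<bullet>c v))"

definition psd_sqrt :: "complex mat \<Rightarrow> complex mat" where
  "psd_sqrt A = (THE S. psd (dim_row A) S \<and> S * S = A)"

definition trace_norm :: "complex mat \<Rightarrow> real" where
  "trace_norm R = Re (mtr (psd_sqrt (mat_adjoint R * R)))"

definition frob_norm :: "complex mat \<Rightarrow> real" where
  "frob_norm R = sqrt (Re (mtr (mat_adjoint R * R)))"

definition is_state :: "nat \<Rightarrow> complex mat \<Rightarrow> bool" where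
  "is_state n \<rho> \<longleftrightarrow> psd n \<rho> \<and> mtr \<rho> = 1"

text \<open>Superoperators are functions on matrices; only their values on square matrices of the
  relevant dimension matter.\<close>

type_synonym superop = "complex mat \<Rightarrow> complex mat"

definition linear_superop :: "nat \<Rightarrow> superop \<Rightarrow> bool" where
  "linear_superop n T \<longleftrightarrow>
     (\<forall>R\<in>carrier_mat n n. T R \<in> carrier_mat n n) \<and>
     (\<forall>R\<in>carrier_mat n n. \<forall>S\<in>carrier_mat n n. T (R + S) = T R + T S) \<and>
     (\<forall>a. \<forall>R\<in>carrier_mat n n. T (a \<cdot>\<^sub>m R) = a \<cdot>\<^sub>m T R)"

text \<open>The superoperator \<open>id \<otimes> T \<otimes> id\<close> on operators on \<open>\<complex>\<^sup>c \<otimes> \<complex>\<^sup>k \<otimes> \<complex>\<^sup>e\<close>, with the index convention of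
  \<^const>\<open>kron\<close>: the basis vector \<open>(a, p, z)\<close> has index \<open>a * (k * e) + p * e + z\<close>. For fixed outer
  indices of row and column, \<open>T\<close> is applied to the corresponding \<open>k \<times> k\<close> block.\<close>

definition ampl :: "nat \<Rightarrow> nat \<Rightarrow> nat \<Rightarrow> superop \<Rightarrow> superop" where
  "ampl c k e T R = mat (c * k * e) (c * k * e) (\<lambda>(i, j).
     T (mat k k (\<lambda>(p, q). R $$ (i div (k * e) * (k * e) + p * e + i mod e,
                                j div (k * e) * (k * e) + q * e + j mod e)))
       $$ (i div e mod k, j div e mod k))"

text \<open>Suprema are taken in the extended reals, where they always exist.\<close>

definition norm_1_1 :: "nat \<Rightarrow> superop \<Rightarrow> ereal" where
  "norm_1_1 n T = (SUP R\<in>{R \<in> carrier_mat n n. trace_norm R = 1}. ereal (trace_norm (T R)))"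

definition diamond_norm :: "nat \<Rightarrow> superop \<Rightarrow> ereal" where
  "diamond_norm D T = (SUP n\<in>{1..}. norm_1_1 (D * n) (ampl 1 D n T))"

text \<open>The exponential \<open>e\<^bsup>\<tau>T\<^esup>\<close>, applied to \<open>R\<close>; the series is summed entrywise.\<close>

definition superop_exp :: "nat \<Rightarrow> real \<Rightarrow> superop \<Rightarrow> superop" where
  "superop_exp n \<tau> T R =
     mat n n (\<lambda>ij. \<Sum>k. complex_of_real (\<tau> ^ k / fact k) * ((T ^^ k) R $$ ij))"

definition liouvillian :: "nat \<Rightarrow> superop \<Rightarrow> bool" where
  "liouvillian n T \<longleftrightarrow> (\<exists>H (p::nat) (J :: nat \<Rightarrow> complex mat).
     hermitian_mat n H \<and> (\<forall>a<p. J a \<in> carrier_mat n n) \<and>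
     (\<forall>R\<in>carrier_mat n n.
        T R = (- \<i>) \<cdot>\<^sub>m (H * R - R * H) +
          mat_sum n n (\<lambda>a. J a * R * mat_adjoint (J a) -
            (1 / 2) \<cdot>\<^sub>m (mat_adjoint (J a) * J a * R + R * (mat_adjoint (J a) * J a))) {..<p}))"

text \<open>Sites are numbered \<open>1, \<dots>, N\<close>; site \<open>k\<close> carries an index of dimension \<open>f k\<close>. Multi-indices are
  flattened with site \<open>1\<close> most significant, as in iterated \<^const>\<open>kron\<close>; \<open>site_index\<close> extracts the
  index of one site and \<open>flat_index\<close> assembles the flattened index.\<close>

definition site_index :: "(nat \<Rightarrow> nat) \<Rightarrow> nat \<Rightarrow> nat \<Rightarrow> nat \<Rightarrow> nat" where
  "site_index f N l i = i div (\<Prod>k\<in>{l<..N}. f k) mod f l"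

definition flat_index :: "(nat \<Rightarrow> nat) \<Rightarrow> nat \<Rightarrow> (nat \<Rightarrow> nat) \<Rightarrow> nat" where
  "flat_index f N r = (\<Sum>l\<in>{1..N}. r l * (\<Prod>k\<in>{l<..N}. f k))"

text \<open>The operator acting as \<open>B\<close> on the sites \<open>a, \<dots>, b\<close> and as the identity on the others.\<close>

definition on_sites :: "(nat \<Rightarrow> nat) \<Rightarrow> nat \<Rightarrow> nat \<Rightarrow> nat \<Rightarrow> complex mat \<Rightarrow> complex mat" where
  "on_sites f N a b B = kron (kron (1\<^sub>m (\<Prod>k\<in>{1..<a}. f k)) B) (1\<^sub>m (\<Prod>k\<in>{b<..N}. f k))"

definition acts_on_pair :: "nat \<Rightarrow> nat \<Rightarrow> nat \<Rightarrow> superop \<Rightarrow> bool" where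
  "acts_on_pair d N l T \<longleftrightarrow> (\<exists>M. linear_superop (d ^ 2) M \<and>
     (\<forall>R\<in>carrier_mat (d ^ N) (d ^ N). T R = ampl (d ^ (l - 1)) (d ^ 2) (d ^ (N - (l + 1))) M R))"

definition local_sum :: "nat \<Rightarrow> nat \<Rightarrow> (nat \<Rightarrow> superop) \<Rightarrow> nat set \<Rightarrow> superop" where
  "local_sum d N L I R = mat_sum (d ^ N) (d ^ N) (\<lambda>l. L l R) I"

text \<open>A tensor \<open>A l s r n m\<close> at site \<open>l\<close> has physical index \<open>s < d\<close>, Kraus index \<open>r < K l\<close>, left bond index
  \<open>n < D (l - 1)\<close> and right bond index \<open>m < D l\<close>.\<close>

type_synonym tensor = "nat \<Rightarrow> nat \<Rightarrow> nat \<Rightarrow> nat \<Rightarrow> complex"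

definition bond_dims :: "nat \<Rightarrow> (nat \<Rightarrow> nat) \<Rightarrow> bool" where
  "bond_dims N D \<longleftrightarrow> D 0 = 1 \<and> D N = 1"

definition lpf_op ::
  "nat \<Rightarrow> nat \<Rightarrow> (nat \<Rightarrow> nat) \<Rightarrow> (nat \<Rightarrow> nat) \<Rightarrow> (nat \<Rightarrow> tensor) \<Rightarrow> complex mat" where
  "lpf_op d N K D A = mat (d ^ N) (\<Prod>k\<in>{1..N}. K k) (\<lambda>(i, j).
     \<Sum>b\<in>(\<Pi>\<^sub>E l\<in>{0..N}. {..<D l}).
       \<Prod>l\<in>{1..N}. A l (site_index (\<lambda>_. d) N l i) (site_index K N l j) (b (l - 1)) (b l))"

definition mixed_canonical ::
  "nat \<Rightarrow> nat \<Rightarrow> (nat \<Rightarrow> nat) \<Rightarrow> (nat \<Rightarrow> nat) \<Rightarrow> (nat \<Rightarrow> tensor) \<Rightarrow> nat \<Rightarrow> bool" where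
  "mixed_canonical d N K D A l0 \<longleftrightarrow>
     (\<forall>l\<in>{1..<l0}. \<forall>m<D l. \<forall>m'<D l.
        (\<Sum>s<d. \<Sum>r<K l. \<Sum>n<D (l - 1). A l s r n m * cnj (A l s r n m')) =
          (if m = m' then 1 else 0)) \<and>
     (\<forall>l\<in>{l0<..N}. \<forall>n<D (l - 1). \<forall>n'<D (l - 1).
        (\<Sum>s<d. \<Sum>r<K l. \<Sum>m<D l. A l s r n m * cnj (A l s r n' m)) =
          (if n = n' then 1 else 0))"

text \<open>A tensor with dimensions \<open>d\<close>, \<open>k\<close> (Kraus), \<open>a\<close> (left bond), \<open>b\<close> (right bond) as a matrix. Rows: the
  virtual index number \<open>j\<close> (\<open>1\<close>: left bond, \<open>2\<close>: Kraus, \<open>3\<close>: right bond); columns: the other three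
  indices, flattened.\<close>

definition unfolding_mat :: "nat \<Rightarrow> nat \<Rightarrow> nat \<Rightarrow> nat \<Rightarrow> nat \<Rightarrow> tensor \<Rightarrow> complex mat" where
  "unfolding_mat j d k a b A =
    (if j = 1 then mat a (d * k * b) (\<lambda>(x, y). A (y div (k * b)) (y div b mod k) x (y mod b))
     else if j = 2 then mat k (d * a * b) (\<lambda>(x, y). A (y div (a * b)) x (y div b mod a) (y mod b))
     else mat b (d * k * a) (\<lambda>(x, y). A (y div (k * a)) (y div a mod k) (y mod a) x))"

text \<open>\<open>q\<close> may be any size for which the columns of \<open>V\<close> and \<open>U\<close> are orthonormal, so that singular values
  equal to zero may be present or omitted.\<close>

definition is_svd ::
  "complex mat \<Rightarrow> nat \<Rightarrow> complex mat \<Rightarrow> (nat \<Rightarrow> real) \<Rightarrow> complex mat \<Rightarrow> bool" where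
  "is_svd M q V s U \<longleftrightarrow>
     V \<in> carrier_mat (dim_row M) q \<and> U \<in> carrier_mat (dim_col M) q \<and>
     mat_adjoint V * V = 1\<^sub>m q \<and> mat_adjoint U * U = 1\<^sub>m q \<and> (\<forall>i<q. 0 \<le> s i) \<and>
     M = V * mat_diag q (\<lambda>i. complex_of_real (s i)) * mat_adjoint U"

text \<open>The data carried along are the Kraus dimensions and the purification operator. The bond
  dimensions and tensors are not carried along because every step may first change the gauge.\<close>

type_synonym purification = "(nat \<Rightarrow> nat) \<times> complex mat"

text \<open>Change of the Kraus index of site \<open>l\<close> by an isometry \<open>W\<close>. The second case removes an isometry: it
  is used to drop the part of the Kraus space that became superfluous by the truncation.\<close>

definition kraus_isometry :: "nat \<Rightarrow> nat \<Rightarrow> nat \<Rightarrow> purification \<Rightarrow> purification \<Rightarrow> bool" where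
  "kraus_isometry d N l = (\<lambda>(K, Y) (K', X). \<exists>k' W. K' = K(l := k') \<and>
     X \<in> carrier_mat (d ^ N) (\<Prod>k\<in>{1..N}. K' k) \<and>
     (W \<in> carrier_mat (K l) k' \<and> W * mat_adjoint W = 1\<^sub>m (K l) \<and> X = Y * on_sites K N l l W \<or>
      W \<in> carrier_mat k' (K l) \<and> W * mat_adjoint W = 1\<^sub>m k' \<and> Y = X * on_sites K N l l W))"

text \<open>One compression step at virtual index \<open>j\<close> of site \<open>l\<close> with discarded weight \<open>\<delta>\<close>; \<open>Z\<close> is the set of
  discarded positions and \<open>c\<close> the rescaling factor.\<close>

definition compression ::
  "nat \<Rightarrow> nat \<Rightarrow> nat \<Rightarrow> nat \<Rightarrow> real \<Rightarrow> purification \<Rightarrow> purification \<Rightarrow> bool" where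
  "compression d N l j \<delta> = (\<lambda>(K, X) P'. \<exists>D A A' q V s U Z c Y.
     bond_dims N D \<and> X = lpf_op d N K D A \<and> mixed_canonical d N K D A l \<and>
     is_svd (unfolding_mat j d (K l) (D (l - 1)) (D l) (A l)) q V s U \<and>
     Z \<subseteq> {..<q} \<and> (\<forall>i\<in>Z. \<forall>i'\<in>{..<q} - Z. s i \<le> s i') \<and> (\<exists>i\<in>{..<q} - Z. s i \<noteq> 0) \<and>
     \<delta> = sqrt (\<Sum>i\<in>Z. (s i)\<^sup>2) \<and>
     0 < (c::real) \<and>
     unfolding_mat j d (K l) (D (l - 1)) (D l) A' =
       complex_of_real c \<cdot>\<^sub>m
         (V * mat_diag q (\<lambda>i. if i \<in> Z then 0 else complex_of_real (s i)) * mat_adjoint U) \<and>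
     Y = lpf_op d N K D (A(l := A')) \<and> frob_norm Y = 1 \<and>
     (if j = 2 then kraus_isometry d N l (K, Y) P' else P' = (K, Y)))"

fun compression_sweep ::
  "nat \<Rightarrow> nat \<Rightarrow> (nat \<Rightarrow> nat \<Rightarrow> real) \<Rightarrow> (nat \<times> nat) list \<Rightarrow> purification \<Rightarrow> purification \<Rightarrow> bool" where
  "compression_sweep d N \<delta> [] P P' \<longleftrightarrow> P' = P"
| "compression_sweep d N \<delta> ((l, j) # xs) P P' \<longleftrightarrow>
     (\<exists>Q. compression d N l j (\<delta> l j) P Q \<and> compression_sweep d N \<delta> xs Q P')"

text \<open>Contraction of Kraus operators \<open>B q1 q2\<close> of a channel \<open>E\<close> on sites \<open>l, l + 1\<close> into the purification.
  The Kraus index of the channel is a pair, whose components are joined with the Kraus indices of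
  sites \<open>l\<close> and \<open>l + 1\<close>: the joined index of \<open>r\<close> and \<open>q\<close> is \<open>r * Q + q\<close>. Taking \<open>Q1 = 1\<close> or \<open>Q2 = 1\<close> joins the
  whole Kraus index of the channel with that of a single site.\<close>

definition kraus_contraction ::
  "nat \<Rightarrow> nat \<Rightarrow> nat \<Rightarrow> superop \<Rightarrow> purification \<Rightarrow> purification \<Rightarrow> bool" where
  "kraus_contraction d N l E = (\<lambda>(K, X) (K', X'). \<exists>Q1 Q2 (B :: nat \<Rightarrow> nat \<Rightarrow> complex mat).
     (\<forall>q1<Q1. \<forall>q2<Q2. B q1 q2 \<in> carrier_mat (d ^ 2) (d ^ 2)) \<and>
     (\<forall>R\<in>carrier_mat (d ^ N) (d ^ N).
        E R = mat_sum (d ^ N) (d ^ N)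
          (\<lambda>(q1, q2). on_sites (\<lambda>_. d) N l (l + 1) (B q1 q2) * R *
             mat_adjoint (on_sites (\<lambda>_. d) N l (l + 1) (B q1 q2))) ({..<Q1} \<times> {..<Q2})) \<and>
     K' = K(l := K l * Q1, l + 1 := K (l + 1) * Q2) \<and>
     X' = mat (d ^ N) (\<Prod>k\<in>{1..N}. K' k) (\<lambda>(i, j). let r' = (\<lambda>k. site_index K' N k j) in
        (on_sites (\<lambda>_. d) N l (l + 1) (B (r' l mod Q1) (r' (l + 1) mod Q2)) * X)
          $$ (i, flat_index K N (r'(l := r' l div Q1, l + 1 := r' (l + 1) div Q2)))))"

fun kraus_contractions ::
  "nat \<Rightarrow> nat \<Rightarrow> (nat \<Rightarrow> superop) \<Rightarrow> nat list \<Rightarrow> purification \<Rightarrow> purification \<Rightarrow> bool" where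
  "kraus_contractions d N E [] P P' \<longleftrightarrow> P' = P"
| "kraus_contractions d N E (l # ls) P P' \<longleftrightarrow>
     (\<exists>Q. kraus_contraction d N l (E l) P Q \<and> kraus_contractions d N E ls Q P')"

text \<open>Layer \<open>k\<close> (numbered from \<open>1\<close>) of the Trotter-Suzuki product is the exponential of
  \<open>layer_time t m k\<close> times the sum of the local terms in \<open>layer_bonds N k\<close>, where the term number \<open>l\<close>
  acts on sites \<open>l, l + 1\<close>.\<close>

definition layer_bonds :: "nat \<Rightarrow> nat \<Rightarrow> nat list" where
  "layer_bonds N k = filter (\<lambda>l. even l = even k) [1..<N]"

definition layer_time :: "real \<Rightarrow> nat \<Rightarrow> nat \<Rightarrow> real" where
  "layer_time t m k = (if k = 1 \<or> k = 2 * m + 1 then t / real m / 2 else t / real m)"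

text \<open>The first conjunct says how the update is performed, the second one that it is exact; the
  channels of one layer act on disjoint pairs of sites, so their order is immaterial.\<close>

definition layer_update ::
  "nat \<Rightarrow> nat \<Rightarrow> (nat \<Rightarrow> superop) \<Rightarrow> real \<Rightarrow> nat list \<Rightarrow> purification \<Rightarrow> purification \<Rightarrow> bool" where
  "layer_update d N L \<tau> ls P P' \<longleftrightarrow>
     kraus_contractions d N (\<lambda>l. superop_exp (d ^ N) \<tau> (L l)) ls P P' \<and>
     snd P' * mat_adjoint (snd P') =
       superop_exp (d ^ N) \<tau> (local_sum d N L (set ls)) (snd P * mat_adjoint (snd P))"

definition lpf_simulation ::
  "nat \<Rightarrow> nat \<Rightarrow> (nat \<Rightarrow> superop) \<Rightarrow> real \<Rightarrow> nat \<Rightarrow> (nat \<Rightarrow> nat \<Rightarrow> nat \<Rightarrow> real) \<Rightarrow>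
   purification \<Rightarrow> purification \<Rightarrow> bool" where
  "lpf_simulation d N L t m \<delta> P P' \<longleftrightarrow> (\<exists>F.
     F 0 = P \<and> F (2 * m + 1) = P' \<and>
     (\<forall>k\<in>{1..2 * m + 1}. \<exists>Q.
        layer_update d N L (layer_time t m k) (layer_bonds N k) (F (k - 1)) Q \<and>
        compression_sweep d N (\<delta> k) (List.product [1..<N + 1] [1, 2, 3]) Q (F k)))"

end

(*
  The trace norm of a Hermitian R is the least value of tr P + tr Q over the decompositions R = P - Q
  into positive parts. This makes positive trace preserving maps contractive, and polarization gives
  |X X* - Y Y*|_1 <= |X - Y|_2 |X + Y|_2, which for a compression step equals twice its discarded weight,
  because in mixed canonical form the tensor at the chosen site determines the purification isometrically.
  The layers are contractions, so these errors add up to 6 (2m + 1) N \<delta>max.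

  Contractivity of exp (s L), s >= 0, follows from a bound 1 + O(e^2) on 1 + e L. Writing A, B for the odd
  and even parts of the generator, differentiating exp ((\<tau> - s) (A + B)) exp (s A / 2) exp (s B) exp (s A / 2)
  in s and using only forward evolution bounds the error of one Strang step by
  \<tau>^3 (|[A,[A,B]]| / 24 + |[B,[A,B]]| / 12). Locality leaves at most N - 1 nonzero terms in [A,B], so this
  is at most (\<tau> b)^3 N^2 / 4.
*)

theory Submission
  imports Defs "HOL-Analysis.Derivative" "HOL-Analysis.Bounded_Continuous_Function"
begin

hide_const (open) Finite_Cartesian_Product.mat Finite_Cartesian_Product.vec Finite_Cartesian_Product.row
hide_type (open) Finite_Cartesian_Product.vec
no_notation Finite_Cartesian_Product.vec_nth (infixl "$" 90)
no_notation inner (infix "\<bullet>" 70)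

section \<open>Hermitian matrices and the trace norm\<close>

text \<open>All estimates are made on Hermitian operators: there the sign of an operator, read off
  its eigenvalues, plays the part of the polar decomposition, and every map that occurs preserves
  Hermiticity. Two norms are kept apart. That of a Banach algebra provides exponentials, series and
  derivatives; the sharp constants refer to the norm induced by the trace norm, which makes sense
  only for maps preserving Hermiticity and is therefore handled as a relation. The obstacle in the
  splitting error is that exp (- s L) is in general no contraction, so every interpolating family is
  arranged such that its derivative contains exponentials at nonnegative times only. Constants: one
  layer is followed by 3 N compressions of cost 2 \<delta>max. With x even and y odd bonds the
  double commutators are at most 8 b^3 x y and 8 b^3 x^2, so one time step costs (\<tau> b)^3 x (y +
  2 x) / 3; at x = y = N / 2 this equals (\<tau> b)^3 N^2 / 4. Summing m steps of length t / m
  leaves the factor 1 / m^2.\<close>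

lemma mat_adjoint_dim [simp]:
  "dim_row (mat_adjoint A) = dim_col A" "dim_col (mat_adjoint A) = dim_row A"
  by (auto simp: mat_adjoint_def)

lemma mat_adjoint_carrier [simp]: "A \<in> carrier_mat n m \<Longrightarrow> mat_adjoint A \<in> carrier_mat m n"
  by auto

lemma mat_adjoint_index [simp]:
  assumes "i < dim_col A" "j < dim_row A"
  shows "mat_adjoint (A :: complex mat) $$ (i, j) = cnj (A $$ (j, i))"
  using assms by (simp add: mat_adjoint_def mat_of_rows_index)

lemma mat_adjoint_adjoint [simp]: "mat_adjoint (mat_adjoint (A :: complex mat)) = A"
  by (rule eq_matI) auto

lemma index_mult_mat_sum:
  assumes "i < dim_row A" "j < dim_col B" "dim_row B = dim_col A"
  shows "(A * B) $$ (i, j) = (\<Sum>k<dim_col A. A $$ (i, k) * B $$ (k, j))"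
  using assms by (auto simp: scalar_prod_def atLeast0LessThan intro!: sum.cong)

lemma mat_adjoint_mult:
  fixes A B :: "complex mat"
  assumes "A \<in> carrier_mat n m" "B \<in> carrier_mat m k"
  shows "mat_adjoint (A * B) = mat_adjoint B * mat_adjoint A"
  by (rule eq_matI) (use assms in \<open>auto simp: index_mult_mat_sum mult.commute simp del: index_mult_mat(1)\<close>)

lemma mult_mat_vec_in_carrier [simp]: "dim_row A = m \<Longrightarrow> A *\<^sub>v w \<in> carrier_vec m"
  by (metis carrier_vec_dim_vec dim_mult_mat_vec)

lemma mat_adjoint_add:
  fixes A B :: "complex mat"
  assumes "A \<in> carrier_mat n m" "B \<in> carrier_mat n m"
  shows "mat_adjoint (A + B) = mat_adjoint A + mat_adjoint B"
  by (rule eq_matI) (use assms in auto)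

lemma mat_adjoint_minus:
  fixes A B :: "complex mat"
  assumes "A \<in> carrier_mat n m" "B \<in> carrier_mat n m"
  shows "mat_adjoint (A - B) = mat_adjoint A - mat_adjoint B"
  by (rule eq_matI) (use assms in auto)

lemma mat_adjoint_smult:
  fixes A :: "complex mat"
  shows "mat_adjoint (c \<cdot>\<^sub>m A) = cnj c \<cdot>\<^sub>m mat_adjoint A"
  by (rule eq_matI) auto

lemma mat_adjoint_one [simp]: "mat_adjoint (1\<^sub>m n) = (1\<^sub>m n :: complex mat)"
  by (rule eq_matI) auto

lemma mat_adjoint_diag: "mat_adjoint (mat_diag n f) = mat_diag n (\<lambda>i. cnj (f i))"
  by (rule eq_matI) (auto simp: mat_diag_def)

section \<open>Trace and Frobenius norm\<close>

lemma mtr_add: "A \<in> carrier_mat n n \<Longrightarrow> B \<in> carrier_mat n n \<Longrightarrow> mtr (A + B) = mtr A + mtr B"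
  by (auto simp: mtr_def sum.distrib)

lemma mtr_minus: "A \<in> carrier_mat n n \<Longrightarrow> B \<in> carrier_mat n n \<Longrightarrow> mtr (A - B) = mtr A - mtr B"
  by (auto simp: mtr_def sum_subtractf)

lemma mtr_smult: "A \<in> carrier_mat n n \<Longrightarrow> mtr (c \<cdot>\<^sub>m A) = c * mtr A"
  by (auto simp: mtr_def sum_distrib_left)

lemma mtr_mult:
  assumes "A \<in> carrier_mat n m" "B \<in> carrier_mat m n"
  shows "mtr (A * B) = (\<Sum>i<n. \<Sum>k<m. A $$ (i, k) * B $$ (k, i))"
  using assms by (auto simp: mtr_def index_mult_mat_sum simp del: index_mult_mat(1))

lemma mtr_mult_commute:
  assumes "A \<in> carrier_mat n m" "B \<in> carrier_mat m n"
  shows "mtr (A * B) = mtr (B * A)"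
  unfolding mtr_mult[OF assms] mtr_mult[OF assms(2,1)]
  by (subst sum.swap) (simp add: mult.commute)

lemma mtr_adjoint_mult_self:
  assumes "X \<in> carrier_mat n m"
  shows "mtr (mat_adjoint X * X) = of_real (\<Sum>i<n. \<Sum>j<m. (cmod (X $$ (i, j)))\<^sup>2)"
proof -
  have "mtr (mat_adjoint X * X) = (\<Sum>j<m. \<Sum>i<n. of_real ((cmod (X $$ (i, j)))\<^sup>2))"
    using assms by (subst mtr_mult[of _ m n])
      (auto intro!: sum.cong simp: complex_norm_square[symmetric] mult.commute)
  then show ?thesis
    by (subst sum.swap) simp
qed

lemma frob_norm_sq:
  assumes "X \<in> carrier_mat n m"
  shows "(frob_norm X)\<^sup>2 = (\<Sum>i<n. \<Sum>j<m. (cmod (X $$ (i, j)))\<^sup>2)"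
  unfolding frob_norm_def mtr_adjoint_mult_self[OF assms]
  by (simp add: sum_nonneg)

lemma frob_norm_nonneg [simp]: "0 \<le> frob_norm X"
proof -
  have "X \<in> carrier_mat (dim_row X) (dim_col X)" by auto
  from mtr_adjoint_mult_self[OF this] show ?thesis
    by (simp add: frob_norm_def sum_nonneg)
qed

lemma mtr_self_mult_adjoint:
  assumes "X \<in> carrier_mat n m"
  shows "mtr (X * mat_adjoint X) = of_real ((frob_norm X)\<^sup>2)"
  unfolding frob_norm_sq[OF assms]
  using mtr_mult_commute[of X n m "mat_adjoint X"] mtr_adjoint_mult_self[OF assms] assms by simp

section \<open>Hermitian and positive semidefinite matrices\<close>

lemma hermitian_index:
  assumes "hermitian_mat n A" "i < n" "j < n"
  shows "A $$ (i, j) = cnj (A $$ (j, i))"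
proof -
  have "A $$ (i, j) = mat_adjoint A $$ (i, j)" using assms by (simp add: hermitian_mat_def)
  also have "\<dots> = cnj (A $$ (j, i))"
    using assms by (subst mat_adjoint_index) (auto simp: hermitian_mat_def)
  finally show ?thesis .
qed

lemma hermitianI:
  assumes "A \<in> carrier_mat n n" "\<And>i j. i < n \<Longrightarrow> j < n \<Longrightarrow> A $$ (i, j) = cnj (A $$ (j, i))"
  shows "hermitian_mat n A"
  unfolding hermitian_mat_def using assms(1)
  by (auto intro!: eq_matI simp: assms(2)[symmetric])

lemma hermitian_carrier: "hermitian_mat n A \<Longrightarrow> A \<in> carrier_mat n n"
  by (simp add: hermitian_mat_def)

lemma hermitian_adjoint: "hermitian_mat n A \<Longrightarrow> mat_adjoint A = A"
  by (simp add: hermitian_mat_def)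

lemma hermitian_add: "hermitian_mat n A \<Longrightarrow> hermitian_mat n B \<Longrightarrow> hermitian_mat n (A + B)"
  by (auto simp: hermitian_mat_def mat_adjoint_add)

lemma hermitian_minus: "hermitian_mat n A \<Longrightarrow> hermitian_mat n B \<Longrightarrow> hermitian_mat n (A - B)"
  by (auto simp: hermitian_mat_def mat_adjoint_minus minus_carrier_mat)

lemma hermitian_smult: "hermitian_mat n A \<Longrightarrow> hermitian_mat n (of_real c \<cdot>\<^sub>m A)"
  by (auto simp: hermitian_mat_def mat_adjoint_smult)

lemma hermitian_conj:
  assumes "hermitian_mat n A" "M \<in> carrier_mat m n"
  shows "hermitian_mat m (M * A * mat_adjoint M)"
proof -
  have A: "A \<in> carrier_mat n n" "mat_adjoint A = A"
    using assms(1) by (auto simp: hermitian_mat_def)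
  have M: "mat_adjoint M \<in> carrier_mat n m" using assms(2) by simp
  have "mat_adjoint (M * A * mat_adjoint M) = mat_adjoint (mat_adjoint M) * mat_adjoint (M * A)"
    by (rule mat_adjoint_mult) (use A M assms(2) in auto)
  also have "mat_adjoint (M * A) = A * mat_adjoint M"
    using mat_adjoint_mult[OF assms(2) A(1)] A(2) by simp
  also have "mat_adjoint (mat_adjoint M) * (A * mat_adjoint M) = M * A * mat_adjoint M"
    using assoc_mult_mat[OF assms(2) A(1) M] by simp
  finally show ?thesis
    unfolding hermitian_mat_def using mult_carrier_mat[OF mult_carrier_mat[OF assms(2) A(1)] M] by blast
qed

lemma hermitian_self_adjoint:
  assumes "M \<in> carrier_mat m n"
  shows "hermitian_mat m (M * mat_adjoint M)"
  using assms by (auto simp: hermitian_mat_def mat_adjoint_mult[of _ m n _ m])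

lemma hermitian_mtr: "hermitian_mat n A \<Longrightarrow> mtr A = of_real (Re (mtr A))"
proof -
  assume a: "hermitian_mat n A"
  have "cnj (mtr A) = mtr A"
    using hermitian_carrier[OF a] by (auto simp: mtr_def hermitian_index[OF a, symmetric] intro!: sum.cong)
  then show ?thesis
    by (metis Reals_cnj_iff of_real_Re)
qed

lemma cscalar_prod_sum:
  fixes v :: "complex vec"
  assumes "v \<in> carrier_vec n" "w \<in> carrier_vec n"
  shows "v \<bullet>c w = (\<Sum>i<n. v $ i * cnj (w $ i))"
  using assms by (auto simp: scalar_prod_def atLeast0LessThan)

lemma cscalar_prod_self:
  fixes v :: "complex vec"
  assumes "v \<in> carrier_vec n"
  shows "v \<bullet>c v = of_real (\<Sum>i<n. (cmod (v $ i))\<^sup>2)"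
  by (simp add: cscalar_prod_sum[OF assms assms] complex_norm_square del: of_real_power)

lemma cscalar_prod_mult_mat:
  fixes A :: "complex mat"
  assumes "A \<in> carrier_mat n m" "v \<in> carrier_vec m" "w \<in> carrier_vec n"
  shows "(A *\<^sub>v v) \<bullet>c w = v \<bullet>c (mat_adjoint A *\<^sub>v w)"
proof -
  have "(A *\<^sub>v v) \<bullet>c w = (\<Sum>i<n. (\<Sum>j<m. A $$ (i, j) * v $ j) * cnj (w $ i))"
    using assms by (subst cscalar_prod_sum[of _ n]) (auto simp: scalar_prod_def atLeast0LessThan intro!: sum.cong)
  also have "\<dots> = (\<Sum>j<m. v $ j * (\<Sum>i<n. A $$ (i, j) * cnj (w $ i)))"
    by (simp add: sum_distrib_left sum_distrib_right) (subst sum.swap, simp add: mult_ac)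
  also have "\<dots> = v \<bullet>c (mat_adjoint A *\<^sub>v w)"
    using assms by (subst cscalar_prod_sum[of _ m]) (auto simp: scalar_prod_def atLeast0LessThan intro!: sum.cong)
  finally show ?thesis .
qed

lemma psd_hermitian: "psd n A \<Longrightarrow> hermitian_mat n A"
  by (simp add: psd_def)

lemma psd_carrier: "psd n A \<Longrightarrow> A \<in> carrier_mat n n"
  by (simp add: psd_def hermitian_mat_def)

lemma psd_add: "psd n A \<Longrightarrow> psd n B \<Longrightarrow> psd n (A + B)"
  unfolding psd_def
  by (auto simp: hermitian_add add_mult_distrib_mat_vec[OF hermitian_carrier hermitian_carrier]
      add_scalar_prod_distrib[of _ n] hermitian_carrier[THEN mult_mat_vec_carrier])

lemma smult_mat_mult_vec:
  "A \<in> carrier_mat n m \<Longrightarrow> v \<in> carrier_vec m \<Longrightarrow> (c \<cdot>\<^sub>m A) *\<^sub>v v = c \<cdot>\<^sub>v (A *\<^sub>v (v :: complex vec))"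
  by (rule eq_vecI) auto

lemma psd_smult: "psd n A \<Longrightarrow> 0 \<le> c \<Longrightarrow> psd n (of_real c \<cdot>\<^sub>m A)"
  unfolding psd_def
  by (auto simp: hermitian_smult smult_mat_mult_vec[of _ n n] hermitian_carrier
     hermitian_carrier[THEN mult_mat_vec_carrier] smult_scalar_prod_distrib[of _ n])

lemma psd_conj:
  assumes "psd n A" "M \<in> carrier_mat m n"
  shows "psd m (M * A * mat_adjoint M)"
  unfolding psd_def
proof (intro conjI ballI)
  show "hermitian_mat m (M * A * mat_adjoint M)"
    using assms by (auto intro: hermitian_conj psd_hermitian)
  fix v :: "complex vec" assume v: "v \<in> carrier_vec m"
  note c = psd_carrier[OF assms(1)] assms(2) v
  have "((M * A * mat_adjoint M) *\<^sub>v v) = M *\<^sub>v (A *\<^sub>v (mat_adjoint M *\<^sub>v v))"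
    using c assoc_mult_mat_vec[OF mult_carrier_mat[OF c(2,1)] mat_adjoint_carrier[OF c(2)] c(3)]
      assoc_mult_mat_vec[OF c(2,1) mult_mat_vec_carrier[OF mat_adjoint_carrier[OF c(2)] c(3)]]
    by simp
  then have "((M * A * mat_adjoint M) *\<^sub>v v) \<bullet>c v = (A *\<^sub>v (mat_adjoint M *\<^sub>v v)) \<bullet>c (mat_adjoint M *\<^sub>v v)"
    using c by (simp add: cscalar_prod_mult_mat[of M m n])
  moreover have "mat_adjoint M *\<^sub>v v \<in> carrier_vec n" using c by simp
  ultimately show "0 \<le> Re (((M * A * mat_adjoint M) *\<^sub>v v) \<bullet>c v)"
    using assms(1) by (auto simp: psd_def)
qed

lemma psd_diag:
  assumes "\<And>i. i < n \<Longrightarrow> 0 \<le> f i"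
  shows "psd n (mat_diag n (\<lambda>i. of_real (f i)))"
  unfolding psd_def
proof (intro conjI ballI)
  show "hermitian_mat n (mat_diag n (\<lambda>i. complex_of_real (f i)))"
    by (auto simp: hermitian_mat_def mat_adjoint_diag)
  fix v :: "complex vec" assume v: "v \<in> carrier_vec n"
  have e: "(mat_diag n (\<lambda>i. of_real (f i)) *\<^sub>v v) $ i = of_real (f i) * v $ i" if "i < n" for i
  proof -
    have "(mat_diag n (\<lambda>i. of_real (f i)) *\<^sub>v v) $ i = (\<Sum>k\<in>{0..<n}. if k = i then of_real (f i) * v $ i else 0)"
      using that v by (auto simp: mat_diag_def scalar_prod_def simp del: sum.delta sum.delta' intro!: sum.cong)
    then show ?thesis using that by simp
  qed
  have w: "mat_diag n (\<lambda>i. of_real (f i)) *\<^sub>v v \<in> carrier_vec n"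
    using v mult_mat_vec_carrier[OF mat_diag_dim] by blast
  have "(mat_diag n (\<lambda>i. of_real (f i)) *\<^sub>v v) \<bullet>c v = (\<Sum>i<n. of_real (f i * (cmod (v $ i))\<^sup>2))"
    unfolding cscalar_prod_sum[OF w v]
    by (auto intro!: sum.cong simp: e complex_norm_square mult_ac simp del: of_real_power)
  then show "0 \<le> Re ((mat_diag n (\<lambda>i. of_real (f i)) *\<^sub>v v) \<bullet>c v)"
    by (auto intro!: sum_nonneg mult_nonneg_nonneg assms)
qed

lemma psd_one: "psd n (1\<^sub>m n)"
  using psd_diag[of n "\<lambda>_. 1"] by simp

lemma psd_self_adjoint:
  assumes "M \<in> carrier_mat m n"
  shows "psd m (M * mat_adjoint M)"
  using psd_conj[OF psd_one assms] assms by simp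

lemma psd_zero: "psd n (0\<^sub>m n n)"
proof -
  have "mat_diag n (\<lambda>i. complex_of_real 0) = 0\<^sub>m n n"
    by (rule eq_matI) (auto simp: mat_diag_def)
  then show ?thesis using psd_diag[of n "\<lambda>_. 0"] by simp
qed

text \<open>Test vector \<open>e\<^sub>i + w e\<^sub>j\<close>.\<close>

lemma psd_test:
  assumes "psd n A" "i < n" "j < n" "i \<noteq> j"
  shows "0 \<le> Re (A $$ (i, i) + cnj w * A $$ (j, i) + w * A $$ (i, j) + w * cnj w * A $$ (j, j))"
proof -
  define v where "v = vec n (\<lambda>k. if k = i then 1 else if k = j then w else 0)"
  have v: "v \<in> carrier_vec n" by (simp add: v_def)
  have A: "A \<in> carrier_mat n n" by (rule psd_carrier[OF assms(1)])
  have s: "(\<Sum>k<n. g k * v $ k) = g i + g j * w" for g :: "nat \<Rightarrow> complex"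
  proof -
    have "(\<Sum>k<n. g k * v $ k) = (\<Sum>k<n. (if k = i then g k else 0) + (if k = j then g k * w else 0))"
      using assms(4) by (intro sum.cong) (auto simp: v_def)
    also have "\<dots> = g i + g j * w" using assms by (simp add: sum.distrib)
    finally show ?thesis .
  qed
  have s': "(\<Sum>k<n. g k * cnj (v $ k)) = g i + g j * cnj w" for g :: "nat \<Rightarrow> complex"
    using arg_cong[OF s[of "\<lambda>k. cnj (g k)"], of cnj] by simp
  have Av: "(A *\<^sub>v v) $ k = A $$ (k, i) + A $$ (k, j) * w" if "k < n" for k
    using that A v s[of "\<lambda>l. A $$ (k, l)"] by (simp add: scalar_prod_def atLeast0LessThan)
  have "(A *\<^sub>v v) \<bullet>c v = (\<Sum>k<n. (A *\<^sub>v v) $ k * cnj (v $ k))"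
    using A v by (intro cscalar_prod_sum) auto
  also have "\<dots> = (A *\<^sub>v v) $ i + (A *\<^sub>v v) $ j * cnj w" by (rule s')
  finally show ?thesis
    using assms v Av by (auto simp: psd_def algebra_simps)
qed

lemma psd_diag_nonneg:
  assumes "psd n A" "i < n"
  shows "0 \<le> Re (A $$ (i, i))" 
proof -
  define v :: "complex vec" where "v = unit_vec n i"
  have A: "A \<in> carrier_mat n n" by (rule psd_carrier[OF assms(1)])
  have v: "v \<in> carrier_vec n" by (simp add: v_def)
  have "(A *\<^sub>v v) \<bullet>c v = (\<Sum>k<n. (A *\<^sub>v v) $ k * cnj (v $ k))"
    using A v by (intro cscalar_prod_sum) auto
  also have "\<dots> = (\<Sum>k<n. if k = i then (A *\<^sub>v v) $ i else 0)"
    using assms(2) by (intro sum.cong) (auto simp: v_def unit_vec_def)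
  also have "\<dots> = A $$ (i, i)"
    using A assms(2) by (simp add: v_def)
  finally show ?thesis using assms(1) v by (auto simp: psd_def)
qed

lemma psd_mtr_nonneg: "psd n A \<Longrightarrow> 0 \<le> Re (mtr A)"
  using psd_carrier[of n A] by (auto simp: mtr_def intro!: sum_nonneg psd_diag_nonneg)

text \<open>Testing positivity on a basis vector plus a unimodular multiple of another one gives 2
  |A_ij| \<le> A_ii + A_jj, and all diagonal entries are nonnegative.\<close>

lemma psd_index_le:
  assumes "psd n A" "i < n" "j < n"
  shows "cmod (A $$ (i, j)) \<le> Re (mtr A)"
proof -
  have tr: "Re (mtr A) = (\<Sum>k<n. Re (A $$ (k, k)))"
    using psd_carrier[OF assms(1)] by (auto simp: mtr_def)
  show ?thesis
  proof (cases "i = j")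
    case True
    have "A $$ (i, i) = of_real (Re (A $$ (i, i)))"
      using hermitian_index[OF psd_hermitian[OF assms(1)] assms(2,2)]
      by (metis Reals_cnj_iff of_real_Re)
    then have "cmod (A $$ (i, i)) = Re (A $$ (i, i))"
      using psd_diag_nonneg[OF assms(1,2)] by (metis abs_of_nonneg norm_of_real)
    also have "\<dots> \<le> Re (mtr A)"
      unfolding tr using assms by (intro member_le_sum) (auto intro: psd_diag_nonneg)
    finally show ?thesis using True by simp
  next
    case False
    define z where "z = A $$ (i, j)"
    \<comment> \<open>The phase for which w z = - |z|; for z = 0 it is replaced by 0.\<close>
    define w where "w = (if z = 0 then 0 else - cnj z / cmod z)"
    have ww: "w * cnj w = (if z = 0 then 0 else 1)" "w * z = - of_real (cmod z)"
    proof -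
      have "z * cnj z = of_real (cmod z) * of_real (cmod z)"
        using complex_norm_square[of z] by (simp add: power2_eq_square)
      then show "w * cnj w = (if z = 0 then 0 else 1)" "w * z = - of_real (cmod z)"
        by (auto simp: w_def field_simps)
    qed
    have zz: "A $$ (j, i) = cnj z"
      using hermitian_index[OF psd_hermitian[OF assms(1)] assms(3,2)] by (simp add: z_def)
    have "cnj w * cnj z = - of_real (cmod z)"
      using arg_cong[OF ww(2), of cnj] by simp
    then have "0 \<le> Re (A $$ (i, i)) - cmod z - cmod z + (if z = 0 then 0 else Re (A $$ (j, j)))"
      using psd_test[OF assms False, of w] ww by (auto simp: zz z_def[symmetric] split: if_splits)
    then have "2 * cmod z \<le> Re (A $$ (i, i)) + Re (A $$ (j, j))"
      using psd_diag_nonneg[OF assms(1,3)] by (auto split: if_splits)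
    also have "\<dots> = (\<Sum>k\<in>{i, j}. Re (A $$ (k, k)))" using False by simp
    also have "\<dots> \<le> Re (mtr A)"
      unfolding tr using assms by (intro sum_mono2) (auto intro: psd_diag_nonneg)
    finally show ?thesis
      using norm_ge_zero[of z] unfolding z_def by linarith
  qed
qed


section \<open>Spectral theorem for Hermitian matrices\<close>

lemma mat_mult_one_right_inverse:
  fixes U :: "complex mat"
  assumes "U \<in> carrier_mat n n" "mat_adjoint U * U = 1\<^sub>m n"
  shows "U * mat_adjoint U = 1\<^sub>m n"
  by (rule mat_mult_left_right_inverse[OF mat_adjoint_carrier[OF assms(1)] assms])

text \<open>By Schur triangularization the trace is the sum of the n eigenvalues, which would be n
  \<mu> if all of them were \<mu>.\<close>

lemma exists_eigenvalue_neq: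
  assumes A: "A \<in> carrier_mat n n" and ne: "mtr A \<noteq> of_nat n * \<mu>"
  obtains e v where "e \<noteq> \<mu>" "v \<in> carrier_vec n" "v \<noteq> 0\<^sub>v n" "A *\<^sub>v v = e \<cdot>\<^sub>v v"
proof -
  obtain es where es: "char_poly A = (\<Prod>a\<leftarrow>es. [:- a, 1:])" "length es = n"
    using char_poly_factorized[OF A] by auto
  obtain B P Q where "schur_decomposition A es = (B, P, Q)" by (cases "schur_decomposition A es")
  from schur_decomposition[OF A es(1) this]
  have w: "similar_mat_wit A B P Q" and d: "diag_mat B = es" by auto
  from similar_mat_witD2[OF A w]
  have c: "P \<in> carrier_mat n n" "Q \<in> carrier_mat n n" "B \<in> carrier_mat n n"
    and QP: "Q * P = 1\<^sub>m n" and AE: "A = P * B * Q" by auto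
  have "mtr A = mtr (Q * (P * B))"
    unfolding AE by (rule mtr_mult_commute) (use c in auto)
  also have "Q * (P * B) = B"
    using c QP by (metis assoc_mult_mat left_mult_one_mat)
  also have "mtr B = sum_list es"
    unfolding d[symmetric] using c by (simp add: mtr_def diag_mat_def sum_list_sum_nth atLeast0LessThan)
  finally have tr: "mtr A = sum_list es" .
  have "\<exists>e\<in>set es. e \<noteq> \<mu>"
  proof (rule ccontr)
    assume "\<not> (\<exists>e\<in>set es. e \<noteq> \<mu>)"
    then have "es = replicate n \<mu>" using es(2) by (auto intro!: replicate_eqI)
    then show False using tr ne by (simp add: sum_list_replicate)
  qed
  then obtain e where e: "e \<in> set es" "e \<noteq> \<mu>" by auto
  then have "poly (char_poly A) e = 0"
    unfolding es(1) poly_prod_list by (auto simp: prod_list_zero_iff)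
  then have "eigenvalue A e" using eigenvalue_root_char_poly[OF A] by simp
  then obtain v where "eigenvector A v e" by (auto simp: eigenvalue_def)
  then show thesis using that[OF e(2)] A by (auto simp: eigenvector_def)
qed

text \<open>Deflation: moving the known eigenvalues to a common value \<open>\<mu>\<close> that is not the mean of the
  spectrum forces an eigenvalue different from \<open>\<mu>\<close>, whose eigenvectors are orthogonal to the known ones.\<close>

lemma hermitian_eigenvector_extend:
  assumes A: "hermitian_mat n A" and kn: "k < n"
    and U: "U \<in> carrier_mat n k" and UU: "mat_adjoint U * U = 1\<^sub>m k"
    and AU: "A * U = U * mat_diag k (\<lambda>i. of_real (l i))"
  obtains v c where "v \<in> carrier_vec n" "v \<bullet>c v = 1" "mat_adjoint U *\<^sub>v v = 0\<^sub>v k"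
    "A *\<^sub>v v = of_real c \<cdot>\<^sub>v v"
proof -
  \<comment> \<open>The mean of the n - k eigenvalues not yet found, plus 1; the shift by 1 keeps
    \<mu> away from the mean of the spectrum of the deflated matrix.\<close>
  define \<mu> where "\<mu> = (Re (mtr A) - (\<Sum>i<k. l i)) / real (n - k) + 1"
  define D where "D = mat_diag k (\<lambda>i. complex_of_real (\<mu> - l i))"
  have Ac: "A \<in> carrier_mat n n" "mat_adjoint A = A" using A by (auto simp: hermitian_mat_def)
  have Dc: "D \<in> carrier_mat k k" by (simp add: D_def)
  have Ua: "mat_adjoint U \<in> carrier_mat k n" using U by simp
  have UD: "U * D \<in> carrier_mat n k" using U Dc by simp
  have UDU: "U * D * mat_adjoint U \<in> carrier_mat n n" using UD Ua by simp
  define Ak where "Ak = A + U * D * mat_adjoint U"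
  have Akc: "Ak \<in> carrier_mat n n" using Ac UDU by (simp add: Ak_def)
  have "hermitian_mat k D" by (auto simp: hermitian_mat_def D_def mat_adjoint_diag)
  then have "hermitian_mat n Ak"
    unfolding Ak_def using U by (intro hermitian_add A hermitian_conj[of k])
  then have Aka: "mat_adjoint Ak = Ak" by (rule hermitian_adjoint)
  have "mtr (U * D * mat_adjoint U) = mtr (mat_adjoint U * (U * D))"
    by (rule mtr_mult_commute[OF UD Ua])
  also have "mat_adjoint U * (U * D) = D"
    using assoc_mult_mat[OF Ua U Dc] UU Dc by simp
  also have "mtr D = of_real (real k * \<mu> - (\<Sum>i<k. l i))"
    by (simp add: mtr_def D_def mat_diag_def sum_subtractf)
  finally have "mtr Ak = of_real (Re (mtr A) + real k * \<mu> - (\<Sum>i<k. l i))"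
    unfolding Ak_def mtr_add[OF Ac(1) UDU] using hermitian_mtr[OF A] by simp
  moreover have "real n * \<mu> \<noteq> Re (mtr A) + real k * \<mu> - (\<Sum>i<k. l i)"
  proof
    assume "real n * \<mu> = Re (mtr A) + real k * \<mu> - (\<Sum>i<k. l i)"
    then have "real (n - k) * \<mu> = Re (mtr A) - (\<Sum>i<k. l i)"
      using kn by (simp add: of_nat_diff algebra_simps)
    moreover have "real (n - k) * \<mu> = Re (mtr A) - (\<Sum>i<k. l i) + real (n - k)"
      using kn by (simp add: \<mu>_def distrib_left)
    ultimately show False using kn by simp
  qed
  ultimately have "mtr Ak \<noteq> of_nat n * of_real \<mu>"
    by (metis of_real_eq_iff of_real_mult of_real_of_nat_eq)
  from exists_eigenvalue_neq[OF Akc this] obtain e v where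
    e: "e \<noteq> of_real \<mu>" and v: "v \<in> carrier_vec n" "v \<noteq> 0\<^sub>v n" and Akv: "Ak *\<^sub>v v = e \<cdot>\<^sub>v v" .
  have "A * U + U * D = U * (mat_diag k (\<lambda>i. of_real (l i)) + D)"
    unfolding AU by (rule mult_add_distrib_mat[OF U _ Dc, symmetric]) simp
  also have "mat_diag k (\<lambda>i. of_real (l i)) + D = of_real \<mu> \<cdot>\<^sub>m 1\<^sub>m k"
    by (rule eq_matI) (auto simp: D_def mat_diag_def)
  also have "U * (of_real \<mu> \<cdot>\<^sub>m 1\<^sub>m k) = of_real \<mu> \<cdot>\<^sub>m U"
    using mult_smult_distrib[OF U, of "1\<^sub>m k" k] U by simp
  finally have "A * U + U * D = of_real \<mu> \<cdot>\<^sub>m U" .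
  moreover have "U * D * mat_adjoint U * U = U * D * 1\<^sub>m k"
    using assoc_mult_mat[OF UD Ua U] UU by simp
  moreover have "U * D * 1\<^sub>m k = U * D" by (rule right_mult_one_mat[OF UD])
  ultimately have AkU: "Ak * U = of_real \<mu> \<cdot>\<^sub>m U"
    unfolding Ak_def add_mult_distrib_mat[OF Ac(1) UDU U] by simp
  define y where "y = mat_adjoint U *\<^sub>v v"
  have y: "y \<in> carrier_vec k" using U v by (simp add: y_def)
  have "mat_adjoint U * Ak = of_real \<mu> \<cdot>\<^sub>m mat_adjoint U"
    using arg_cong[OF AkU, of mat_adjoint] mat_adjoint_mult[OF Akc U] by (simp add: Aka mat_adjoint_smult)
  \<comment> \<open>Letting \<open>Ak\<close> act to the left gives \<mu> y, to the right e y; as e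
    \<noteq> \<mu>, the overlap y with the known eigenvectors vanishes.\<close>
  then have "of_real \<mu> \<cdot>\<^sub>v y = mat_adjoint U *\<^sub>v (Ak *\<^sub>v v)"
    using assoc_mult_mat_vec[OF Ua Akc v(1)] smult_mat_mult_vec[OF Ua v(1)] by (simp add: y_def)
  also have "\<dots> = e \<cdot>\<^sub>v y" unfolding Akv y_def using mult_mat_vec[OF Ua v(1)] by simp
  finally have ey: "of_real \<mu> \<cdot>\<^sub>v y = e \<cdot>\<^sub>v y" .
  have y0: "y = 0\<^sub>v k"
  proof (rule eq_vecI)
    fix i assume i: "i < dim_vec (0\<^sub>v k)"
    then have "of_real \<mu> * y $ i = e * y $ i"
      using arg_cong[OF ey, of "\<lambda>w. w $ i"] y by simp
    then show "y $ i = 0\<^sub>v k $ i" using e i by simp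
  qed (use y in simp)
  have "(U * D * mat_adjoint U) *\<^sub>v v = (U * D) *\<^sub>v y"
    unfolding y_def by (rule assoc_mult_mat_vec[OF UD Ua v(1)])
  also have "\<dots> = 0\<^sub>v n" unfolding y0
  proof (rule eq_vecI)
    fix i assume "i < dim_vec (0\<^sub>v n :: complex vec)"
    then have "((U * D) *\<^sub>v 0\<^sub>v k) $ i = row (U * D) i \<bullet> 0\<^sub>v k" using UD by (subst index_mult_mat_vec) auto
    then show "((U * D) *\<^sub>v 0\<^sub>v k) $ i = 0\<^sub>v n $ i"
      using \<open>i < _\<close> UD by (simp add: scalar_prod_def)
  qed (use UD in auto)
  finally have Av: "A *\<^sub>v v = e \<cdot>\<^sub>v v"
    using Akv v Ac by (simp add: Ak_def add_mult_distrib_mat_vec[OF Ac(1) UDU v(1)])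
  define q where "q = (\<Sum>i<n. (cmod (v $ i))\<^sup>2)"
  have q: "v \<bullet>c v = of_real q" unfolding q_def by (rule cscalar_prod_self[OF v(1)])
  have q0: "q > 0"
  proof -
    have "v \<bullet>c v \<noteq> 0" using v by simp
    then have "q \<noteq> 0" using q by auto
    moreover have "q \<ge> 0" by (simp add: q_def sum_nonneg)
    ultimately show ?thesis by simp
  qed
  have "e * of_real q = (A *\<^sub>v v) \<bullet>c v"
    unfolding Av using v by (simp add: smult_scalar_prod_distrib[of _ n] q)
  also have "\<dots> = v \<bullet>c (A *\<^sub>v v)" using cscalar_prod_mult_mat[OF Ac(1) v(1,1)] Ac by simp
  also have "\<dots> = cnj e * of_real q"
    unfolding Av using v q by (simp add: conjugate_smult_vec)
  finally have "cnj e = e" using q0 by simp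
  then obtain c where c: "e = of_real c" by (metis Reals_cases Reals_cnj_iff)
  define w where "w = complex_of_real (1 / sqrt q) \<cdot>\<^sub>v v"
  show thesis
  proof
    show "w \<in> carrier_vec n" using v by (simp add: w_def)
    have "complex_of_real (sqrt q) * complex_of_real (sqrt q) = of_real q"
      using q0 by (metis of_real_mult real_sqrt_mult_self abs_of_pos)
    then show "w \<bullet>c w = 1"
      using v q q0 by (simp add: w_def conjugate_smult_vec smult_scalar_prod_distrib[of _ n] field_simps)
    show "mat_adjoint U *\<^sub>v w = 0\<^sub>v k"
      unfolding w_def mult_mat_vec[OF Ua v(1)] y0[unfolded y_def] by (rule eq_vecI) auto
    show "A *\<^sub>v w = of_real c \<cdot>\<^sub>v w"
      unfolding w_def mult_mat_vec[OF Ac(1) v(1)] Av c by (simp add: smult_smult_assoc mult.commute)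
  qed
qed

text \<open>Eigenvectors are collected one by one as the columns of \<open>U\<close>; for k = n the
  matrix is unitary and diagonalizes \<open>A\<close>.\<close>

lemma hermitian_partial_spectral:
  assumes A: "hermitian_mat n A" and "k \<le> n"
  shows "\<exists>U l. U \<in> carrier_mat n k \<and> mat_adjoint U * U = 1\<^sub>m k \<and>
    A * U = U * mat_diag k (\<lambda>i. complex_of_real (l i))"
  using assms(2)
proof (induction k)
  case 0
  have "A \<in> carrier_mat n n" using A by (rule hermitian_carrier)
  then show ?case
    by (intro exI[of _ "0\<^sub>m n 0"] exI[of _ "\<lambda>_. 0"]) (auto intro!: eq_matI simp: mat_diag_def)
next
  case (Suc k)
  then obtain U l where U: "U \<in> carrier_mat n k" and UU: "mat_adjoint U * U = 1\<^sub>m k"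
    and AU: "A * U = U * mat_diag k (\<lambda>i. complex_of_real (l i))" by auto
  from hermitian_eigenvector_extend[OF A _ U UU AU] Suc.prems
  obtain v c where v: "v \<in> carrier_vec n" "v \<bullet>c v = 1" "mat_adjoint U *\<^sub>v v = 0\<^sub>v k"
    and Av: "A *\<^sub>v v = of_real c \<cdot>\<^sub>v v" by auto
  have Ac: "A \<in> carrier_mat n n" using A by (rule hermitian_carrier)
  define W where "W = mat n (Suc k) (\<lambda>(i, j). if j < k then U $$ (i, j) else v $ i)"
  have W: "W \<in> carrier_mat n (Suc k)" by (simp add: W_def)
  have Uv: "(\<Sum>x<n. cnj (U $$ (x, i)) * v $ x) = 0" if "i < k" for i
  proof -
    have "(mat_adjoint U *\<^sub>v v) $ i = (\<Sum>x<n. cnj (U $$ (x, i)) * v $ x)"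
      using that U v(1) by (simp add: scalar_prod_def atLeast0LessThan)
    then show ?thesis using v(3) that by simp
  qed
  have vU: "(\<Sum>x<n. U $$ (x, i) * cnj (v $ x)) = 0" if "i < k" for i
    using arg_cong[OF Uv[OF that], of cnj] by simp
  have vv: "(\<Sum>x<n. v $ x * cnj (v $ x)) = 1"
    using v(2) cscalar_prod_sum[OF v(1,1)] by simp
  have UUi: "(\<Sum>x<n. cnj (U $$ (x, i)) * U $$ (x, j)) = (if i = j then 1 else 0)" if "i < k" "j < k" for i j
    using arg_cong[OF UU, of "\<lambda>M. M $$ (i, j)"] that U
    by (simp add: index_mult_mat_sum del: index_mult_mat(1))
  have "mat_adjoint W * W = 1\<^sub>m (Suc k)"
  proof (rule eq_matI)
    fix i j assume "i < dim_row (1\<^sub>m (Suc k) :: complex mat)" "j < dim_col (1\<^sub>m (Suc k) :: complex mat)"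
    then have ij: "i < Suc k" "j < Suc k" by auto
    then have "(mat_adjoint W * W) $$ (i, j) = (\<Sum>x<n. cnj (W $$ (x, i)) * W $$ (x, j))"
      using W by (simp add: index_mult_mat_sum del: index_mult_mat(1))
    also have "\<dots> = (if i = j then 1 else 0)"
      using ij UUi Uv vU vv by (auto simp: W_def less_Suc_eq mult.commute)
    finally show "(mat_adjoint W * W) $$ (i, j) = 1\<^sub>m (Suc k) $$ (i, j)" using ij by simp
  qed (use W in auto)
  moreover have "A * W = W * mat_diag (Suc k) (\<lambda>i. complex_of_real ((l(k := c)) i))"
  proof (rule eq_matI)
    fix i j assume "i < dim_row (W * mat_diag (Suc k) (\<lambda>i. complex_of_real ((l(k := c)) i)))"
      "j < dim_col (W * mat_diag (Suc k) (\<lambda>i. complex_of_real ((l(k := c)) i)))"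
    then have ij: "i < n" "j < Suc k" using W by (auto simp: mat_diag_def)
    have R: "(W * mat_diag (Suc k) (\<lambda>i. complex_of_real ((l(k := c)) i))) $$ (i, j) =
      W $$ (i, j) * of_real ((l(k := c)) j)"
      unfolding mat_diag_mult_right[OF W] using ij by simp
    have L: "(A * W) $$ (i, j) = (\<Sum>x<n. A $$ (i, x) * W $$ (x, j))"
      using W Ac ij by (simp add: index_mult_mat_sum del: index_mult_mat(1))
    show "(A * W) $$ (i, j) = (W * mat_diag (Suc k) (\<lambda>i. complex_of_real ((l(k := c)) i))) $$ (i, j)"
    proof (cases "j < k")
      case True
      have "(\<Sum>x<n. A $$ (i, x) * U $$ (x, j)) = U $$ (i, j) * of_real (l j)"
        using arg_cong[OF AU, of "\<lambda>M. M $$ (i, j)"] True ij U Ac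
        unfolding mat_diag_mult_right[OF U]
        by (simp add: index_mult_mat_sum del: index_mult_mat(1))
      then show ?thesis unfolding L R using True ij by (simp add: W_def)
    next
      case False
      have "(\<Sum>x<n. A $$ (i, x) * v $ x) = v $ i * of_real c"
        using arg_cong[OF Av, of "\<lambda>w. w $ i"] ij v Ac
        by (simp add: scalar_prod_def atLeast0LessThan mult.commute)
      then show ?thesis unfolding L R using False ij by (simp add: W_def)
    qed
  qed (use W Ac in \<open>auto simp: mat_diag_def\<close>)
  ultimately show ?case using W by blast
qed

lemma hermitian_spectral:
  assumes A: "hermitian_mat n A"
  obtains U l where "U \<in> carrier_mat n n" "mat_adjoint U * U = 1\<^sub>m n" "U * mat_adjoint U = 1\<^sub>m n"
    "A = U * mat_diag n (\<lambda>i. complex_of_real (l i)) * mat_adjoint U"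
proof -
  from hermitian_partial_spectral[OF A order_refl] obtain U l where
    U: "U \<in> carrier_mat n n" and UU: "mat_adjoint U * U = 1\<^sub>m n"
    and AU: "A * U = U * mat_diag n (\<lambda>i. complex_of_real (l i))" by auto
  have UU': "U * mat_adjoint U = 1\<^sub>m n" by (rule mat_mult_one_right_inverse[OF U UU])
  have "A = A * (U * mat_adjoint U)" using hermitian_carrier[OF A] by (simp add: UU')
  also have "\<dots> = A * U * mat_adjoint U"
    using assoc_mult_mat[OF hermitian_carrier[OF A] U mat_adjoint_carrier[OF U]] by simp
  finally show thesis using that[OF U UU UU'] AU by simp
qed


section \<open>Positive square roots, the trace norm and its duality\<close>

lemma mat_conj_mult:
  fixes U :: "complex mat"
  assumes U: "U \<in> carrier_mat n n" "U * mat_adjoint U = 1\<^sub>m n"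
    and A: "A \<in> carrier_mat n n" and B: "B \<in> carrier_mat n n"
  shows "mat_adjoint U * (A * B) * U = (mat_adjoint U * A * U) * (mat_adjoint U * B * U)"
proof -
  have Ua: "mat_adjoint U \<in> carrier_mat n n" using U by simp
  have "(mat_adjoint U * A * U) * (mat_adjoint U * B * U) = mat_adjoint U * (A * ((U * mat_adjoint U) * (B * U)))"
    using U(1) Ua A B by (simp add: assoc_mult_mat[of _ n n _ n _ n] del: mat_adjoint_carrier)
  also have "\<dots> = mat_adjoint U * (A * B) * U"
    using U Ua A B by (simp add: assoc_mult_mat[of _ n n _ n _ n] del: mat_adjoint_carrier)
  finally show ?thesis by simp
qed

lemma mat_conj_conj:
  fixes U :: "complex mat"
  assumes U: "U \<in> carrier_mat n n" "mat_adjoint U * U = 1\<^sub>m n" and A: "A \<in> carrier_mat n n"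
  shows "mat_adjoint U * (U * A * mat_adjoint U) * U = A"
proof -
  have Ua: "mat_adjoint U \<in> carrier_mat n n" using U by simp
  have "mat_adjoint U * (U * A * mat_adjoint U) * U = (mat_adjoint U * U) * (A * (mat_adjoint U * U))"
    using U(1) Ua A by (simp add: assoc_mult_mat[of _ n n _ n _ n] del: mat_adjoint_carrier)
  then show ?thesis using U A by simp
qed

lemma mtr_conj_diag:
  fixes U :: "complex mat"
  assumes U: "U \<in> carrier_mat n n" and A: "A \<in> carrier_mat n n"
  shows "mtr (U * mat_diag n f * mat_adjoint U * A) = (\<Sum>i<n. f i * (mat_adjoint U * A * U) $$ (i, i))"
proof -
  have Ua: "mat_adjoint U \<in> carrier_mat n n" using U by simp
  have D: "mat_diag n f \<in> carrier_mat n n" by simp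
  have "mtr (U * mat_diag n f * mat_adjoint U * A) = mtr (U * (mat_diag n f * (mat_adjoint U * A)))"
    using assoc_mult_mat[OF mult_carrier_mat[OF U D] Ua A] assoc_mult_mat[OF U D mult_carrier_mat[OF Ua A]] by simp
  also have "\<dots> = mtr (mat_diag n f * (mat_adjoint U * A) * U)"
    by (rule mtr_mult_commute[OF U mult_carrier_mat[OF D mult_carrier_mat[OF Ua A]]])
  also have "mat_diag n f * (mat_adjoint U * A) * U = mat_diag n f * (mat_adjoint U * A * U)"
    by (rule assoc_mult_mat[OF D mult_carrier_mat[OF Ua A] U])
  also have "mtr \<dots> = (\<Sum>i<n. f i * (mat_adjoint U * A * U) $$ (i, i))"
    unfolding mat_diag_mult_left[OF mult_carrier_mat[OF mult_carrier_mat[OF Ua A] U]]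
    by (simp add: mtr_def)
  finally show ?thesis .
qed

lemma mtr_conj:
  fixes U :: "complex mat"
  assumes U: "U \<in> carrier_mat n n" "U * mat_adjoint U = 1\<^sub>m n" and A: "A \<in> carrier_mat n n"
  shows "(\<Sum>i<n. (mat_adjoint U * A * U) $$ (i, i)) = mtr A"
  using mtr_conj_diag[OF U(1) A, of "\<lambda>_. 1"] U A by simp

text \<open>This makes the definite description in \<open>psd_sqrt\<close> meaningful. In an
  eigenbasis of S - T, the diagonal entries of S (S - T) + (S - T) T = S^2 - T^2 = 0 read l_i (s_i +
  t_i) = 0, while l_i = s_i - t_i with s_i, t_i \<ge> 0; hence l_i = 0.\<close>

lemma psd_square_inject:
  assumes S: "psd n S" and T: "psd n T" and eq: "S * S = T * T"
  shows "S = T"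
proof -
  have Sc: "S \<in> carrier_mat n n" and Tc: "T \<in> carrier_mat n n"
    using S T by (auto intro: psd_carrier)
  have h: "hermitian_mat n (S - T)" using S T by (intro hermitian_minus psd_hermitian)
  then obtain U l where U: "U \<in> carrier_mat n n" and UU: "mat_adjoint U * U = 1\<^sub>m n" "U * mat_adjoint U = 1\<^sub>m n"
    and ST: "S - T = U * mat_diag n (\<lambda>i. complex_of_real (l i)) * mat_adjoint U"
    by (rule hermitian_spectral)
  define L where "L = mat_diag n (\<lambda>i. complex_of_real (l i))"
  have L: "L \<in> carrier_mat n n" by (simp add: L_def)
  have Ua: "mat_adjoint U \<in> carrier_mat n n" using U by simp
  define S' T' where "S' = mat_adjoint U * S * U" and "T' = mat_adjoint U * T * U"
  have S': "psd n S'" and T': "psd n T'"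
    unfolding S'_def T'_def using psd_conj[OF S Ua] psd_conj[OF T Ua] by simp_all
  have S'c: "S' \<in> carrier_mat n n" and T'c: "T' \<in> carrier_mat n n"
    using S' T' by (auto intro: psd_carrier)
  have STc: "S - T \<in> carrier_mat n n" using h by (rule hermitian_carrier)
  have L': "mat_adjoint U * (S - T) * U = L"
    unfolding ST L_def by (rule mat_conj_conj[OF U UU(1)]) simp
  have "L = S' - T'"
    unfolding L'[symmetric] S'_def T'_def
    unfolding mult_minus_distrib_mat[OF Ua Sc Tc]
    by (rule minus_mult_distrib_mat[OF mult_carrier_mat[OF Ua Sc] mult_carrier_mat[OF Ua Tc] U])
  then have dl: "of_real (l i) = S' $$ (i, i) - T' $$ (i, i)" if "i < n" for i
  proof -
    have "L $$ (i, i) = S' $$ (i, i) - T' $$ (i, i)"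
      unfolding \<open>L = S' - T'\<close> using that S'c T'c by simp
    then show ?thesis using that by (simp add: L_def mat_diag_def)
  qed
  have "S * (S - T) = S * S - S * T" "(S - T) * T = S * T - T * T"
    using mult_minus_distrib_mat[OF Sc Sc Tc] minus_mult_distrib_mat[OF Sc Tc Tc] by auto
  then have z: "S * (S - T) + (S - T) * T = 0\<^sub>m n n"
    using Sc Tc by (intro eq_matI) (auto simp: eq simp del: index_mult_mat(1))
  have "mat_adjoint U * (S * (S - T) + (S - T) * T) * U =
     mat_adjoint U * (S * (S - T)) * U + mat_adjoint U * ((S - T) * T) * U"
    unfolding mult_add_distrib_mat[OF Ua mult_carrier_mat[OF Sc STc] mult_carrier_mat[OF STc Tc]]
    by (rule add_mult_distrib_mat[OF mult_carrier_mat[OF Ua mult_carrier_mat[OF Sc STc]]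
          mult_carrier_mat[OF Ua mult_carrier_mat[OF STc Tc]] U])
  also have "\<dots> = S' * L + L * T'"
    unfolding mat_conj_mult[OF U UU(2) Sc STc] mat_conj_mult[OF U UU(2) STc Tc] L' S'_def T'_def ..
  finally have "S' * L + L * T' = 0\<^sub>m n n"
    unfolding z using U Ua by simp
  then have d0: "S' $$ (i, i) * of_real (l i) + of_real (l i) * T' $$ (i, i) = 0" if "i < n" for i
  proof -
    have "(S' * L + L * T') $$ (i, i) = S' $$ (i, i) * of_real (l i) + of_real (l i) * T' $$ (i, i)"
      unfolding L_def mat_diag_mult_left[OF T'c] mat_diag_mult_right[OF S'c] using that by simp
    then show ?thesis using \<open>S' * L + L * T' = 0\<^sub>m n n\<close> that by simp
  qed
  have l0: "l i = 0" if i: "i < n" for i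
  proof (rule ccontr)
    assume "l i \<noteq> 0"
    then have "S' $$ (i, i) + T' $$ (i, i) = 0"
      using d0[OF i] by (simp add: algebra_simps) (metis distrib_left mult_eq_0_iff of_real_eq_0_iff)
    then have "Re (S' $$ (i, i)) + Re (T' $$ (i, i)) = 0"
      by (metis plus_complex.sel(1) zero_complex.sel(1))
    then have "Re (S' $$ (i, i)) = 0 \<and> Re (T' $$ (i, i)) = 0"
      using psd_diag_nonneg[OF S' i] psd_diag_nonneg[OF T' i] by linarith
    then have "l i = 0"
      using arg_cong[OF dl[OF i], of Re] by simp
    then show False using \<open>l i \<noteq> 0\<close> by simp
  qed
  have "L = 0\<^sub>m n n" by (rule eq_matI) (auto simp: L_def mat_diag_def l0)
  then have "S - T = 0\<^sub>m n n" unfolding ST L_def[symmetric] using U Ua by simp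
  show ?thesis
  proof (rule eq_matI)
    fix i j assume "i < dim_row T" "j < dim_col T"
    then show "S $$ (i, j) = T $$ (i, j)"
      using arg_cong[OF \<open>S - T = 0\<^sub>m n n\<close>, of "\<lambda>M. M $$ (i, j)"] Sc Tc by simp
  qed (use Sc Tc in auto)
qed

lemma psd_sqrt_eq: "psd n S \<Longrightarrow> S * S = A \<Longrightarrow> psd_sqrt A = S"
proof -
  assume S: "psd n S" "S * S = A"
  then have "dim_row A = n" using psd_carrier[OF S(1)] by auto
  then show ?thesis
    unfolding psd_sqrt_def using S by (auto intro!: the_equality psd_square_inject[of n])
qed

text \<open>The positive square root of R^2 is obtained by replacing each eigenvalue by its
  modulus.\<close>

lemma trace_norm_spectral:
  fixes U :: "complex mat"
  assumes U: "U \<in> carrier_mat n n" "mat_adjoint U * U = 1\<^sub>m n"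
    and R: "R = U * mat_diag n (\<lambda>i. complex_of_real (l i)) * mat_adjoint U"
  shows "trace_norm R = (\<Sum>i<n. \<bar>l i\<bar>)"
proof -
  have Ua: "mat_adjoint U \<in> carrier_mat n n" using U by simp
  have m: "U * mat_diag n f * mat_adjoint U * (U * mat_diag n g * mat_adjoint U) =
    U * mat_diag n (\<lambda>i. f i * g i) * mat_adjoint U" for f g
  proof -
    have D: "mat_diag n f \<in> carrier_mat n n" "mat_diag n g \<in> carrier_mat n n" by auto
    have "U * mat_diag n f * mat_adjoint U * (U * mat_diag n g * mat_adjoint U) =
       U * (mat_diag n f * ((mat_adjoint U * U) * (mat_diag n g * mat_adjoint U)))"
      using U(1) Ua D by (simp add: assoc_mult_mat[of _ n n _ n _ n] del: mat_adjoint_carrier mat_diag_dim)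
    also have "\<dots> = U * ((mat_diag n f * mat_diag n g) * mat_adjoint U)"
      using U Ua D by (simp add: assoc_mult_mat[of _ n n _ n _ n] del: mat_diag_diag mat_adjoint_carrier mat_diag_dim)
    finally show ?thesis using U Ua by (simp add: assoc_mult_mat[of _ n n _ n _ n] del: mat_adjoint_carrier)
  qed
  define S where "S = U * mat_diag n (\<lambda>i. complex_of_real \<bar>l i\<bar>) * mat_adjoint U"
  have S: "psd n S" unfolding S_def by (rule psd_conj[OF psd_diag U(1)]) simp
  have "hermitian_mat n R"
    unfolding R by (rule hermitian_conj[OF _ U(1)]) (auto simp: hermitian_mat_def mat_adjoint_diag)
  then have "mat_adjoint R * R = S * S"
    unfolding hermitian_adjoint[OF \<open>hermitian_mat n R\<close>] unfolding R S_def m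
    by (simp add: of_real_mult[symmetric] del: of_real_mult)
  then have "psd_sqrt (mat_adjoint R * R) = S" using psd_sqrt_eq[OF S] by simp
  moreover have "mtr S = mtr (S * 1\<^sub>m n)" using psd_carrier[OF S] by simp
  moreover have "\<dots> = (\<Sum>i<n. complex_of_real \<bar>l i\<bar> * (mat_adjoint U * 1\<^sub>m n * U) $$ (i, i))"
    unfolding S_def by (rule mtr_conj_diag[OF U(1)]) simp
  ultimately show ?thesis using U Ua by (simp add: trace_norm_def)
qed

text \<open>\<open>W\<close> is the sign of \<open>R\<close>: it turns the eigenvalues of
  \<open>R\<close> into their moduli, and since its own eigenvalues lie in [-1, 1] it cannot enlarge
  the trace of a positive matrix.\<close>

lemma trace_norm_dual_witness:
  assumes R: "hermitian_mat n R"
  obtains W where "W \<in> carrier_mat n n" "Re (mtr (W * R)) = trace_norm R"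
    "\<And>P. psd n P \<Longrightarrow> \<bar>Re (mtr (W * P))\<bar> \<le> Re (mtr P)"
proof -
  obtain U l where U: "U \<in> carrier_mat n n" and UU: "mat_adjoint U * U = 1\<^sub>m n" "U * mat_adjoint U = 1\<^sub>m n"
    and Req: "R = U * mat_diag n (\<lambda>i. complex_of_real (l i)) * mat_adjoint U"
    by (rule hermitian_spectral[OF R])
  have Ua: "mat_adjoint U \<in> carrier_mat n n" using U by simp
  define W where "W = U * mat_diag n (\<lambda>i. complex_of_real (sgn (l i))) * mat_adjoint U"
  have W: "W \<in> carrier_mat n n"
    unfolding W_def by (rule mult_carrier_mat[OF mult_carrier_mat[OF U mat_diag_dim] Ua])
  have Wm: "mtr (W * A) = (\<Sum>i<n. of_real (sgn (l i)) * (mat_adjoint U * A * U) $$ (i, i))"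
    if "A \<in> carrier_mat n n" for A
    unfolding W_def by (rule mtr_conj_diag[OF U that])
  show thesis
  proof
    show "W \<in> carrier_mat n n" by fact
    have "mat_adjoint U * R * U = mat_diag n (\<lambda>i. complex_of_real (l i))"
      unfolding Req by (rule mat_conj_conj[OF U UU(1)]) simp
    then have "mtr (W * R) = (\<Sum>i<n. of_real \<bar>l i\<bar>)"
      unfolding Wm[OF hermitian_carrier[OF R]]
      by (simp add: mat_diag_def of_real_mult[symmetric] abs_sgn mult.commute del: of_real_mult)
    then show "Re (mtr (W * R)) = trace_norm R"
      using trace_norm_spectral[OF U UU(1) Req] by simp
    fix P assume P: "psd n P"
    have PU: "psd n (mat_adjoint U * P * U)" using psd_conj[OF P Ua] by simp
    have "\<bar>Re (mtr (W * P))\<bar> = \<bar>\<Sum>i<n. sgn (l i) * Re ((mat_adjoint U * P * U) $$ (i, i))\<bar>"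
      unfolding Wm[OF psd_carrier[OF P]] by simp
    also have "\<dots> \<le> (\<Sum>i<n. \<bar>sgn (l i) * Re ((mat_adjoint U * P * U) $$ (i, i))\<bar>)"
      by (rule sum_abs)
    also have "\<dots> \<le> (\<Sum>i<n. Re ((mat_adjoint U * P * U) $$ (i, i)))"
      using psd_diag_nonneg[OF PU] by (intro sum_mono) (auto simp: abs_mult sgn_if)
    also have "\<dots> = Re (mtr P)"
      unfolding mtr_conj[OF U UU(2) psd_carrier[OF P], symmetric] by simp
    finally show "\<bar>Re (mtr (W * P))\<bar> \<le> Re (mtr P)" .
  qed
qed

lemma hermitian_jordan_decomposition:
  assumes R: "hermitian_mat n R"
  obtains P Q where "psd n P" "psd n Q" "R = P - Q" "trace_norm R = Re (mtr P) + Re (mtr Q)"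
proof -
  obtain U l where U: "U \<in> carrier_mat n n" and UU: "mat_adjoint U * U = 1\<^sub>m n" "U * mat_adjoint U = 1\<^sub>m n"
    and Req: "R = U * mat_diag n (\<lambda>i. complex_of_real (l i)) * mat_adjoint U"
    by (rule hermitian_spectral[OF R])
  have Ua: "mat_adjoint U \<in> carrier_mat n n" using U by simp
  define E where "E f = U * mat_diag n (\<lambda>i. complex_of_real (f i)) * mat_adjoint U" for f
  have E: "psd n (E f)" if "\<And>i. 0 \<le> f i" for f
    unfolding E_def by (rule psd_conj[OF psd_diag U]) (rule that)
  have tr: "Re (mtr (E f)) = (\<Sum>i<n. f i)" for f
  proof -
    have Ec: "E f \<in> carrier_mat n n"
      unfolding E_def by (rule mult_carrier_mat[OF mult_carrier_mat[OF U mat_diag_dim] Ua])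
    have "mtr (E f * 1\<^sub>m n) = (\<Sum>i<n. of_real (f i) * (mat_adjoint U * 1\<^sub>m n * U) $$ (i, i))"
      unfolding E_def by (rule mtr_conj_diag[OF U]) simp
    then show ?thesis using Ec U Ua UU by simp
  qed
  show thesis
  proof
    show "psd n (E (\<lambda>i. max (l i) 0))" "psd n (E (\<lambda>i. max (- l i) 0))"
      by (rule E, simp)+
    have D: "mat_diag n (\<lambda>i. complex_of_real (l i)) =
      mat_diag n (\<lambda>i. complex_of_real (max (l i) 0)) - mat_diag n (\<lambda>i. complex_of_real (max (- l i) 0))"
      by (rule eq_matI) (auto simp: mat_diag_def max_def)
    show "R = E (\<lambda>i. max (l i) 0) - E (\<lambda>i. max (- l i) 0)"
      unfolding Req E_def D mult_minus_distrib_mat[OF U mat_diag_dim mat_diag_dim]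
      by (rule minus_mult_distrib_mat[OF mult_carrier_mat[OF U mat_diag_dim] mult_carrier_mat[OF U mat_diag_dim] Ua])
    show "trace_norm R = Re (mtr (E (\<lambda>i. max (l i) 0))) + Re (mtr (E (\<lambda>i. max (- l i) 0)))"
      unfolding tr trace_norm_spectral[OF U UU(1) Req] sum.distrib[symmetric]
      by (rule sum.cong) (auto simp: max_def)
  qed
qed

text \<open>The trace norm of P - Q is the pairing with its own sign, and that pairing is bounded by
  the trace on \<open>P\<close> and on \<open>Q\<close> separately.\<close>

lemma trace_norm_le:
  assumes P: "psd n P" and Q: "psd n Q"
  shows "trace_norm (P - Q) \<le> Re (mtr P) + Re (mtr Q)"
proof -
  have "hermitian_mat n (P - Q)" using P Q by (intro hermitian_minus psd_hermitian)
  then obtain W where W: "W \<in> carrier_mat n n" "Re (mtr (W * (P - Q))) = trace_norm (P - Q)"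
    and b: "\<And>P. psd n P \<Longrightarrow> \<bar>Re (mtr (W * P))\<bar> \<le> Re (mtr P)"
    by (rule trace_norm_dual_witness) blast
  have c: "P \<in> carrier_mat n n" "Q \<in> carrier_mat n n" using P Q by (auto intro: psd_carrier)
  have "mtr (W * (P - Q)) = mtr (W * P) - mtr (W * Q)"
    unfolding mult_minus_distrib_mat[OF W(1) c] using W c by (intro mtr_minus[of _ n]) auto
  then show ?thesis using b[OF P] b[OF Q] W(2) by simp
qed

text \<open>A functional of norm at most one that attains the trace norm at \<open>R\<close>; it
  reduces inequalities between operator-valued functions to real-valued ones.\<close>

lemma trace_norm_norming:
  assumes R: "hermitian_mat n R"
  obtains W where "W \<in> carrier_mat n n" "Re (mtr (W * R)) = trace_norm R"
    "\<And>S. hermitian_mat n S \<Longrightarrow> \<bar>Re (mtr (W * S))\<bar> \<le> trace_norm S"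
proof -
  obtain W where W: "W \<in> carrier_mat n n" "Re (mtr (W * R)) = trace_norm R"
    and b: "\<And>P. psd n P \<Longrightarrow> \<bar>Re (mtr (W * P))\<bar> \<le> Re (mtr P)"
    using trace_norm_dual_witness[OF R] by blast
  have "\<bar>Re (mtr (W * S))\<bar> \<le> trace_norm S" if S: "hermitian_mat n S" for S
  proof -
    obtain P Q where PQ: "psd n P" "psd n Q" "S = P - Q" "trace_norm S = Re (mtr P) + Re (mtr Q)"
      by (rule hermitian_jordan_decomposition[OF S])
    have c: "P \<in> carrier_mat n n" "Q \<in> carrier_mat n n" using PQ by (auto intro: psd_carrier)
    have "mtr (W * S) = mtr (W * P) - mtr (W * Q)"
      unfolding PQ(3) mult_minus_distrib_mat[OF W(1) c] using W c by (intro mtr_minus[of _ n]) auto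
    then show ?thesis using b[OF PQ(1)] b[OF PQ(2)] PQ(4) by simp
  qed
  then show thesis using that W by blast
qed

lemma trace_norm_nonneg: "hermitian_mat n R \<Longrightarrow> 0 \<le> trace_norm R"
  by (erule hermitian_jordan_decomposition) (use psd_mtr_nonneg in force)

lemma trace_norm_psd:
  assumes P: "psd n P" shows "trace_norm P = Re (mtr P)"
proof (rule antisym)
  have "P - 0\<^sub>m n n = P" using psd_carrier[OF P] by (intro eq_matI) auto
  then show "trace_norm P \<le> Re (mtr P)" using trace_norm_le[OF P psd_zero] by (simp add: mtr_def)
  obtain S Q where PQ: "psd n S" "psd n Q" "P = S - Q" "trace_norm P = Re (mtr S) + Re (mtr Q)"
    by (rule hermitian_jordan_decomposition[OF psd_hermitian[OF P]])
  have "mtr P = mtr S - mtr Q" unfolding PQ(3) using PQ by (intro mtr_minus[of _ n] psd_carrier)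
  then show "Re (mtr P) \<le> trace_norm P" using PQ psd_mtr_nonneg[OF PQ(2)] by simp
qed

lemma trace_norm_zero: "trace_norm (0\<^sub>m n n) = 0"
  using trace_norm_psd[OF psd_zero] by (simp add: mtr_def)

lemma trace_norm_triangle:
  assumes R: "hermitian_mat n R" and S: "hermitian_mat n S"
  shows "trace_norm (R + S) \<le> trace_norm R + trace_norm S"
proof -
  obtain P Q where PQ: "psd n P" "psd n Q" "R = P - Q" "trace_norm R = Re (mtr P) + Re (mtr Q)"
    by (rule hermitian_jordan_decomposition[OF R])
  obtain P' Q' where PQ': "psd n P'" "psd n Q'" "S = P' - Q'" "trace_norm S = Re (mtr P') + Re (mtr Q')"
    by (rule hermitian_jordan_decomposition[OF S])
  note c = PQ(1,2)[THEN psd_carrier] PQ'(1,2)[THEN psd_carrier]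
  have "R + S = (P + P') - (Q + Q')" unfolding PQ PQ' using c by (intro eq_matI) auto
  then show ?thesis
    using trace_norm_le[OF psd_add[OF PQ(1) PQ'(1)] psd_add[OF PQ(2) PQ'(2)]] PQ(4) PQ'(4)
      mtr_add[OF c(1,3)] mtr_add[OF c(2,4)] by simp
qed

lemma trace_norm_smult:
  assumes R: "hermitian_mat n R"
  shows "trace_norm (of_real c \<cdot>\<^sub>m R) = \<bar>c\<bar> * trace_norm R"
proof -
  obtain U l where U: "U \<in> carrier_mat n n" and UU: "mat_adjoint U * U = 1\<^sub>m n" "U * mat_adjoint U = 1\<^sub>m n"
    and Req: "R = U * mat_diag n (\<lambda>i. complex_of_real (l i)) * mat_adjoint U"
    by (rule hermitian_spectral[OF R])
  have Ua: "mat_adjoint U \<in> carrier_mat n n" using U by simp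
  have "mat_diag n (\<lambda>i. complex_of_real (c * l i)) = of_real c \<cdot>\<^sub>m mat_diag n (\<lambda>i. complex_of_real (l i))"
    by (rule eq_matI) (auto simp: mat_diag_def)
  then have "of_real c \<cdot>\<^sub>m R = U * mat_diag n (\<lambda>i. complex_of_real (c * l i)) * mat_adjoint U"
    unfolding Req using mult_smult_distrib[OF U mat_diag_dim]
      mult_smult_assoc_mat[OF mult_carrier_mat[OF U mat_diag_dim] Ua] by metis
  from trace_norm_spectral[OF U UU(1) this] show ?thesis
    unfolding trace_norm_spectral[OF U UU(1) Req] by (simp add: abs_mult sum_distrib_left)
qed

lemma trace_norm_index_le:
  assumes R: "hermitian_mat n R" and ij: "i < n" "j < n"
  shows "cmod (R $$ (i, j)) \<le> trace_norm R"
proof -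
  obtain P Q where PQ: "psd n P" "psd n Q" "R = P - Q" "trace_norm R = Re (mtr P) + Re (mtr Q)"
    by (rule hermitian_jordan_decomposition[OF R])
  have "cmod (R $$ (i, j)) \<le> cmod (P $$ (i, j)) + cmod (Q $$ (i, j))"
    unfolding PQ(3) using ij psd_carrier[OF PQ(2)] by (simp add: norm_triangle_ineq4)
  then show ?thesis using psd_index_le[OF PQ(1) ij] psd_index_le[OF PQ(2) ij] PQ(4) by simp
qed

text \<open>A crude constant is enough: it only enters a term of second order in the step
  size.\<close>

lemma mtr_mult_psd_le:
  assumes P: "psd n P" and G: "G \<in> carrier_mat n n"
  shows "Re (mtr (G * P)) \<le> (\<Sum>i<n. \<Sum>k<n. cmod (G $$ (i, k))) * Re (mtr P)"
proof -
  have "Re (mtr (G * P)) \<le> cmod (mtr (G * P))" by (rule complex_Re_le_cmod)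
  also have "\<dots> \<le> (\<Sum>i<n. \<Sum>k<n. cmod (G $$ (i, k) * P $$ (k, i)))"
    unfolding mtr_mult[OF G psd_carrier[OF P]]
    by (intro order_trans[OF norm_sum] sum_mono norm_sum)
  also have "\<dots> \<le> (\<Sum>i<n. \<Sum>k<n. cmod (G $$ (i, k)) * Re (mtr P))"
    by (intro sum_mono) (auto simp: norm_mult intro!: mult_left_mono psd_index_le[OF P])
  finally show ?thesis by (simp add: sum_distrib_right)
qed

text \<open>\<open>XX\<^sup>* - YY\<^sup>* = (UV\<^sup>* + VU\<^sup>*) / 2\<close> for \<open>U = X - Y\<close>, \<open>V = X + Y\<close>; the decomposition into positive parts is
  obtained by polarization with \<open>c U \<plusminus> V / c\<close>, where \<open>c\<close> balances the two norms.\<close>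

lemma trace_norm_purification_diff:
  assumes X: "X \<in> carrier_mat n m" and Y: "Y \<in> carrier_mat n m"
  shows "trace_norm (X * mat_adjoint X - Y * mat_adjoint Y) \<le> frob_norm (X - Y) * frob_norm (X + Y)"
proof -
  define u v where "u = frob_norm (X - Y)" and "v = frob_norm (X + Y)"
  have uv: "u \<ge> 0" "v \<ge> 0" by (auto simp: u_def v_def)
  define G where "G c e = of_real c \<cdot>\<^sub>m (X - Y) + of_real e \<cdot>\<^sub>m (X + Y)" for c e :: real
  have Gc: "G c e \<in> carrier_mat n m" for c e using X Y by (simp add: G_def)
  have Gi: "G c e $$ (i, j) = (c + e) * X $$ (i, j) + (e - c) * Y $$ (i, j)" if "i < n" "j < m" for c e i j
    using that X Y by (simp add: G_def algebra_simps)
  define P where "P c e = of_real (1/4) \<cdot>\<^sub>m (G c e * mat_adjoint (G c e))" for c e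
  have P: "psd n (P c e)" for c e
    unfolding P_def by (intro psd_smult psd_self_adjoint[OF Gc]) simp
  have trP: "Re (mtr (P c e)) = (\<Sum>i<n. \<Sum>j<m. (cmod (G c e $$ (i, j)))\<^sup>2) / 4" for c e
    unfolding P_def using mtr_smult[of "G c e * mat_adjoint (G c e)" n] mult_carrier_mat[OF Gc mat_adjoint_carrier[OF Gc]]
    by (simp add: mtr_self_mult_adjoint[OF Gc] frob_norm_sq[OF Gc])
  have bound: "trace_norm (X * mat_adjoint X - Y * mat_adjoint Y) \<le> (c\<^sup>2 * u\<^sup>2 + e\<^sup>2 * v\<^sup>2) / 2" if ce: "c * e = 1" for c e
  proof -
    \<comment> \<open>The squares of the two summands cancel in the difference, which leaves the
      mixed terms with the factor c e = 1.\<close>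
    have "X * mat_adjoint X - Y * mat_adjoint Y = P c e - P (- c) e"
    proof (rule eq_matI)
      fix i j assume "i < dim_row (P c e - P (- c) e)" "j < dim_col (P c e - P (- c) e)"
      then have ij: "i < n" "j < n" using psd_carrier[OF P[of "- c" e]] by auto
      have PI: "P c e $$ (i, j) = (\<Sum>k<m. G c e $$ (i, k) * cnj (G c e $$ (j, k))) / 4" for c e
        using ij Gc[of c e] by (simp add: P_def index_mult_mat_sum del: index_mult_mat(1))
      have "P c e $$ (i, j) - P (- c) e $$ (i, j) =
        (\<Sum>k<m. (G c e $$ (i, k) * cnj (G c e $$ (j, k)) - G (-c) e $$ (i, k) * cnj (G (-c) e $$ (j, k))) / 4)"
        unfolding PI by (simp add: sum_subtractf sum_divide_distrib diff_divide_distrib)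
      also have "\<dots> = (\<Sum>k<m. complex_of_real (c * e) * (X $$ (i, k) * cnj (X $$ (j, k)) - Y $$ (i, k) * cnj (Y $$ (j, k))))"
        using ij by (intro sum.cong refl) (simp add: Gi field_simps)
      finally show "(X * mat_adjoint X - Y * mat_adjoint Y) $$ (i, j) = (P c e - P (- c) e) $$ (i, j)"
        using ij X Y psd_carrier[OF P[of c e]] psd_carrier[OF P[of "- c" e]] ce by (simp add: index_mult_mat_sum sum_subtractf del: index_mult_mat(1))
    qed (use psd_carrier[OF P[of c e]] psd_carrier[OF P[of "- c" e]] X Y in auto)
    then have "trace_norm (X * mat_adjoint X - Y * mat_adjoint Y) \<le> Re (mtr (P c e)) + Re (mtr (P (-c) e))"
      using trace_norm_le[OF P P] by simp
    also have "\<dots> = (\<Sum>i<n. \<Sum>j<m. ((cmod (G c e $$ (i, j)))\<^sup>2 + (cmod (G (-c) e $$ (i, j)))\<^sup>2) / 4)"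
      unfolding trP by (simp add: sum.distrib sum_divide_distrib add_divide_distrib)
    \<comment> \<open>Parallelogram law: in the sum it is the mixed terms that cancel.\<close>
    also have "\<dots> = (\<Sum>i<n. \<Sum>j<m. (c\<^sup>2 * (cmod ((X - Y) $$ (i, j)))\<^sup>2 + e\<^sup>2 * (cmod ((X + Y) $$ (i, j)))\<^sup>2) / 2)"
      using X Y by (intro sum.cong refl) (simp add: Gi cmod_power2, simp add: power2_eq_square algebra_simps)
    also have "\<dots> = (c\<^sup>2 * u\<^sup>2 + e\<^sup>2 * v\<^sup>2) / 2"
      using frob_norm_sq[of "X - Y" n m] frob_norm_sq[of "X + Y" n m] X Y
      by (simp add: u_def v_def sum.distrib sum_divide_distrib add_divide_distrib sum_distrib_left minus_carrier_mat)
    finally show ?thesis .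
  qed
  show ?thesis
  proof (cases "u = 0 \<or> v = 0")
    case True
    have "trace_norm (X * mat_adjoint X - Y * mat_adjoint Y) \<le> 0 + \<epsilon>" if eps: "\<epsilon> > 0" for \<epsilon>
    proof (cases "u = 0")
      case True
      \<comment> \<open>No balancing factor exists when one norm vanishes. The other side gets a
        weight so small that its contribution is at most \<epsilon>; the 1 in the denominator covers
        the case that it vanishes too.\<close>
      define e where "e = sqrt \<epsilon> / (v + 1)"
      have e: "e > 0" using eps uv by (simp add: e_def add_nonneg_pos)
      have "e\<^sup>2 * v\<^sup>2 = \<epsilon> * (v / (v + 1))\<^sup>2" using eps by (simp add: e_def power_divide)
      also have "\<dots> \<le> \<epsilon> * 1" using eps uv by (intro mult_left_mono) (auto simp: power_le_one divide_simps)
      finally show ?thesis using bound[of "1/e" e] e True eps by simp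
    next
      case False
      then have v0: "v = 0" using True by simp
      define c where "c = sqrt \<epsilon> / (u + 1)"
      have c: "c > 0" using eps uv by (simp add: c_def add_nonneg_pos)
      have "c\<^sup>2 * u\<^sup>2 = \<epsilon> * (u / (u + 1))\<^sup>2" using eps by (simp add: c_def power_divide)
      also have "\<dots> \<le> \<epsilon> * 1" using eps uv by (intro mult_left_mono) (auto simp: power_le_one divide_simps)
      finally show ?thesis using bound[of c "1/c"] c v0 eps by simp
    qed
    then have "trace_norm (X * mat_adjoint X - Y * mat_adjoint Y) \<le> 0"
      by (rule field_le_epsilon)
    then show ?thesis using True by (auto simp: u_def v_def)
  next
    case False
    then have p: "u > 0" "v > 0" using uv by auto
    \<comment> \<open>With this choice both c^2 u^2 and v^2 / c^2 equal u v.\<close>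
    define c where "c = sqrt (v / u)"
    have c: "c\<^sup>2 = v / u" "c > 0" using p by (auto simp: c_def)
    have "(1 / c)\<^sup>2 = u / v" using c p by (simp add: power_one_over) 
    then have "(c\<^sup>2 * u\<^sup>2 + (1 / c)\<^sup>2 * v\<^sup>2) / 2 = u * v"
      using c p by (simp add: power2_eq_square)
    then show ?thesis using bound[of c "1/c"] c by (simp add: u_def v_def)
  qed
qed

text \<open>\<open>R = XX\<^sup>* - YY\<^sup>*\<close> for \<open>X = (R + 1) / 2\<close> and \<open>Y = (R - 1) / 2\<close>.\<close>

lemma trace_norm_le_frob_norm:
  assumes R: "hermitian_mat n R"
  shows "trace_norm R \<le> sqrt (real n) * frob_norm R"
proof -
  have Rc: "R \<in> carrier_mat n n" by (rule hermitian_carrier[OF R])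
  define Z where "Z c = of_real (1/2) \<cdot>\<^sub>m (R + of_real c \<cdot>\<^sub>m 1\<^sub>m n)" for c :: real
  have Z: "Z c \<in> carrier_mat n n" for c using Rc by (simp add: Z_def)
  have "hermitian_mat n (Z c)" for c
    unfolding Z_def using R psd_hermitian[OF psd_one] by (intro hermitian_smult hermitian_add)
  note Za = hermitian_adjoint[OF this]
  have "Z 1 - Z (- 1) = 1\<^sub>m n"
    by (rule eq_matI) (use Rc in \<open>auto simp: Z_def field_simps\<close>)
  moreover have "Z 1 + Z (- 1) = R"
    by (rule eq_matI) (use Rc in \<open>auto simp: Z_def field_simps\<close>)
  ultimately have e: "Z 1 - Z (- 1) = 1\<^sub>m n" "Z 1 + Z (- 1) = R" .
  have "Z 1 * Z 1 - Z (- 1) * Z (- 1) = of_real (1/2) \<cdot>\<^sub>m ((Z 1 + Z (- 1)) * (Z 1 - Z (- 1)) + (Z 1 - Z (- 1)) * (Z 1 + Z (- 1)))"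
  proof -
    \<comment> \<open>Symmetrizing the product of sum and difference makes the difference of squares
      hold without commutativity.\<close>
    have "A * A - B * B = of_real (1/2) \<cdot>\<^sub>m ((A + B) * (A - B) + (A - B) * (A + B))"
      if c: "A \<in> carrier_mat n n" "B \<in> carrier_mat n n" for A B :: "complex mat"
    proof -
      have m: "A * A \<in> carrier_mat n n" "A * B \<in> carrier_mat n n" "B * A \<in> carrier_mat n n" "B * B \<in> carrier_mat n n"
        using c by auto
      have "(A + B) * (A - B) = (A * A + B * A) - (A * B + B * B)" "(A - B) * (A + B) = (A * A - B * A) + (A * B - B * B)"
        using c m mult_minus_distrib_mat[of "A + B" n n A n B] mult_add_distrib_mat[of "A - B" n n A n B]
        by (simp_all add: add_mult_distrib_mat[OF c] minus_mult_distrib_mat[OF c] minus_carrier_mat)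
      then show ?thesis using c by (simp, intro eq_matI) (auto simp del: index_mult_mat(1))
    qed
    from this[OF Z Z] show ?thesis .
  qed
  also have "\<dots> = R" unfolding e using Rc by (intro eq_matI) auto
  finally have "trace_norm R \<le> frob_norm (1\<^sub>m n) * frob_norm R"
    using trace_norm_purification_diff[OF Z Z, of 1 "- 1"] unfolding Za e by simp
  moreover have "frob_norm (1\<^sub>m n) = sqrt (real n)" by (simp add: frob_norm_def mtr_def)
  ultimately show ?thesis by simp
qed

section \<open>Splitting of contraction semigroups\<close>

lemma has_vector_derivative_mult_left_const:
  fixes f :: "real \<Rightarrow> 'a::real_normed_algebra"
  shows "(f has_vector_derivative f') F \<Longrightarrow> ((\<lambda>x. c * f x) has_vector_derivative (c * f')) F"
  by (rule bounded_linear.has_vector_derivative[OF bounded_linear_mult_right])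

lemma has_vector_derivative_mult_right_const:
  fixes f :: "real \<Rightarrow> 'a::real_normed_algebra"
  shows "(f has_vector_derivative f') F \<Longrightarrow> ((\<lambda>x. f x * c) has_vector_derivative (f' * c)) F"
  by (rule bounded_linear.has_vector_derivative[OF bounded_linear_mult_left])

lemma exp_minus_mult_exp:
  fixes x :: "'a::{real_normed_algebra_1,banach}"
  shows "exp (- x) * exp x = 1" "exp x * exp (- x) = 1"
  by (simp_all add: exp_add_commuting[symmetric])

lemma exp_scaleR_add:
  fixes x :: "'a::{real_normed_algebra_1,banach}"
  shows "exp ((s + t) *\<^sub>R x) = exp (s *\<^sub>R x) * exp (t *\<^sub>R x)"
  by (subst exp_add_commuting[symmetric]) (simp_all add: scaleR_add_left)

lemma exp_scaleR_of_nat: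
  fixes x :: "'a::{real_normed_algebra_1,banach}"
  shows "exp ((real n * s) *\<^sub>R x) = exp (s *\<^sub>R x) ^ n"
  by (induction n) (simp_all add: exp_scaleR_add ring_distribs)

text \<open>\<open>bnd x c\<close> stands for \<open>\<parallel>x\<parallel> \<le> c\<close> in a norm (such as the norm induced by the trace norm) that is
  defined only on a subalgebra. The last assumption is the mean value inequality.\<close>

locale op_bound =
  fixes bnd :: "'a::{real_normed_algebra_1,banach} \<Rightarrow> real \<Rightarrow> bool"
  assumes one: "bnd 1 1"
    and add: "bnd x a \<Longrightarrow> bnd y b \<Longrightarrow> bnd (x + y) (a + b)"
    and mult: "bnd x a \<Longrightarrow> bnd y b \<Longrightarrow> bnd (x * y) (a * b)"
    and scale: "bnd x a \<Longrightarrow> bnd (c *\<^sub>R x) (\<bar>c\<bar> * a)"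
    and mono: "bnd x a \<Longrightarrow> a \<le> b \<Longrightarrow> bnd x b"
    and nonneg: "bnd x a \<Longrightarrow> 0 \<le> a"
    and limit: "X \<longlonglongrightarrow> x \<Longrightarrow> u \<longlonglongrightarrow> a \<Longrightarrow> (\<And>n. bnd (X n) (u n)) \<Longrightarrow> bnd x a"
    and mvt: "0 \<le> \<tau> \<Longrightarrow> (\<And>s. 0 \<le> s \<Longrightarrow> s \<le> \<tau> \<Longrightarrow> (F has_vector_derivative F' s) (at s)) \<Longrightarrow>
      (\<And>s. 0 \<le> s \<Longrightarrow> s \<le> \<tau> \<Longrightarrow> (h has_real_derivative h' s) (at s)) \<Longrightarrow>
      (\<And>s. 0 \<le> s \<Longrightarrow> s \<le> \<tau> \<Longrightarrow> bnd (F' s) (h' s)) \<Longrightarrow>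
      bnd (F \<tau> - F 0) a \<Longrightarrow> bnd (F \<tau> - F 0) (h \<tau> - h 0)"
begin

lemma zero: "bnd 0 0"
  using scale[OF one, of 0] by simp

lemma minus: "bnd x a \<Longrightarrow> bnd y b \<Longrightarrow> bnd (x - y) (a + b)"
  using add[of x a "- y" b] scale[of y b "- 1"] by simp

lemma commutator: "bnd x a \<Longrightarrow> bnd y b \<Longrightarrow> bnd (x * y - y * x) (2 * a * b)"
  using minus[OF mult mult, of x a y b y b x a] by (simp add: mult_ac)

lemma sum: "finite I \<Longrightarrow> (\<And>i. i \<in> I \<Longrightarrow> bnd (f i) (g i)) \<Longrightarrow> bnd (sum f I) (sum g I)"
  by (induction I rule: finite_induct) (auto intro: zero add)

lemma power: "bnd x a \<Longrightarrow> bnd (x ^ n) (a ^ n)"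
  by (induction n) (auto intro: one mult)

lemma sums: "f sums x \<Longrightarrow> g sums a \<Longrightarrow> (\<And>n. bnd (f n) (g n)) \<Longrightarrow> bnd x a"
  unfolding sums_def by (erule limit, assumption) (auto intro: sum)

lemma exp_series_term: "bnd x a \<Longrightarrow> bnd (x ^ n /\<^sub>R fact n) (a ^ n /\<^sub>R fact n)"
  using scale[OF power[of x a n], of "inverse (fact n)"] by simp

lemma exp: "bnd x a \<Longrightarrow> bnd (exp x) (exp a)"
  by (rule sums[OF exp_converges exp_converges exp_series_term])

lemma exp_remainder:
  assumes "bnd x a"
  shows "bnd (exp x - 1 - x) (exp a - 1 - a)"
proof (rule sums)
  show "(\<lambda>n. x ^ (n + 2) /\<^sub>R fact (n + 2)) sums (exp x - 1 - x)"
    using sums_split_initial_segment[OF exp_converges[of x], of 2]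
    by (simp add: eval_nat_numeral algebra_simps)
  show "(\<lambda>n. a ^ (n + 2) /\<^sub>R fact (n + 2)) sums (exp a - 1 - a)"
    using sums_split_initial_segment[OF exp_converges[of a], of 2]
    by (simp add: eval_nat_numeral algebra_simps)
qed (rule exp_series_term[OF assms])

text \<open>The bound on \<open>x\<close> itself may have any size; it records that \<open>x\<close>
  lies in the subalgebra on which \<open>bnd\<close> is defined.\<close>

definition contractive :: "'a \<Rightarrow> bool" where
  "contractive x \<longleftrightarrow> (\<exists>a. bnd x a) \<and> (\<forall>s\<ge>0. bnd (exp (s *\<^sub>R x)) 1)"

text \<open>A quadratic bound on the defect of \<open>1 + e x\<close> suffices for contractivity, and unlike
  contractivity it is visibly stable under sums.\<close>

definition dissipative :: "'a \<Rightarrow> bool" where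
  "dissipative x \<longleftrightarrow> (\<exists>a. bnd x a) \<and> (\<exists>g. \<forall>e\<ge>0. bnd (1 + e *\<^sub>R x) (1 + g * e\<^sup>2))"

lemma dissipative_zero: "dissipative 0"
  unfolding dissipative_def using zero one by (auto intro!: exI[of _ 0])

text \<open>1 + e (x + y) is the average of 1 + 2 e x and 1 + 2 e y, so the defect stays
  quadratic.\<close>

lemma dissipative_add:
  assumes "dissipative x" "dissipative y"
  shows "dissipative (x + y)"
proof -
  obtain a b g h where x: "bnd x a" "\<And>e. e \<ge> 0 \<Longrightarrow> bnd (1 + e *\<^sub>R x) (1 + g * e\<^sup>2)"
    and y: "bnd y b" "\<And>e. e \<ge> 0 \<Longrightarrow> bnd (1 + e *\<^sub>R y) (1 + h * e\<^sup>2)"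
    using assms unfolding dissipative_def by blast
  have "bnd (1 + e *\<^sub>R (x + y)) (1 + (2 * g + 2 * h) * e\<^sup>2)" if "e \<ge> 0" for e
  proof -
    have "1 + e *\<^sub>R (x + y) = (1/2) *\<^sub>R (1 + (2 * e) *\<^sub>R x) + (1/2) *\<^sub>R (1 + (2 * e) *\<^sub>R y)"
      by (simp add: scaleR_add_right scaleR_add_left[symmetric])
    moreover have "1 + (2 * g + 2 * h) * e\<^sup>2 = \<bar>1/2\<bar> * (1 + g * (2 * e)\<^sup>2) + \<bar>1/2\<bar> * (1 + h * (2 * e)\<^sup>2)"
      by (simp add: power2_eq_square algebra_simps)
    ultimately show ?thesis
      using add[OF scale[OF x(2)] scale[OF y(2)], of "2 * e" "2 * e" "1/2" "1/2"] that by simp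
  qed
  then show ?thesis unfolding dissipative_def using add[OF x(1) y(1)] by blast
qed

lemma dissipative_sum: "finite I \<Longrightarrow> (\<And>i. i \<in> I \<Longrightarrow> dissipative (f i)) \<Longrightarrow> dissipative (sum f I)"
  by (induction I rule: finite_induct) (auto intro: dissipative_zero dissipative_add)

lemma contractive_scale: "contractive x \<Longrightarrow> 0 \<le> c \<Longrightarrow> contractive (c *\<^sub>R x)"
  unfolding contractive_def using scale by fastforce

text \<open>exp (s x) is the k-th power of exp (e x) with e = s / k, whose excess over 1 is of order
  e^2; the k factors together contribute exp (K / k), and k tends to infinity.\<close>

lemma dissipative_imp_contractive:
  assumes "dissipative x"
  shows "contractive x"
proof -
  obtain a g where a: "bnd x a" and g: "\<And>e. e \<ge> 0 \<Longrightarrow> bnd (1 + e *\<^sub>R x) (1 + g * e\<^sup>2)"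
    using assms unfolding dissipative_def by blast
  have a0: "a \<ge> 0" by (rule nonneg[OF a])
  have "bnd (exp (s *\<^sub>R x)) 1" if s: "s \<ge> 0" for s
  proof (rule limit[OF tendsto_const])
    \<comment> \<open>Starting with k > N keeps a e \<le> 1, the range in which exp u \<le> 1 + u +
      u^2 is available.\<close>
    define N where "N = nat \<lceil>a * s\<rceil>"
    define K where "K = (\<bar>g\<bar> + a\<^sup>2) * s\<^sup>2"
    have "(\<lambda>n. K * inverse (real (Suc (n + N)))) \<longlonglongrightarrow> K * 0"
      using LIMSEQ_ignore_initial_segment[OF LIMSEQ_inverse_real_of_nat, of N] by (intro tendsto_mult tendsto_const)
    then show "(\<lambda>n. exp (K * inverse (real (Suc (n + N))))) \<longlonglongrightarrow> 1"
      using tendsto_exp by fastforce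
    fix n
    define k where "k = Suc (n + N)"
    define e where "e = s / real k"
    have k: "real k > 0" by (simp add: k_def)
    have e0: "e \<ge> 0" using s by (simp add: e_def)
    have "a * s \<le> real N" unfolding N_def by linarith
    then have ae: "a * e \<le> 1" using k by (simp add: e_def k_def divide_simps)
    have "bnd (exp (e *\<^sub>R x)) ((1 + g * e\<^sup>2) + (exp (\<bar>e\<bar> * a) - 1 - \<bar>e\<bar> * a))"
      using add[OF g[OF e0] exp_remainder[OF scale[OF a, of e]]] by simp
    moreover have "exp (\<bar>e\<bar> * a) \<le> 1 + e * a + (e * a)\<^sup>2"
      using exp_bound[of "e * a"] e0 a0 ae by (simp add: mult.commute)
    moreover have "g * e\<^sup>2 \<le> \<bar>g\<bar> * e\<^sup>2" by (intro mult_right_mono) auto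
    ultimately have "bnd (exp (e *\<^sub>R x)) (1 + (\<bar>g\<bar> + a\<^sup>2) * e\<^sup>2)"
      using e0 by (elim mono) (simp add: power_mult_distrib algebra_simps)
    moreover have "1 + (\<bar>g\<bar> + a\<^sup>2) * e\<^sup>2 \<le> exp ((\<bar>g\<bar> + a\<^sup>2) * e\<^sup>2)"
      by (rule exp_ge_add_one_self)
    ultimately have "bnd (exp (e *\<^sub>R x)) (exp ((\<bar>g\<bar> + a\<^sup>2) * e\<^sup>2))"
      by (rule mono)
    then have "bnd (exp (e *\<^sub>R x) ^ k) (exp ((\<bar>g\<bar> + a\<^sup>2) * e\<^sup>2) ^ k)"
      by (rule power)
    moreover have "exp (e *\<^sub>R x) ^ k = exp (s *\<^sub>R x)"
      using k by (simp add: exp_scaleR_of_nat[symmetric] e_def)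
    moreover have "exp ((\<bar>g\<bar> + a\<^sup>2) * e\<^sup>2) ^ k = exp (K * inverse (real k))"
      using k by (simp add: exp_of_nat_mult[symmetric] e_def K_def field_simps power2_eq_square)
    ultimately show "bnd (exp (s *\<^sub>R x)) (exp (K * inverse (real (Suc (n + N)))))"
      by (simp add: k_def)
  qed
  then show ?thesis unfolding contractive_def using a by blast
qed

lemma contractive_exp: "contractive x \<Longrightarrow> 0 \<le> s \<Longrightarrow> bnd (exp (s *\<^sub>R x)) 1"
  by (simp add: contractive_def)

section \<open>Duhamel formulas for commutators and for the Strang splitting\<close>

lemma conj_derivative:
  "((\<lambda>u. exp (u *\<^sub>R (- A)) * C * exp (u *\<^sub>R A)) has_vector_derivative
    (exp (u *\<^sub>R (- A)) * (C * A - A * C) * exp (u *\<^sub>R A))) (at u)"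
  for A C :: 'a
proof -
  have "((\<lambda>u. exp (u *\<^sub>R (- A)) * C * exp (u *\<^sub>R A)) has_vector_derivative
    (exp (u *\<^sub>R (- A)) * C) * (A * exp (u *\<^sub>R A)) +
    (exp (u *\<^sub>R (- A)) * (- A) * C) * exp (u *\<^sub>R A)) (at u)"
    by (intro has_vector_derivative_mult has_vector_derivative_mult_right_const
        exp_scaleR_has_vector_derivative_left exp_scaleR_has_vector_derivative_right)
  then show ?thesis by (simp add: algebra_simps)
qed

text \<open>Duhamel: the commutator is the integral over s in [0, r] of exp ((r - s) A) [C, A] exp
  (s A), and both exponentials run forward in time.\<close>

lemma commutator_exp:
  assumes A: "contractive A" and C: "bnd C c" and \<kappa>: "bnd (C * A - A * C) \<kappa>" and r: "0 \<le> r"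
  shows "bnd (C * exp (r *\<^sub>R A) - exp (r *\<^sub>R A) * C) (r * \<kappa>)"
proof -
  define F where "F u = exp (r *\<^sub>R A) *
    (exp (u *\<^sub>R (- A)) * C * exp (u *\<^sub>R A))" for u
  define F' where "F' u = exp (r *\<^sub>R A) *
    (exp (u *\<^sub>R (- A)) * (C * A - A * C) * exp (u *\<^sub>R A))" for u
  have F: "F r = C * exp (r *\<^sub>R A)" "F 0 = exp (r *\<^sub>R A) * C"
    by (simp_all add: F_def mult.assoc[symmetric] exp_minus_mult_exp)
  have ex: "bnd (exp (r *\<^sub>R A)) 1" by (rule contractive_exp[OF A r])
  have "bnd (F r - F 0) (r * \<kappa> - 0 * \<kappa>)"
  proof (rule mvt[OF r])
    show "(F has_vector_derivative F' s) (at s)" for s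
      unfolding F_def F'_def by (intro has_vector_derivative_mult_left_const conj_derivative)
    show "((\<lambda>s. s * \<kappa>) has_real_derivative \<kappa>) (at s)" for s
      by (auto intro!: derivative_eq_intros)
    \<comment> \<open>Any constant would do: this is the a priori bound of \<open>mvt\<close>, which
      provides that the increment lies in the domain of \<open>bnd\<close>.\<close>
    show "bnd (F r - F 0) (1 * c + c * 1)"
      unfolding F using minus[OF mult[OF C ex] mult[OF ex C]] by (simp add: mult.commute)
    fix s assume s: "0 \<le> s" "s \<le> r"
    \<comment> \<open>The backward exponential is absorbed by the prefactor exp (r A).\<close>
    have "F' s = exp ((r - s) *\<^sub>R A) * (C * A - A * C) * exp (s *\<^sub>R A)"
      using exp_scaleR_add[of r "- s" A] by (simp add: F'_def mult.assoc)
    also have "bnd \<dots> (1 * \<kappa> * 1)"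
      using s by (intro mult \<kappa> contractive_exp[OF A]) auto
    finally show "bnd (F' s) \<kappa>" by simp
  qed
  then show ?thesis by (simp add: F)
qed

text \<open>This is the amount by which the derivative of the Strang product a b a deviates from (2
  P + B) a b a. Its two summands are s C and - s C to first order, so they have to be estimated
  together: \<open>F\<close> interpolates both at once, and in its derivative the commutator
  \<open>C\<close> occurs twice with opposite signs, at different places of the product.\<close>

lemma strang_defect:
  assumes P: "contractive P" and B: "contractive B" and s: "0 \<le> s"
  defines "C \<equiv> P * B - B * P"
  assumes \<alpha>: "bnd (C * P - P * C) \<alpha>" and \<beta>: "bnd (C * B - B * C) \<beta>"
  defines "a \<equiv> exp (s *\<^sub>R P)" and "b \<equiv> exp (s *\<^sub>R B)"
  shows "bnd ((a * B - B * a) * b * a + a * (b * P - P * b) * a) (s\<^sup>2 / 2 * (\<alpha> + \<beta>))"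
proof -
  define F where "F u = exp (u *\<^sub>R P) * B * exp (u *\<^sub>R (- P)) * (a * b * a)
    + a * (exp (u *\<^sub>R B) * P * exp (u *\<^sub>R (- B)) * (b * a))" for u
  define F' where "F' u = exp (u *\<^sub>R P) * C * exp (u *\<^sub>R (- P)) * (a * b * a)
    + a * (exp (u *\<^sub>R B) * (- C) * exp (u *\<^sub>R (- B)) * (b * a))" for u
  \<comment> \<open>Antiderivative of (s - u) \<alpha> + u \<beta>; over [0, s] it increases by s^2
    (\<alpha> + \<beta>) / 2.\<close>
  define h where "h u = (s * u - u\<^sup>2 / 2) * \<alpha> + u\<^sup>2 / 2 * \<beta>" for u
  have Fs: "F s - F 0 = (a * B - B * a) * b * a + a * (b * P - P * b) * a"
  proof -
    have "F s = a * B * (exp (- (s *\<^sub>R P)) * a) * b * a + a * (b * P * (exp (- (s *\<^sub>R B)) * b) * a)"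
      by (simp add: F_def a_def b_def mult.assoc)
    also have "\<dots> = a * B * b * a + a * (b * P * a)"
      by (simp add: a_def b_def exp_minus_mult_exp)
    finally show ?thesis by (simp add: F_def algebra_simps)
  qed
  obtain p q where p: "bnd P p" and q: "bnd B q" using P B by (auto simp: contractive_def)
  have a: "bnd a 1" and b: "bnd b 1" unfolding a_def b_def using contractive_exp[OF P s] contractive_exp[OF B s] by auto
  have Cb: "bnd C (2 * p * q)" unfolding C_def by (rule commutator[OF p q])
  have "bnd (F s - F 0) (h s - h 0)"
  proof (rule mvt[OF s])
    show "(F has_vector_derivative F' u) (at u)" for u
    proof -
      have "((\<lambda>u. exp (u *\<^sub>R P) * B * exp (u *\<^sub>R (- P))) has_vector_derivative
        exp (u *\<^sub>R P) * C * exp (u *\<^sub>R (- P))) (at u)"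
        using conj_derivative[of "- P" B u] by (simp add: C_def)
      moreover have "((\<lambda>u. exp (u *\<^sub>R B) * P * exp (u *\<^sub>R (- B))) has_vector_derivative
        exp (u *\<^sub>R B) * (- C) * exp (u *\<^sub>R (- B))) (at u)"
        using conj_derivative[of "- B" P u] by (simp add: C_def)
      ultimately show ?thesis
        unfolding F_def F'_def
        by (intro has_vector_derivative_add has_vector_derivative_mult_left_const has_vector_derivative_mult_right_const)
    qed
    show "(h has_real_derivative ((s - u) * \<alpha> + u * \<beta>)) (at u)" for u
      unfolding h_def by (auto intro!: derivative_eq_intros)
    have "bnd (F s - F 0) ((1 * q + q * 1) * 1 * 1 + 1 * (1 * p + p * 1) * 1)"
      unfolding Fs by (intro add mult minus a b p q)
    then show "bnd (F s - F 0) ((1 * q + q * 1) * 1 * 1 + 1 * (1 * p + p * 1) * 1)" .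
    fix u assume u: "0 \<le> u" "u \<le> s"
    \<comment> \<open>Splitting a = x y and b = x' y' at the intermediate time u removes the
      backward exponentials.\<close>
    define x y x' y' where "x = exp (u *\<^sub>R P)" and "y = exp ((s - u) *\<^sub>R P)"
      and "x' = exp (u *\<^sub>R B)" and "y' = exp ((s - u) *\<^sub>R B)"
    have xy: "a = x * y" "b = x' * y'"
      unfolding a_def b_def x_def y_def x'_def y'_def by (simp_all add: exp_scaleR_add[symmetric])
    have y: "exp (u *\<^sub>R (- P)) * a = y" "exp (u *\<^sub>R (- B)) * b = y'"
      unfolding xy x_def x'_def by (simp_all add: mult.assoc[symmetric] exp_minus_mult_exp)
    have "F' u = x * C * (exp (u *\<^sub>R (- P)) * a) * b * a + a * (x' * (- C) * (exp (u *\<^sub>R (- B)) * b) * a)"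
      by (simp add: F'_def x_def x'_def mult.assoc)
    also have "\<dots> = x * C * y * b * a - a * x' * C * y' * a"
      unfolding y by (simp add: mult.assoc)
    \<comment> \<open>The term a C b a is inserted twice with opposite signs: moving
      \<open>C\<close> across y costs a commutator with exp ((s - u) P), moving it across x' one
      with exp (u B).\<close>
    also have "\<dots> = (x * C * y * b * a - x * y * C * b * a) + (a * C * x' * y' * a - a * x' * C * y' * a)"
      unfolding xy by (simp add: mult.assoc)
    also have "\<dots> = x * (C * y - y * C) * b * a + a * (C * x' - x' * C) * y' * a"
      by (simp add: algebra_simps)
    finally have F'u: "F' u = x * (C * y - y * C) * b * a + a * (C * x' - x' * C) * y' * a" .
    have "bnd (F' u) (1 * ((s - u) * \<alpha>) * 1 * 1 + 1 * (u * \<beta>) * 1 * 1)"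
      unfolding F'u
    proof (intro add mult a b)
      show "bnd x 1" "bnd y' 1"
        unfolding x_def y'_def using u by (auto intro!: contractive_exp P B)
      show "bnd (C * y - y * C) ((s - u) * \<alpha>)"
        unfolding y_def using u by (intro commutator_exp[OF P Cb \<alpha>]) auto
      show "bnd (C * x' - x' * C) (u * \<beta>)"
        unfolding x'_def using u by (intro commutator_exp[OF B Cb \<beta>]) auto
    qed
    then show "bnd (F' u) ((s - u) * \<alpha> + u * \<beta>)" by simp
  qed
  moreover have "h s - h 0 = s\<^sup>2 / 2 * (\<alpha> + \<beta>)" by (simp add: h_def power2_eq_square algebra_simps)
  ultimately show ?thesis unfolding Fs by simp
qed

text \<open>With G = 2 P + B, the family exp ((\<tau> - s) G) S(s) leads from exp (\<tau> G) to the
  Strang product S(\<tau>). Its derivative is the defect S' - G S propagated by a contraction; the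
  rate s^2 (\<alpha> + \<beta>) / 2 integrates to \<tau>^3 (\<alpha> + \<beta>) / 6.\<close>

lemma strang_splitting:
  assumes P: "contractive P" and B: "contractive B" and G: "contractive (P + P + B)" and \<tau>: "0 \<le> \<tau>"
  defines "C \<equiv> P * B - B * P"
  assumes \<alpha>: "bnd (C * P - P * C) \<alpha>" and \<beta>: "bnd (C * B - B * C) \<beta>"
  shows "bnd (exp (\<tau> *\<^sub>R P) * exp (\<tau> *\<^sub>R B) * exp (\<tau> *\<^sub>R P) -
    exp (\<tau> *\<^sub>R (P + P + B))) (\<tau> ^ 3 / 6 * (\<alpha> + \<beta>))"
proof -
  define G where "G = P + P + B"
  define S where "S s = exp (s *\<^sub>R P) * exp (s *\<^sub>R B) * exp (s *\<^sub>R P)" for s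
  define S' where "S' s = exp (s *\<^sub>R P) * exp (s *\<^sub>R B) * (P * exp (s *\<^sub>R P))
    + (exp (s *\<^sub>R P) * (B * exp (s *\<^sub>R B)) + (P * exp (s *\<^sub>R P)) * exp (s *\<^sub>R B)) *
      exp (s *\<^sub>R P)" for s
  have S: "(S has_vector_derivative S' s) (at s)" for s
    unfolding S_def S'_def by (intro has_vector_derivative_mult exp_scaleR_has_vector_derivative_left)
  define F where "F s = exp (\<tau> *\<^sub>R G) * (exp (s *\<^sub>R (- G)) * S s)" for s
  define F' where "F' s = exp (\<tau> *\<^sub>R G) * (exp (s *\<^sub>R (- G)) * S' s + exp (s *\<^sub>R (- G)) * (- G) * S s)" for s
  have F: "F \<tau> - F 0 = S \<tau> - exp (\<tau> *\<^sub>R G)"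
    by (simp add: F_def S_def mult.assoc[symmetric] exp_minus_mult_exp)
  have "bnd (F \<tau> - F 0) (\<tau> ^ 3 / 6 * (\<alpha> + \<beta>) - 0 ^ 3 / 6 * (\<alpha> + \<beta>))"
  proof (rule mvt[OF \<tau>])
    show "(F has_vector_derivative F' s) (at s)" for s
      unfolding F_def F'_def
      by (intro has_vector_derivative_mult_left_const has_vector_derivative_mult S exp_scaleR_has_vector_derivative_right)
    show "((\<lambda>s. s ^ 3 / 6 * (\<alpha> + \<beta>)) has_real_derivative s\<^sup>2 / 2 * (\<alpha> + \<beta>)) (at s)" for s
      by (auto intro!: derivative_eq_intros simp: power2_eq_square)
    show "bnd (F \<tau> - F 0) (1 * 1 * 1 + 1)"
      unfolding F S_def using contractive_exp[OF P \<tau>] contractive_exp[OF B \<tau>] contractive_exp[OF G \<tau>]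
      by (intro minus mult) (auto simp: G_def)
    fix s assume s: "0 \<le> s" "s \<le> \<tau>"
    define a b where "a = exp (s *\<^sub>R P)" and "b = exp (s *\<^sub>R B)"
    have c: "a * P = P * a" "b * B = B * b" by (simp_all add: a_def b_def exp_times_scaleR_commute)
    have "S' s - G * S s = a * (b * P) * a + a * (B * b) * a + P * a * b * a - (P + P + B) * (a * b * a)"
      by (simp add: S'_def S_def G_def a_def[symmetric] b_def[symmetric] algebra_simps)
    \<comment> \<open>The last bracket vanishes because \<open>a\<close> commutes with
      \<open>P\<close>.\<close>
    also have "\<dots> = (a * B - B * a) * b * a + a * (b * P - P * b) * a + (a * P * b * a - P * a * b * a)"
      by (simp add: algebra_simps)
    finally have d: "S' s - G * S s = (a * B - B * a) * b * a + a * (b * P - P * b) * a" using c by simp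
    have "F' s = exp (\<tau> *\<^sub>R G) * exp (s *\<^sub>R (- G)) * (S' s - G * S s)"
      by (simp add: F'_def algebra_simps)
    also have "exp (\<tau> *\<^sub>R G) * exp (s *\<^sub>R (- G)) = exp ((\<tau> - s) *\<^sub>R G)"
      using exp_scaleR_add[of \<tau> "- s" G] by simp
    finally have F's: "F' s = exp ((\<tau> - s) *\<^sub>R G) * (S' s - G * S s)" .
    have "bnd (F' s) (1 * (s\<^sup>2 / 2 * (\<alpha> + \<beta>)))"
      unfolding F's d
    proof (rule mult)
      show "bnd (exp ((\<tau> - s) *\<^sub>R G)) 1"
        unfolding G_def using s by (intro contractive_exp[OF G]) auto
      show "bnd ((a * B - B * a) * b * a + a * (b * P - P * b) * a) (s\<^sup>2 / 2 * (\<alpha> + \<beta>))"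
        unfolding a_def b_def using strang_defect[OF P B s(1)] \<alpha> \<beta> unfolding C_def by blast
    qed
    then show "bnd (F' s) (s\<^sup>2 / 2 * (\<alpha> + \<beta>))" by simp
  qed
  then show ?thesis by (simp add: F S_def G_def)
qed

lemma power_diff:
  assumes x: "bnd x 1" and y: "bnd y 1" and e: "bnd (x - y) e"
  shows "bnd (x ^ n - y ^ n) (real n * e)"
proof (induction n)
  case 0
  show ?case using zero by simp
next
  case (Suc n)
  have "x ^ Suc n - y ^ Suc n = x * (x ^ n - y ^ n) + (x - y) * y ^ n"
    by (simp add: algebra_simps)
  moreover have "bnd \<dots> (1 * (real n * e) + e * 1 ^ n)"
    by (intro add mult x e Suc.IH power y)
  ultimately show ?case by (simp add: algebra_simps)
qed

end

section \<open>Superoperators in a Banach algebra\<close>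

text \<open>The library proves completeness of \<^typ>\<open>nat \<Rightarrow>\<^sub>C complex\<close> only for metric domains.\<close>

instantiation nat :: metric_space
begin

definition dist_nat :: "nat \<Rightarrow> nat \<Rightarrow> real" where "dist_nat m n = \<bar>real m - real n\<bar>"
definition uniformity_nat :: "(nat \<times> nat) filter"
  where "uniformity_nat = (INF e\<in>{0<..}. principal {(x, y). dist x y < e})"

instance
proof
  fix U :: "nat set"
  have "\<forall>\<^sub>F (x', y) in uniformity. x' = x \<longrightarrow> y \<in> U" if "x \<in> U" for x
  proof -
    have "eventually (\<lambda>(x', y). x' = x \<longrightarrow> y \<in> U) (principal {(x, y :: nat). dist x y < 1})"
    proof -
      have "x = y" if "\<bar>real x - real y\<bar> < 1" for y using that by linarith
      then show ?thesis using \<open>x \<in> U\<close> by (auto simp: eventually_principal dist_nat_def)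
    qed
    then show ?thesis
      unfolding uniformity_nat_def by (rule eventually_INF1[rotated]) simp
  qed
  then show "open U \<longleftrightarrow> (\<forall>x\<in>U. \<forall>\<^sub>F (x', y) in uniformity. x' = x \<longrightarrow> y \<in> U)"
    using open_discrete by blast
qed (auto simp: dist_nat_def uniformity_nat_def)

end

instance bcontfun :: (metric_space, banach) banach ..

type_synonym bseq = "nat \<Rightarrow>\<^sub>C complex"

text \<open>A Banach algebra that contains the superoperators of all dimensions: the matrices are embedded
  into one fixed Banach space of sequences.\<close>

typedef endo = "UNIV :: (bseq \<Rightarrow>\<^sub>L bseq) set" morphisms endo_rep Endo ..

setup_lifting type_definition_endo

instantiation endo :: real_normed_vector
begin

lift_definition zero_endo :: endo is 0 .
lift_definition plus_endo :: "endo \<Rightarrow> endo \<Rightarrow> endo" is "(+)" .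
lift_definition minus_endo :: "endo \<Rightarrow> endo \<Rightarrow> endo" is "(-)" .
lift_definition uminus_endo :: "endo \<Rightarrow> endo" is uminus .
lift_definition scaleR_endo :: "real \<Rightarrow> endo \<Rightarrow> endo" is "(*\<^sub>R)" .
lift_definition norm_endo :: "endo \<Rightarrow> real" is norm .
lift_definition dist_endo :: "endo \<Rightarrow> endo \<Rightarrow> real" is dist .
lift_definition sgn_endo :: "endo \<Rightarrow> endo" is sgn .
definition uniformity_endo :: "(endo \<times> endo) filter"
  where "uniformity_endo = (INF e\<in>{0<..}. principal {(x, y). dist x y < e})"
definition open_endo :: "endo set \<Rightarrow> bool"
  where "open_endo S = (\<forall>x\<in>S. \<forall>\<^sub>F (x', y) in uniformity. x' = x \<longrightarrow> y \<in> S)"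

instance
  by standard
    (simp only: uniformity_endo_def open_endo_def |
      (transfer, simp add: algebra_simps dist_norm norm_triangle_ineq sgn_div_norm))+

end

instantiation endo :: real_normed_algebra_1
begin

lift_definition one_endo :: endo is id_blinfun .
lift_definition times_endo :: "endo \<Rightarrow> endo \<Rightarrow> endo" is "(o\<^sub>L)" .

lemma norm_id_blinfun_bseq: "norm (id_blinfun :: bseq \<Rightarrow>\<^sub>L bseq) = 1"
proof (rule antisym[OF norm_blinfun_id_le])
  define c :: bseq where "c = const_bcontfun 1"
  have "norm c \<ge> norm (apply_bcontfun c 0)" by (rule norm_bounded)
  then have c: "norm c \<ge> 1" by (simp add: c_def)
  have "norm (blinfun_apply id_blinfun c) \<le> norm (id_blinfun :: bseq \<Rightarrow>\<^sub>L bseq) * norm c"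
    by (rule norm_blinfun)
  then have "1 * norm c \<le> norm (id_blinfun :: bseq \<Rightarrow>\<^sub>L bseq) * norm c" by simp
  then show "1 \<le> norm (id_blinfun :: bseq \<Rightarrow>\<^sub>L bseq)" by (rule mult_right_le_imp_le) (use c in linarith)
qed

instance
proof
  fix a b c :: endo and r :: real
  show "a * b * c = a * (b * c)" by transfer (simp add: blinfun_eqI)
  show "(a + b) * c = a * c + b * c" by transfer (simp add: blinfun_eqI blinfun.bilinear_simps)
  show "a * (b + c) = a * b + a * c" by transfer (simp add: blinfun_eqI blinfun.bilinear_simps)
  show "1 * a = a" "a * 1 = a" by (transfer, simp add: blinfun_eqI)+
  show "r *\<^sub>R a * b = r *\<^sub>R (a * b)" "a * r *\<^sub>R b = r *\<^sub>R (a * b)"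
    by (transfer, simp add: blinfun_eqI blinfun.bilinear_simps)+
  show "(0 :: endo) \<noteq> 1"
  proof (transfer, rule notI)
    assume "(0 :: bseq \<Rightarrow>\<^sub>L bseq) = id_blinfun"
    then have "norm (0 :: bseq \<Rightarrow>\<^sub>L bseq) = 1" using norm_id_blinfun_bseq by simp
    then show False by simp
  qed
  show "norm (a * b) \<le> norm a * norm b" by transfer (rule norm_blinfun_compose)
  show "norm (1 :: endo) = 1" by transfer (rule norm_id_blinfun_bseq)
qed

end

instance endo :: banach
proof
  fix X :: "nat \<Rightarrow> endo"
  assume "Cauchy X"
  have d: "dist x y = dist (endo_rep x) (endo_rep y)" for x y by (rule dist_endo.rep_eq)
  have "Cauchy (\<lambda>n. endo_rep (X n))" using \<open>Cauchy X\<close> unfolding Cauchy_def d .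
  then have "convergent (\<lambda>n. endo_rep (X n))" by (rule Cauchy_convergent)
  then obtain L where "(\<lambda>n. endo_rep (X n)) \<longlonglongrightarrow> L" unfolding convergent_def ..
  then have "X \<longlonglongrightarrow> Endo L"
    unfolding tendsto_iff d by (simp add: Endo_inverse)
  then show "convergent X" by (auto simp: convergent_def)
qed

lift_definition app :: "endo \<Rightarrow> bseq \<Rightarrow> bseq" is blinfun_apply .

lemma bounded_bilinear_app: "bounded_bilinear app"
proof
  fix a a' :: endo and v v' :: bseq and r :: real
  show "app (a + a') v = app a v + app a' v" "app a (v + v') = app a v + app a v'"
    "app (r *\<^sub>R a) v = r *\<^sub>R app a v" "app a (r *\<^sub>R v) = r *\<^sub>R app a v"
    by (transfer, simp add: blinfun.bilinear_simps)+
  have "norm (app a v) \<le> norm a * norm v * 1" for a v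
    by transfer (simp add: norm_blinfun)
  then show "\<exists>K. \<forall>a v. norm (app a v) \<le> norm a * norm v * K" by blast
qed

interpretation app: bounded_bilinear app by (rule bounded_bilinear_app)

lemma app_mult [simp]: "app (a * b) v = app a (app b v)" by transfer simp

lemma app_one [simp]: "app 1 v = v" by transfer simp

section \<open>Matrices as sequences and superoperators as algebra elements\<close>

definition enc :: "nat \<Rightarrow> complex mat \<Rightarrow> bseq" where
  "enc D R = Bcontfun (\<lambda>k. if k < D * D then R $$ (k div D, k mod D) else 0)"

definition dec :: "nat \<Rightarrow> bseq \<Rightarrow> complex mat" where
  "dec D v = mat D D (\<lambda>(i, j). apply_bcontfun v (i * D + j))"

lemma apply_enc [simp]:
  "apply_bcontfun (enc D R) k = (if k < D * D then R $$ (k div D, k mod D) else 0)"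
proof -
  have "(\<lambda>k. if k < D * D then R $$ (k div D, k mod D) else 0) \<in> bcontfun"
  proof (rule bcontfun_normI)
    show "continuous_on UNIV (\<lambda>k. if k < D * D then R $$ (k div D, k mod D) else 0)"
      by (rule continuous_on_discrete)
    fix k show "cmod (if k < D * D then R $$ (k div D, k mod D) else 0) \<le> (\<Sum>k<D * D. cmod (R $$ (k div D, k mod D)))"
      using member_le_sum[of k "{..<D * D}" "\<lambda>k. cmod (R $$ (k div D, k mod D))"]
      by (auto intro: sum_nonneg)
  qed
  then show ?thesis by (simp add: enc_def Bcontfun_inverse)
qed

lemma dec_carrier [simp]: "dec D v \<in> carrier_mat D D" by (simp add: dec_def)

lemma dec_dim [simp]: "dim_row (dec D v) = D" "dim_col (dec D v) = D" by (simp_all add: dec_def)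

lemma pair_index_less: "i < (D::nat) \<Longrightarrow> j < E \<Longrightarrow> i * E + j < D * E"
  by (metis add.commute div_less_iff_less_mult div_mult_self1 div_less add_0_right less_nat_zero_code not_gr_zero)

lemma dec_enc [simp]: "R \<in> carrier_mat D D \<Longrightarrow> dec D (enc D R) = R"
  by (rule eq_matI) (auto simp: dec_def pair_index_less)

lemma enc_inject: "R \<in> carrier_mat D D \<Longrightarrow> S \<in> carrier_mat D D \<Longrightarrow> enc D R = enc D S \<longleftrightarrow> R = S"
  by (metis dec_enc)

lemma div_mod_less: "k < D * D \<Longrightarrow> k div D < D \<and> k mod D < (D::nat)"
  by (metis less_mult_imp_div_less mod_less_divisor mult_0_right mult_is_0 not_gr_zero not_less_zero)

lemma enc_add: "R \<in> carrier_mat D D \<Longrightarrow> S \<in> carrier_mat D D \<Longrightarrow> enc D (R + S) = enc D R + enc D S"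
  by (rule bcontfun_eqI) (auto simp: div_mod_less)

lemma enc_minus: "R \<in> carrier_mat D D \<Longrightarrow> S \<in> carrier_mat D D \<Longrightarrow> enc D (R - S) = enc D R - enc D S"
  by (rule bcontfun_eqI) (auto simp: div_mod_less)

lemma enc_smult: "R \<in> carrier_mat D D \<Longrightarrow> enc D (of_real c \<cdot>\<^sub>m R) = c *\<^sub>R enc D R"
  by (rule bcontfun_eqI) (auto simp: div_mod_less scaleR_conv_of_real)

lemma dec_add: "dec D (v + w) = dec D v + dec D w"
  by (rule eq_matI) (auto simp: dec_def)

lemma dec_minus: "dec D (v - w) = dec D v - dec D w"
  by (rule eq_matI) (auto simp: dec_def)

lemma dec_scale: "dec D (c *\<^sub>R v) = of_real c \<cdot>\<^sub>m dec D v"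
  by (rule eq_matI) (auto simp: dec_def scaleR_conv_of_real)

lemma bounded_linear_coord: "bounded_linear (\<lambda>v :: bseq. apply_bcontfun v k)"
  by (rule bounded_linear_intro[of _ 1]) (auto simp: norm_bounded)

lemma dec_index: "i < D \<Longrightarrow> j < D \<Longrightarrow> dec D v $$ (i, j) = apply_bcontfun v (i * D + j)"
  by (simp add: dec_def)

lemma bounded_linear_dec_index: "i < D \<Longrightarrow> j < D \<Longrightarrow> bounded_linear (\<lambda>v. dec D v $$ (i, j))"
  by (simp add: dec_index bounded_linear_coord)

lemma bounded_linear_mtr_dec:
  assumes "W \<in> carrier_mat D D"
  shows "bounded_linear (\<lambda>v. mtr (W * dec D v))"
  unfolding mtr_mult[OF assms dec_carrier]
  by (intro bounded_linear_sum bounded_linear_const_mult bounded_linear_dec_index) auto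

lemma bounded_linear_mtr: "bounded_linear (\<lambda>v. mtr (dec D v))"
  unfolding mtr_def by (simp, intro bounded_linear_sum bounded_linear_dec_index) auto

definition unit_mat :: "nat \<Rightarrow> nat \<times> nat \<Rightarrow> complex mat" where
  "unit_mat n p = mat n n (\<lambda>q. if q = p then 1 else 0)"

lemma unit_mat_carrier [simp]: "unit_mat n p \<in> carrier_mat n n"
  by (simp add: unit_mat_def)

lemma linear_superop_carrier: "linear_superop n T \<Longrightarrow> R \<in> carrier_mat n n \<Longrightarrow> T R \<in> carrier_mat n n"
  by (simp add: linear_superop_def)

lemma linear_superop_add:
  "linear_superop n T \<Longrightarrow> R \<in> carrier_mat n n \<Longrightarrow> S \<in> carrier_mat n n \<Longrightarrow> T (R + S) = T R + T S"
  by (simp add: linear_superop_def)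

lemma linear_superop_smult:
  "linear_superop n T \<Longrightarrow> R \<in> carrier_mat n n \<Longrightarrow> T (c \<cdot>\<^sub>m R) = c \<cdot>\<^sub>m T R"
  by (simp add: linear_superop_def)

lemma linear_superop_minus:
  assumes T: "linear_superop n T" and R: "R \<in> carrier_mat n n" and S: "S \<in> carrier_mat n n"
  shows "T (R - S) = T R - T S"
proof -
  have "R - S = R + (- 1) \<cdot>\<^sub>m S" using R S by (intro eq_matI) auto
  then have "T (R - S) = T R + (- 1) \<cdot>\<^sub>m T S"
    using linear_superop_add[OF T R, of "(- 1) \<cdot>\<^sub>m S"] linear_superop_smult[OF T S] S by simp
  then show ?thesis
    using linear_superop_carrier[OF T] R S by (simp, intro eq_matI) auto
qed

lemma linear_superop_index:
  assumes T: "linear_superop n T" and R: "R \<in> carrier_mat n n" and ab: "a < n" "b < n"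
  shows "T R $$ (a, b) = (\<Sum>i<n. \<Sum>j<n. R $$ (i, j) * T (unit_mat n (i, j)) $$ (a, b))"
proof -
  define RS where "RS S = mat n n (\<lambda>q. if q \<in> S then R $$ q else 0)" for S
  have RS: "RS S \<in> carrier_mat n n" for S by (simp add: RS_def)
  have "T (RS S) $$ (a, b) = (\<Sum>p\<in>S. R $$ p * T (unit_mat n p) $$ (a, b))" if "finite S" for S
    using that
  proof (induction S rule: finite_induct)
    case empty
    have "RS {} = 0 \<cdot>\<^sub>m (0\<^sub>m n n)" by (rule eq_matI) (auto simp: RS_def)
    then have "T (RS {}) = 0 \<cdot>\<^sub>m T (0\<^sub>m n n)" by (simp only: linear_superop_smult[OF T zero_carrier_mat])
    then show ?case using ab linear_superop_carrier[OF T, of "0\<^sub>m n n"] by simp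
  next
    case (insert p S)
    have "RS (insert p S) = RS S + R $$ p \<cdot>\<^sub>m unit_mat n p"
      by (rule eq_matI) (use insert in \<open>auto simp: RS_def unit_mat_def\<close>)
    then have "T (RS (insert p S)) = T (RS S) + R $$ p \<cdot>\<^sub>m T (unit_mat n p)"
      using linear_superop_add[OF T RS] linear_superop_smult[OF T unit_mat_carrier] by simp
    then show ?case
      using insert ab linear_superop_carrier[OF T RS, of S] linear_superop_carrier[OF T unit_mat_carrier, of p]
      by simp
  qed
  from this[of "{..<n} \<times> {..<n}"]
  have "T (RS ({..<n} \<times> {..<n})) $$ (a, b) = (\<Sum>i<n. \<Sum>j<n. R $$ (i, j) * T (unit_mat n (i, j)) $$ (a, b))"
    by (simp add: sum.cartesian_product case_prod_unfold)
  moreover have "RS ({..<n} \<times> {..<n}) = R" by (rule eq_matI) (use R in \<open>auto simp: RS_def\<close>)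
  ultimately show ?thesis by simp
qed

lemma linear_superop_funpow:
  "linear_superop n T \<Longrightarrow> R \<in> carrier_mat n n \<Longrightarrow> (T ^^ k) R \<in> carrier_mat n n"
  by (induction k) (auto intro: linear_superop_carrier)

text \<open>Coordinates beyond the D^2 matrix entries are annihilated. Products of linear
  superoperators become products, but the unit of the algebra is the identity on all sequences, so
  exponentials are compared only on encoded matrices.\<close>

definition hat :: "nat \<Rightarrow> superop \<Rightarrow> endo" where
  "hat D T = Endo (Blinfun (\<lambda>v. enc D (T (dec D v))))"

lemma app_hat:
  assumes T: "linear_superop D T"
  shows "app (hat D T) v = enc D (T (dec D v))"
proof -
  have "bounded_linear (\<lambda>v. enc D (T (dec D v)))"
  proof (rule bounded_linear_intro)
    fix v w :: bseq and c :: real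
    show "enc D (T (dec D (v + w))) = enc D (T (dec D v)) + enc D (T (dec D w))"
      using linear_superop_carrier[OF T] by (simp add: dec_add linear_superop_add[OF T] enc_add)
    show "enc D (T (dec D (c *\<^sub>R v))) = c *\<^sub>R enc D (T (dec D v))"
      using linear_superop_carrier[OF T] by (simp add: dec_scale linear_superop_smult[OF T] enc_smult)
    \<comment> \<open>Sum of the moduli of all matrix elements, a bound for each coordinate and thus
      for the supremum norm.\<close>
    define K where "K = (\<Sum>a<D. \<Sum>b<D. \<Sum>i<D. \<Sum>j<D. cmod (T (unit_mat D (i, j)) $$ (a, b)))"
    have K0: "K \<ge> 0" unfolding K_def by (intro sum_nonneg) auto
    show "norm (enc D (T (dec D v))) \<le> norm v * K"
    proof (rule norm_bound)
      fix k
      show "cmod (apply_bcontfun (enc D (T (dec D v))) k) \<le> norm v * K"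
      proof (cases "k < D * D")
        case True
        then have ab: "k div D < D" "k mod D < D" using div_mod_less by auto
        have "cmod (T (dec D v) $$ (k div D, k mod D)) \<le>
          (\<Sum>i<D. \<Sum>j<D. cmod (dec D v $$ (i, j) * T (unit_mat D (i, j)) $$ (k div D, k mod D)))"
          unfolding linear_superop_index[OF T dec_carrier ab]
          by (intro order_trans[OF norm_sum] sum_mono norm_sum)
        also have "\<dots> \<le> (\<Sum>i<D. \<Sum>j<D. norm v * cmod (T (unit_mat D (i, j)) $$ (k div D, k mod D)))"
          by (intro sum_mono) (auto simp: norm_mult dec_index intro!: mult_right_mono norm_bounded)
        also have "\<dots> = norm v * (\<Sum>i<D. \<Sum>j<D. cmod (T (unit_mat D (i, j)) $$ (k div D, k mod D)))"
          by (simp add: sum_distrib_left)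
        also have "\<dots> \<le> norm v * (\<Sum>b<D. \<Sum>i<D. \<Sum>j<D. cmod (T (unit_mat D (i, j)) $$ (k div D, b)))"
          using ab by (intro mult_left_mono member_le_sum[where f = "\<lambda>b. \<Sum>i<D. \<Sum>j<D. cmod (T (unit_mat D (i, j)) $$ (k div D, b))"])
            (auto intro!: sum_nonneg)
        also have "\<dots> \<le> norm v * K"
          unfolding K_def using ab
          by (intro mult_left_mono member_le_sum[where f = "\<lambda>a. \<Sum>b<D. \<Sum>i<D. \<Sum>j<D. cmod (T (unit_mat D (i, j)) $$ (a, b))"])
            (auto intro!: sum_nonneg)
        finally show ?thesis using True by simp
      next
        case False
        then show ?thesis using K0 by simp
      qed
    qed
  qed
  then show ?thesis
    unfolding hat_def by (simp add: app.rep_eq Endo_inverse bounded_linear_Blinfun_apply)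
qed

lemma app_hat_enc: "linear_superop D T \<Longrightarrow> R \<in> carrier_mat D D \<Longrightarrow> app (hat D T) (enc D R) = enc D (T R)"
  by (simp add: app_hat)

lemma endo_eqI: "(\<And>v. app x v = app y v) \<Longrightarrow> x = y"
  by transfer (rule blinfun_eqI)

lemma app_hat_power:
  assumes T: "linear_superop D T" and R: "R \<in> carrier_mat D D"
  shows "app (hat D T ^ k) (enc D R) = enc D ((T ^^ k) R)"
  by (induction k) (simp_all add: app_hat_enc[OF T] linear_superop_funpow[OF T R])

text \<open>The functional \<open>f\<close> is left open: a matrix entry identifies the exponential
  with the entrywise series of \<open>superop_exp\<close>, the trace yields trace
  preservation.\<close>

lemma app_exp_hat_sums:
  assumes T: "linear_superop D T" and R: "R \<in> carrier_mat D D" and f: "bounded_linear f"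
  shows "(\<lambda>k. (\<tau> ^ k / fact k) *\<^sub>R f (enc D ((T ^^ k) R))) sums f (app (exp (\<tau> *\<^sub>R hat D T)) (enc D R))"
proof -
  have "bounded_linear (\<lambda>x. f (app x (enc D R)))"
    by (rule bounded_linear_compose[OF f app.bounded_linear_left])
  from bounded_linear.sums[OF this exp_converges[of "\<tau> *\<^sub>R hat D T"]]
  show ?thesis
    using f by (simp add: app.scaleR_left app_hat_power[OF T R] linear_simps(5)[OF f] scaleR_power divide_inverse mult.commute)
qed

lemma superop_exp_eq:
  assumes T: "linear_superop D T" and R: "R \<in> carrier_mat D D"
  shows "superop_exp D \<tau> T R = dec D (app (exp (\<tau> *\<^sub>R hat D T)) (enc D R))"
proof (rule eq_matI)
  fix i j assume "i < dim_row (dec D (app (exp (\<tau> *\<^sub>R hat D T)) (enc D R)))"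
    "j < dim_col (dec D (app (exp (\<tau> *\<^sub>R hat D T)) (enc D R)))"
  then have ij: "i < D" "j < D" by auto
  have "(\<lambda>k. (\<tau> ^ k / fact k) *\<^sub>R dec D (enc D ((T ^^ k) R)) $$ (i, j)) sums
    (dec D (app (exp (\<tau> *\<^sub>R hat D T)) (enc D R)) $$ (i, j))"
    by (rule app_exp_hat_sums[OF T R bounded_linear_dec_index[OF ij]])
  then have "(\<lambda>k. complex_of_real (\<tau> ^ k / fact k) * (T ^^ k) R $$ (i, j)) sums
    (dec D (app (exp (\<tau> *\<^sub>R hat D T)) (enc D R)) $$ (i, j))"
    using linear_superop_funpow[OF T R] by (simp add: scaleR_conv_of_real)
  then show "superop_exp D \<tau> T R $$ (i, j) = dec D (app (exp (\<tau> *\<^sub>R hat D T)) (enc D R)) $$ (i, j)"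
    using ij by (simp add: superop_exp_def sums_unique[symmetric])
qed (simp_all add: superop_exp_def)

text \<open>All terms of the exponential series but the zeroth have trace zero.\<close>

lemma superop_exp_mtr:
  assumes T: "linear_superop D T" and R: "R \<in> carrier_mat D D"
    and tr: "\<And>S. S \<in> carrier_mat D D \<Longrightarrow> mtr (T S) = 0"
  shows "mtr (superop_exp D \<tau> T R) = mtr R"
proof -
  have "(\<lambda>k. (\<tau> ^ k / fact k) *\<^sub>R mtr (dec D (enc D ((T ^^ k) R)))) sums mtr (superop_exp D \<tau> T R)"
    unfolding superop_exp_eq[OF T R] by (rule app_exp_hat_sums[OF T R bounded_linear_mtr])
  moreover have "(\<tau> ^ k / fact k) *\<^sub>R mtr (dec D (enc D ((T ^^ k) R))) = (if k = 0 then mtr R else 0)" for k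
  proof -
    have "mtr (dec D (enc D ((T ^^ k) R))) = mtr ((T ^^ k) R)"
      using linear_superop_funpow[OF T R] by simp
    also have "\<dots> = (if k = 0 then mtr R else 0)"
      using linear_superop_funpow[OF T R] tr by (cases k) auto
    finally show ?thesis by simp
  qed
  ultimately have "(\<lambda>k. if k = 0 then mtr R else 0) sums mtr (superop_exp D \<tau> T R)" by simp
  moreover have "(\<lambda>k. if k = 0 then mtr R else 0) sums mtr R"
    using sums_single[of 0 "\<lambda>_. mtr R"] by simp
  ultimately show ?thesis by (rule sums_unique2)
qed

text \<open>The induced trace norm on Hermitian matrices together with preservation of Hermiticity.
  A relation rather than a number, because for a general algebra element the image of an encoded
  matrix need not encode any matrix.\<close>

definition herm_bound :: "nat \<Rightarrow> endo \<Rightarrow> real \<Rightarrow> bool" where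
  "herm_bound D x c \<longleftrightarrow> (\<forall>R. hermitian_mat D R \<longrightarrow>
     (\<exists>S. hermitian_mat D S \<and> app x (enc D R) = enc D S \<and> trace_norm S \<le> c * trace_norm R))"

lemma herm_boundE:
  assumes "herm_bound D x c" "hermitian_mat D R"
  obtains S where "hermitian_mat D S" "app x (enc D R) = enc D S" "trace_norm S \<le> c * trace_norm R"
  using assms unfolding herm_bound_def by blast

lemma herm_boundI:
  assumes "\<And>R. hermitian_mat D R \<Longrightarrow>
     \<exists>S. hermitian_mat D S \<and> app x (enc D R) = enc D S \<and> trace_norm S \<le> c * trace_norm R"
  shows "herm_bound D x c"
  using assms unfolding herm_bound_def by blast

text \<open>Continuity of the trace norm with respect to the sequence norm, needed to pass to
  limits.\<close>

lemma trace_norm_dec_le: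
  assumes "hermitian_mat D (dec D v)"
  shows "trace_norm (dec D v) \<le> sqrt (real D) * (real D * norm v)"
proof -
  have "(frob_norm (dec D v))\<^sup>2 \<le> (\<Sum>i<D. \<Sum>j<D. (norm v)\<^sup>2)"
    unfolding frob_norm_sq[OF dec_carrier]
    by (intro sum_mono power_mono) (auto simp: dec_index norm_bounded)
  also have "\<dots> = (real D * norm v)\<^sup>2" by (simp add: power2_eq_square)
  finally have "frob_norm (dec D v) \<le> real D * norm v" by (rule power2_le_imp_le) simp
  then have "sqrt (real D) * frob_norm (dec D v) \<le> sqrt (real D) * (real D * norm v)"
    by (intro mult_left_mono) auto
  then show ?thesis using trace_norm_le_frob_norm[OF assms] by simp
qed

lemma trace_norm_one: "trace_norm (1\<^sub>m D) = real D"
  using trace_norm_psd[OF psd_one] by (simp add: mtr_def)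

text \<open>The identity matrix is a Hermitian test matrix of positive trace norm, since D \<ge>
  1.\<close>

lemma herm_bound_nonneg:
  assumes D: "D \<ge> 1" and x: "herm_bound D x a"
  shows "0 \<le> a"
proof -
  have one: "hermitian_mat D (1\<^sub>m D)" by (rule psd_hermitian[OF psd_one])
  obtain S where S: "hermitian_mat D S" "trace_norm S \<le> a * trace_norm (1\<^sub>m D)"
    by (rule herm_boundE[OF x one])
  then have "0 \<le> a * real D"
    using trace_norm_nonneg[OF S(1)] by (simp add: trace_norm_one)
  moreover have "0 < real D" using D by simp
  ultimately show ?thesis by (simp add: zero_le_mult_iff)
qed

lemma op_bound_herm_bound:
  assumes D: "D \<ge> 1"
  shows "op_bound (herm_bound D)"
proof
  show "herm_bound D 1 1" by (rule herm_boundI) auto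
next
  fix x y a b assume x: "herm_bound D x a" and y: "herm_bound D y b"
  show "herm_bound D (x + y) (a + b)"
  proof (rule herm_boundI)
    fix R assume R: "hermitian_mat D R"
    obtain S where S: "hermitian_mat D S" "app x (enc D R) = enc D S" "trace_norm S \<le> a * trace_norm R"
      by (rule herm_boundE[OF x R])
    obtain S' where S': "hermitian_mat D S'" "app y (enc D R) = enc D S'" "trace_norm S' \<le> b * trace_norm R"
      by (rule herm_boundE[OF y R])
    show "\<exists>S. hermitian_mat D S \<and> app (x + y) (enc D R) = enc D S \<and> trace_norm S \<le> (a + b) * trace_norm R"
      using S S' trace_norm_triangle[OF S(1) S'(1)] hermitian_add[OF S(1) S'(1)]
      by (intro exI[of _ "S + S'"]) (auto simp: app.add_left enc_add[OF S(1)[THEN hermitian_carrier] S'(1)[THEN hermitian_carrier]] distrib_right)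
  qed
next
  fix x a assume x: "herm_bound D x a"
  show "0 \<le> a" by (rule herm_bound_nonneg[OF D x])
next
  fix x y a b assume x: "herm_bound D x a" and y: "herm_bound D y b"
  have a: "0 \<le> a" by (rule herm_bound_nonneg[OF D x])
  show "herm_bound D (x * y) (a * b)"
  proof (rule herm_boundI)
    fix R assume R: "hermitian_mat D R"
    obtain S' where S': "hermitian_mat D S'" "app y (enc D R) = enc D S'" "trace_norm S' \<le> b * trace_norm R"
      by (rule herm_boundE[OF y R])
    obtain S where S: "hermitian_mat D S" "app x (enc D S') = enc D S" "trace_norm S \<le> a * trace_norm S'"
      by (rule herm_boundE[OF x S'(1)])
    have "trace_norm S \<le> a * (b * trace_norm R)"
      using S(3) mult_left_mono[OF S'(3) a] by simp
    then show "\<exists>S. hermitian_mat D S \<and> app (x * y) (enc D R) = enc D S \<and> trace_norm S \<le> a * b * trace_norm R"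
      using S S' by (auto simp: mult.assoc)
  qed
next
  fix x a c assume x: "herm_bound D x a"
  show "herm_bound D (c *\<^sub>R x) (\<bar>c\<bar> * a)"
  proof (rule herm_boundI)
    fix R assume R: "hermitian_mat D R"
    obtain S where S: "hermitian_mat D S" "app x (enc D R) = enc D S" "trace_norm S \<le> a * trace_norm R"
      by (rule herm_boundE[OF x R])
    show "\<exists>S. hermitian_mat D S \<and> app (c *\<^sub>R x) (enc D R) = enc D S \<and> trace_norm S \<le> \<bar>c\<bar> * a * trace_norm R"
      using S mult_left_mono[OF S(3), of "\<bar>c\<bar>"]
      by (intro exI[of _ "of_real c \<cdot>\<^sub>m S"])
        (auto simp: app.scaleR_left enc_smult hermitian_carrier hermitian_smult trace_norm_smult mult.assoc)
  qed
next
  fix x a b assume x: "herm_bound D x a" and ab: "a \<le> (b::real)"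
  show "herm_bound D x b"
  proof (rule herm_boundI)
    fix R assume R: "hermitian_mat D R"
    obtain S where S: "hermitian_mat D S" "app x (enc D R) = enc D S" "trace_norm S \<le> a * trace_norm R"
      by (rule herm_boundE[OF x R])
    then show "\<exists>S. hermitian_mat D S \<and> app x (enc D R) = enc D S \<and> trace_norm S \<le> b * trace_norm R"
      using mult_right_mono[OF ab trace_norm_nonneg[OF R]] by force
  qed
next
  fix X :: "nat \<Rightarrow> endo" and x u and a :: real
  assume X: "X \<longlonglongrightarrow> x" and u: "u \<longlonglongrightarrow> a" and b: "\<And>n. herm_bound D (X n) (u n)"
  show "herm_bound D x a"
  proof (rule herm_boundI)
    fix R assume R: "hermitian_mat D R"
    have "\<forall>n. \<exists>S. hermitian_mat D S \<and> app (X n) (enc D R) = enc D S \<and> trace_norm S \<le> u n * trace_norm R"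
      using b R unfolding herm_bound_def by blast
    then obtain S where S: "\<And>n. hermitian_mat D (S n)" "\<And>n. app (X n) (enc D R) = enc D (S n)"
      "\<And>n. trace_norm (S n) \<le> u n * trace_norm R" by metis
    define v where "v = app x (enc D R)"
    have "(\<lambda>n. app (X n) (enc D R)) \<longlonglongrightarrow> v"
      unfolding v_def by (intro app.tendsto X tendsto_const)
    then have lim: "(\<lambda>n. enc D (S n)) \<longlonglongrightarrow> v" by (simp add: S)
    have c: "(\<lambda>n. apply_bcontfun (enc D (S n)) k) \<longlonglongrightarrow> apply_bcontfun v k" for k
      by (rule bounded_linear.tendsto[OF bounded_linear_coord lim])
    \<comment> \<open>Coordinates outside the matrix block vanish along the sequence, hence in the
      limit, so the limit again encodes a matrix.\<close>
    have ve: "v = enc D (dec D v)"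
    proof (rule bcontfun_eqI)
      fix k
      show "apply_bcontfun v k = apply_bcontfun (enc D (dec D v)) k"
      proof (cases "k < D * D")
        case True
        then show ?thesis using div_mod_less[OF True] by (simp add: dec_index)
      next
        case False
        then show ?thesis using c[of k] by (simp add: LIMSEQ_const_iff)
      qed
    qed
    have H: "hermitian_mat D (dec D v)"
    proof (rule hermitianI)
      fix i j assume ij: "i < D" "j < D"
      have d: "(\<lambda>n. S n $$ (i, j)) \<longlonglongrightarrow> dec D v $$ (i, j)" if "i < D" "j < D" for i j
        using c[of "i * D + j"] that by (simp add: pair_index_less dec_index)
      have "(\<lambda>n. cnj (S n $$ (j, i))) \<longlonglongrightarrow> cnj (dec D v $$ (j, i))"
        by (intro tendsto_cnj d ij)
      moreover have "(\<lambda>n. cnj (S n $$ (j, i))) = (\<lambda>n. S n $$ (i, j))"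
        using hermitian_index[OF S(1) ij] by simp
      ultimately show "dec D v $$ (i, j) = cnj (dec D v $$ (j, i))"
        using d[OF ij] LIMSEQ_unique by metis
    qed simp
    \<comment> \<open>The remainder is Hermitian and is controlled by the sequence norm, so it
      disappears in the limit.\<close>
    have "trace_norm (dec D v) \<le> u n * trace_norm R + sqrt (real D) * (real D * norm (v - enc D (S n)))" for n
    proof -
      have Sc: "S n \<in> carrier_mat D D" using S(1) by (rule hermitian_carrier)
      have e: "dec D (v - enc D (S n)) = dec D v - S n" using Sc by (simp add: dec_minus)
      have h: "hermitian_mat D (dec D (v - enc D (S n)))" unfolding e by (rule hermitian_minus[OF H S(1)])
      have "dec D v = S n + dec D (v - enc D (S n))" unfolding e using Sc by (intro eq_matI) auto
      then show ?thesis
        using trace_norm_triangle[OF S(1) h, of n] trace_norm_dec_le[OF h] S(3)[of n] by simp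
    qed
    moreover have "(\<lambda>n. u n * trace_norm R + sqrt (real D) * (real D * norm (v - enc D (S n)))) \<longlonglongrightarrow> a * trace_norm R + sqrt (real D) * (real D * norm (v - v))"
      by (intro tendsto_intros u lim)
    ultimately have "trace_norm (dec D v) \<le> a * trace_norm R"
      by (auto intro: LIMSEQ_le_const)
    then show "\<exists>S. hermitian_mat D S \<and> app x (enc D R) = enc D S \<and> trace_norm S \<le> a * trace_norm R"
      using H ve v_def by blast
  qed
next
  fix \<tau> a :: real and F F' :: "real \<Rightarrow> endo" and h h' :: "real \<Rightarrow> real"
  assume \<tau>: "0 \<le> \<tau>" and F: "\<And>s. 0 \<le> s \<Longrightarrow> s \<le> \<tau> \<Longrightarrow> (F has_vector_derivative F' s) (at s)"
    and h: "\<And>s. 0 \<le> s \<Longrightarrow> s \<le> \<tau> \<Longrightarrow> (h has_real_derivative h' s) (at s)"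
    and b: "\<And>s. 0 \<le> s \<Longrightarrow> s \<le> \<tau> \<Longrightarrow> herm_bound D (F' s) (h' s)"
    and a: "herm_bound D (F \<tau> - F 0) a"
  show "herm_bound D (F \<tau> - F 0) (h \<tau> - h 0)"
  proof (rule herm_boundI)
    fix R assume R: "hermitian_mat D R"
    \<comment> \<open>The a priori bound supplies the fact that the increment maps \<open>R\<close>
      to an encoded Hermitian matrix, for which a norming functional exists.\<close>
    obtain S where S: "hermitian_mat D S" "app (F \<tau> - F 0) (enc D R) = enc D S"
      by (rule herm_boundE[OF a R])
    obtain W where W: "W \<in> carrier_mat D D" "Re (mtr (W * S)) = trace_norm S"
      and Wb: "\<And>S. hermitian_mat D S \<Longrightarrow> \<bar>Re (mtr (W * S))\<bar> \<le> trace_norm S"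
      using trace_norm_norming[OF S(1)] by blast
    define f where "f x = Re (mtr (W * dec D (app x (enc D R))))" for x
    have "bounded_linear f"
      unfolding f_def
      by (rule bounded_linear_compose[OF bounded_linear_Re
            bounded_linear_compose[OF bounded_linear_mtr_dec[OF W(1)] app.bounded_linear_left]])
    then interpret f: bounded_linear f .
    \<comment> \<open>A real function with nonpositive derivative: the norming functional turns the
      operator inequality into monotonicity.\<close>
    define g where "g s = f (F s) - h s * trace_norm R" for s
    have "g \<tau> \<le> g 0"
    proof (rule DERIV_nonpos_imp_nonincreasing[OF \<tau>])
      fix s assume s: "0 \<le> s" "s \<le> \<tau>"
      have "((\<lambda>s. f (F s)) has_vector_derivative f (F' s)) (at s)"
        by (rule f.has_vector_derivative[OF F[OF s]])
      then have "((\<lambda>s. f (F s)) has_real_derivative f (F' s)) (at s)"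
        by (simp add: has_real_derivative_iff_has_vector_derivative)
      then have "(g has_real_derivative (f (F' s) - h' s * trace_norm R)) (at s)"
        unfolding g_def by (intro DERIV_diff DERIV_cmult_right h s)
      moreover have "f (F' s) \<le> h' s * trace_norm R"
      proof -
        obtain Q where Q: "hermitian_mat D Q" "app (F' s) (enc D R) = enc D Q" "trace_norm Q \<le> h' s * trace_norm R"
          by (rule herm_boundE[OF b[OF s] R])
        have "f (F' s) = Re (mtr (W * Q))" using hermitian_carrier[OF Q(1)] by (simp add: f_def Q(2))
        then show ?thesis using Wb[OF Q(1)] Q(3) by simp
      qed
      ultimately show "\<exists>y. (g has_real_derivative y) (at s) \<and> y \<le> 0"
        by (intro exI[of _ "f (F' s) - h' s * trace_norm R"]) auto
    qed
    moreover have "f (F \<tau> - F 0) = trace_norm S"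
      using hermitian_carrier[OF S(1)] by (simp add: f_def S(2) W(2))
    ultimately have "trace_norm S \<le> (h \<tau> - h 0) * trace_norm R"
      by (simp add: g_def f.diff left_diff_distrib)
    then show "\<exists>S. hermitian_mat D S \<and> app (F \<tau> - F 0) (enc D R) = enc D S \<and> trace_norm S \<le> (h \<tau> - h 0) * trace_norm R"
      using S by blast
  qed
qed


section \<open>Lindblad generators\<close>

lemma smult_smult_assoc_mat: "a \<cdot>\<^sub>m (b \<cdot>\<^sub>m A) = (a * b) \<cdot>\<^sub>m (A :: complex mat)"
  by (rule eq_matI) auto

lemma mat_sum_carrier [simp]: "mat_sum n m f I \<in> carrier_mat n m"
  by (simp add: mat_sum_def)

lemma mat_sum_dim [simp]: "dim_row (mat_sum n m f I) = n" "dim_col (mat_sum n m f I) = m"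
  by (simp_all add: mat_sum_def)

lemma mat_sum_index: "i < n \<Longrightarrow> j < m \<Longrightarrow> mat_sum n m f I $$ (i, j) = (\<Sum>a\<in>I. f a $$ (i, j))"
  by (simp add: mat_sum_def)

lemma mat_sum_empty [simp]: "mat_sum n m f {} = 0\<^sub>m n m"
  by (rule eq_matI) (auto simp: mat_sum_def)

lemma mat_sum_insert:
  "finite I \<Longrightarrow> a \<notin> I \<Longrightarrow> f a \<in> carrier_mat n m \<Longrightarrow> mat_sum n m f (insert a I) = f a + mat_sum n m f I"
  by (rule eq_matI) (auto simp: mat_sum_def)

lemma mtr_mat_sum:
  assumes "\<And>a. a \<in> I \<Longrightarrow> f a \<in> carrier_mat n n"
  shows "mtr (mat_sum n n f I) = (\<Sum>a\<in>I. mtr (f a))"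
proof -
  have "mtr (mat_sum n n f I) = (\<Sum>i<n. \<Sum>a\<in>I. f a $$ (i, i))"
    by (simp add: mtr_def mat_sum_def)
  also have "\<dots> = (\<Sum>a\<in>I. \<Sum>i<n. f a $$ (i, i))" by (rule sum.swap)
  also have "\<dots> = (\<Sum>a\<in>I. mtr (f a))"
    using assms by (intro sum.cong) (auto simp: mtr_def)
  finally show ?thesis .
qed

lemma psd_mat_sum: "finite I \<Longrightarrow> (\<And>a. a \<in> I \<Longrightarrow> psd n (f a)) \<Longrightarrow> psd n (mat_sum n n f I)"
  by (induction I rule: finite_induct) (auto simp: psd_zero mat_sum_insert psd_carrier intro!: psd_add)

text \<open>Cyclicity of the trace kills the commutator and balances each jump term against its
  anticommutator.\<close>

lemma liouvillian_mtr:
  assumes T: "liouvillian n T" and R: "R \<in> carrier_mat n n"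
  shows "mtr (T R) = 0"
proof -
  obtain H p J where H: "hermitian_mat n H" and J: "\<And>a. a < (p::nat) \<Longrightarrow> J a \<in> carrier_mat n n"
    and TR: "T R = (- \<i>) \<cdot>\<^sub>m (H * R - R * H) +
          mat_sum n n (\<lambda>a. J a * R * mat_adjoint (J a) -
            (1 / 2) \<cdot>\<^sub>m (mat_adjoint (J a) * J a * R + R * (mat_adjoint (J a) * J a))) {..<p}"
    using T R unfolding liouvillian_def by blast
  have Hc: "H \<in> carrier_mat n n" by (rule hermitian_carrier[OF H])
  have c: "H * R \<in> carrier_mat n n" "R * H \<in> carrier_mat n n" using Hc R by auto
  have "mtr (H * R - R * H) = 0"
    using mtr_minus[OF c] mtr_mult_commute[OF Hc R] by simp
  then have 1: "mtr ((- \<i>) \<cdot>\<^sub>m (H * R - R * H)) = 0"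
    using mtr_smult[of "H * R - R * H" n "- \<i>"] c by (simp add: minus_carrier_mat)
  have 2: "mtr (J a * R * mat_adjoint (J a) -
      (1 / 2) \<cdot>\<^sub>m (mat_adjoint (J a) * J a * R + R * (mat_adjoint (J a) * J a))) = 0" if "a < p" for a
  proof -
    have Ja: "J a \<in> carrier_mat n n" "mat_adjoint (J a) \<in> carrier_mat n n" using J[OF that] by auto
    note JJ = mult_carrier_mat[OF Ja(2,1)]
    have "mtr (J a * R * mat_adjoint (J a)) = mtr (mat_adjoint (J a) * (J a * R))"
      by (rule mtr_mult_commute[OF mult_carrier_mat[OF Ja(1) R] Ja(2)])
    also have "\<dots> = mtr (mat_adjoint (J a) * J a * R)"
      using assoc_mult_mat[OF Ja(2,1) R] by simp
    finally have e1: "mtr (J a * R * mat_adjoint (J a)) = mtr (mat_adjoint (J a) * J a * R)" .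
    have e2: "mtr (R * (mat_adjoint (J a) * J a)) = mtr (mat_adjoint (J a) * J a * R)"
      by (rule mtr_mult_commute[OF R JJ])
    note c1 = mult_carrier_mat[OF mult_carrier_mat[OF Ja(1) R] Ja(2)]
    note c2 = mult_carrier_mat[OF JJ R] and c3 = mult_carrier_mat[OF R JJ]
    have "mtr ((1 / 2) \<cdot>\<^sub>m (mat_adjoint (J a) * J a * R + R * (mat_adjoint (J a) * J a))) = mtr (mat_adjoint (J a) * J a * R)"
      unfolding mtr_smult[OF add_carrier_mat[OF c3]] mtr_add[OF c2 c3] e2 by simp
    then show ?thesis
      using mtr_minus[OF c1 smult_carrier_mat[OF add_carrier_mat[OF c3]]] e1 by simp
  qed
  have 3: "mtr (mat_sum n n (\<lambda>a. J a * R * mat_adjoint (J a) -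
      (1 / 2) \<cdot>\<^sub>m (mat_adjoint (J a) * J a * R + R * (mat_adjoint (J a) * J a))) {..<p}) = 0"
  proof (subst mtr_mat_sum)
    fix a assume "a \<in> {..<p}"
    then have "mat_adjoint (J a) * J a \<in> carrier_mat n n"
      by (intro mult_carrier_mat[OF mat_adjoint_carrier]) (auto intro: J)
    then show "J a * R * mat_adjoint (J a) -
      (1 / 2) \<cdot>\<^sub>m (mat_adjoint (J a) * J a * R + R * (mat_adjoint (J a) * J a)) \<in> carrier_mat n n"
      using R by (intro minus_carrier_mat smult_carrier_mat add_carrier_mat mult_carrier_mat[OF R])
  qed (use 2 in simp)
  show ?thesis
    unfolding TR using 1 3 mtr_add[of "(- \<i>) \<cdot>\<^sub>m (H * R - R * H)" n] c by (simp add: minus_carrier_mat)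
qed

text \<open>With \<open>G = -iH - \<Sum> J\<^sup>* J / 2\<close> the left-hand side is \<open>(1 + eG) P (1 + eG)\<^sup>* + e \<Sum> J P J\<^sup>*\<close>.\<close>

lemma liouvillian_quasi_positive:
  assumes T: "liouvillian n T"
  obtains G where "G \<in> carrier_mat n n"
    "\<And>P e. psd n P \<Longrightarrow> 0 \<le> e \<Longrightarrow> psd n (P + of_real e \<cdot>\<^sub>m T P + of_real (e\<^sup>2) \<cdot>\<^sub>m (G * P * mat_adjoint G))"
proof -
  obtain H p J where H: "hermitian_mat n H" and J: "\<And>a. a < (p::nat) \<Longrightarrow> J a \<in> carrier_mat n n"
    and TR: "\<And>R. R \<in> carrier_mat n n \<Longrightarrow> T R = (- \<i>) \<cdot>\<^sub>m (H * R - R * H) +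
          mat_sum n n (\<lambda>a. J a * R * mat_adjoint (J a) -
            (1 / 2) \<cdot>\<^sub>m (mat_adjoint (J a) * J a * R + R * (mat_adjoint (J a) * J a))) {..<p}"
    using T unfolding liouvillian_def by blast
  define K where "K = mat_sum n n (\<lambda>a. mat_adjoint (J a) * J a) {..<p}"
  define G where "G = (- \<i>) \<cdot>\<^sub>m H + (- 1 / 2) \<cdot>\<^sub>m K"
  have Hc: "H \<in> carrier_mat n n" "mat_adjoint H = H" using H by (auto simp: hermitian_mat_def)
  have Kc: "K \<in> carrier_mat n n" by (simp add: K_def)
  have Ki: "K $$ (i, j) = (\<Sum>a<p. (mat_adjoint (J a) * J a) $$ (i, j))" if "i < n" "j < n" for i j
    unfolding K_def by (rule mat_sum_index[OF that])
  have JJi: "(mat_adjoint (J a) * J a) $$ (i, j) = (\<Sum>k<n. cnj (J a $$ (k, i)) * J a $$ (k, j))"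
    if "i < n" "j < n" "a < p" for i j a
    using J[OF that(3)] that by (simp add: index_mult_mat_sum del: index_mult_mat(1))
  have Ka: "mat_adjoint K = K"
  proof (rule eq_matI)
    fix i j assume "i < dim_row K" "j < dim_col K"
    then have ij: "i < n" "j < n" using Kc by auto
    then show "mat_adjoint K $$ (i, j) = K $$ (i, j)"
      using Kc by (simp add: Ki JJi mult.commute)
  qed (use Kc in auto)
  have Gc: "G \<in> carrier_mat n n" using Hc Kc by (simp add: G_def)
  have Gad: "mat_adjoint G = \<i> \<cdot>\<^sub>m H + (- 1 / 2) \<cdot>\<^sub>m K"
    unfolding G_def using Hc Kc Ka
    by (simp add: mat_adjoint_add[of _ n n] mat_adjoint_smult)
  have GP: "psd n (P + of_real e \<cdot>\<^sub>m T P + of_real (e\<^sup>2) \<cdot>\<^sub>m (G * P * mat_adjoint G))" if P: "psd n P" and e: "0 \<le> e" for P e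
  proof -
    have Pc: "P \<in> carrier_mat n n" by (rule psd_carrier[OF P])
    define M where "M = 1\<^sub>m n + of_real e \<cdot>\<^sub>m G"
    have Mc: "M \<in> carrier_mat n n" using Gc by (simp add: M_def)
    define S where "S = mat_sum n n (\<lambda>a. J a * P * mat_adjoint (J a)) {..<p}"
    have S: "psd n S" unfolding S_def using J P by (intro psd_mat_sum psd_conj) auto
    have psd: "psd n (M * P * mat_adjoint M + of_real e \<cdot>\<^sub>m S)"
      by (intro psd_add psd_conj[OF P Mc] psd_smult S e)
    have Gac: "mat_adjoint G \<in> carrier_mat n n" using Gc by simp
    have MP: "M * P = P + of_real e \<cdot>\<^sub>m (G * P)"
      unfolding M_def using add_mult_distrib_mat[OF one_carrier_mat smult_carrier_mat[OF Gc] Pc, of "of_real e"]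
        mult_smult_assoc_mat[OF Gc Pc] Pc by simp
    have GPc: "G * P \<in> carrier_mat n n" "P * mat_adjoint G \<in> carrier_mat n n" using Gc Pc by auto
    have Ma: "mat_adjoint M = 1\<^sub>m n + of_real e \<cdot>\<^sub>m mat_adjoint G"
      unfolding M_def using Gc by (simp add: mat_adjoint_add[of _ n n] mat_adjoint_smult)
    have MPM: "M * P * mat_adjoint M = P + of_real e \<cdot>\<^sub>m (G * P) + of_real e \<cdot>\<^sub>m (P * mat_adjoint G) +
       of_real (e\<^sup>2) \<cdot>\<^sub>m (G * P * mat_adjoint G)"
    proof -
      have c: "P + of_real e \<cdot>\<^sub>m (G * P) \<in> carrier_mat n n" using Pc GPc by simp
      have "M * P * mat_adjoint M = (P + of_real e \<cdot>\<^sub>m (G * P)) * 1\<^sub>m n + (P + of_real e \<cdot>\<^sub>m (G * P)) * (of_real e \<cdot>\<^sub>m mat_adjoint G)"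
        unfolding MP Ma by (rule mult_add_distrib_mat[OF c one_carrier_mat smult_carrier_mat[OF Gac]])
      also have "(P + of_real e \<cdot>\<^sub>m (G * P)) * (of_real e \<cdot>\<^sub>m mat_adjoint G) =
          P * (of_real e \<cdot>\<^sub>m mat_adjoint G) + (of_real e \<cdot>\<^sub>m (G * P)) * (of_real e \<cdot>\<^sub>m mat_adjoint G)"
        by (rule add_mult_distrib_mat[OF Pc smult_carrier_mat[OF GPc(1)] smult_carrier_mat[OF Gac]])
      also have "P * (of_real e \<cdot>\<^sub>m mat_adjoint G) = of_real e \<cdot>\<^sub>m (P * mat_adjoint G)"
        by (rule mult_smult_distrib[OF Pc Gac])
      also have "(of_real e \<cdot>\<^sub>m (G * P)) * (of_real e \<cdot>\<^sub>m mat_adjoint G) = of_real (e\<^sup>2) \<cdot>\<^sub>m (G * P * mat_adjoint G)"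
        using mult_smult_assoc_mat[OF GPc(1) smult_carrier_mat[OF Gac], of "of_real e" "of_real e"]
          mult_smult_distrib[OF GPc(1) Gac, of "of_real e"] by (simp add: smult_smult_assoc_mat power2_eq_square)
      finally show ?thesis
        unfolding right_mult_one_mat[OF c]
        using assoc_add_mat[OF c smult_carrier_mat[OF GPc(2)] smult_carrier_mat[OF mult_carrier_mat[OF GPc(1) Gac]]]
        by metis
    qed
    have GPe: "G * P = (- \<i>) \<cdot>\<^sub>m (H * P) + (- 1 / 2) \<cdot>\<^sub>m (K * P)"
      unfolding G_def using add_mult_distrib_mat[OF smult_carrier_mat[OF Hc(1)] smult_carrier_mat[OF Kc] Pc]
        mult_smult_assoc_mat[OF Hc(1) Pc] mult_smult_assoc_mat[OF Kc Pc] by simp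
    have PGe: "P * mat_adjoint G = \<i> \<cdot>\<^sub>m (P * H) + (- 1 / 2) \<cdot>\<^sub>m (P * K)"
      unfolding Gad using mult_add_distrib_mat[OF Pc smult_carrier_mat[OF Hc(1)] smult_carrier_mat[OF Kc]]
        mult_smult_distrib[OF Pc Hc(1)] mult_smult_distrib[OF Pc Kc] by simp
    note cs = mult_carrier_mat[OF Hc(1) Pc] mult_carrier_mat[OF Pc Hc(1)] mult_carrier_mat[OF Kc Pc] mult_carrier_mat[OF Pc Kc]
    have KPi: "(K * P) $$ (i, j) = (\<Sum>a<p. (mat_adjoint (J a) * J a * P) $$ (i, j))"
      and PKi: "(P * K) $$ (i, j) = (\<Sum>a<p. (P * (mat_adjoint (J a) * J a)) $$ (i, j))" if ij: "i < n" "j < n" for i j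
    proof -
      have c: "mat_adjoint (J a) * J a \<in> carrier_mat n n" if "a < p" for a
        by (rule mult_carrier_mat[OF mat_adjoint_carrier[OF J[OF that]] J[OF that]])
      have "(K * P) $$ (i, j) = (\<Sum>k<n. (\<Sum>a<p. (mat_adjoint (J a) * J a) $$ (i, k)) * P $$ (k, j))"
        using ij Kc Pc by (simp add: index_mult_mat_sum Ki del: index_mult_mat(1))
      also have "\<dots> = (\<Sum>a<p. \<Sum>k<n. (mat_adjoint (J a) * J a) $$ (i, k) * P $$ (k, j))"
        by (subst sum.swap) (simp add: sum_distrib_right)
      also have "\<dots> = (\<Sum>a<p. (mat_adjoint (J a) * J a * P) $$ (i, j))"
        using ij Pc carrier_matD(2)[OF J] by (intro sum.cong refl, subst (2) index_mult_mat_sum) auto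
      finally show "(K * P) $$ (i, j) = (\<Sum>a<p. (mat_adjoint (J a) * J a * P) $$ (i, j))" .
      have "(P * K) $$ (i, j) = (\<Sum>k<n. P $$ (i, k) * (\<Sum>a<p. (mat_adjoint (J a) * J a) $$ (k, j)))"
        using ij Kc Pc by (simp add: index_mult_mat_sum Ki del: index_mult_mat(1))
      also have "\<dots> = (\<Sum>a<p. \<Sum>k<n. P $$ (i, k) * (mat_adjoint (J a) * J a) $$ (k, j))"
        by (subst sum.swap) (simp add: sum_distrib_left)
      also have "\<dots> = (\<Sum>a<p. (P * (mat_adjoint (J a) * J a)) $$ (i, j))"
      proof (intro sum.cong refl)
        fix a assume "a \<in> {..<p}"
        then have "mat_adjoint (J a) * J a \<in> carrier_mat n n" using c by simp
        then show "(\<Sum>k<n. P $$ (i, k) * (mat_adjoint (J a) * J a) $$ (k, j)) = (P * (mat_adjoint (J a) * J a)) $$ (i, j)"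
          using ij Pc by (subst index_mult_mat_sum[of i P]) auto
      qed
      finally show "(P * K) $$ (i, j) = (\<Sum>a<p. (P * (mat_adjoint (J a) * J a)) $$ (i, j))" .
    qed
    have TP: "T P = (- \<i>) \<cdot>\<^sub>m (H * P) + \<i> \<cdot>\<^sub>m (P * H) + (S + (- 1 / 2) \<cdot>\<^sub>m (K * P) + (- 1 / 2) \<cdot>\<^sub>m (P * K))"
    proof (rule eq_matI)
      fix i j assume "i < dim_row ((- \<i>) \<cdot>\<^sub>m (H * P) + \<i> \<cdot>\<^sub>m (P * H) + (S + (- 1 / 2) \<cdot>\<^sub>m (K * P) + (- 1 / 2) \<cdot>\<^sub>m (P * K)))"
        "j < dim_col ((- \<i>) \<cdot>\<^sub>m (H * P) + \<i> \<cdot>\<^sub>m (P * H) + (S + (- 1 / 2) \<cdot>\<^sub>m (K * P) + (- 1 / 2) \<cdot>\<^sub>m (P * K)))"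
      then have ij: "i < n" "j < n" using cs by auto
      have a: "(J a * P * mat_adjoint (J a) - (1 / 2) \<cdot>\<^sub>m (mat_adjoint (J a) * J a * P + P * (mat_adjoint (J a) * J a))) $$ (i, j)
        = (J a * P * mat_adjoint (J a)) $$ (i, j) - ((mat_adjoint (J a) * J a * P) $$ (i, j) + (P * (mat_adjoint (J a) * J a)) $$ (i, j)) / 2"
        if "a < p" for a
        using J[OF that] Pc ij by (simp del: index_mult_mat(1) assoc_mult_mat)
      show "T P $$ (i, j) = ((- \<i>) \<cdot>\<^sub>m (H * P) + \<i> \<cdot>\<^sub>m (P * H) + (S + (- 1 / 2) \<cdot>\<^sub>m (K * P) + (- 1 / 2) \<cdot>\<^sub>m (P * K))) $$ (i, j)"
        unfolding TR[OF Pc] using ij Hc(1) Kc Pc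
        by (simp add: mat_sum_index a KPi PKi S_def sum_subtractf sum.distrib sum_divide_distrib[symmetric]
            add_divide_distrib algebra_simps del: index_mult_mat(1) assoc_mult_mat)
    qed (use cs TR[OF Pc] in auto)
    have "M * P * mat_adjoint M + of_real e \<cdot>\<^sub>m S = P + of_real e \<cdot>\<^sub>m T P + of_real (e\<^sup>2) \<cdot>\<^sub>m (G * P * mat_adjoint G)"
    proof -
      \<comment> \<open>With the products replaced by arbitrary matrices, the regrouping is an
        entrywise identity.\<close>
      have "P + of_real e \<cdot>\<^sub>m ((- \<i>) \<cdot>\<^sub>m A + (- 1 / 2) \<cdot>\<^sub>m C) + of_real e \<cdot>\<^sub>m (\<i> \<cdot>\<^sub>m B + (- 1 / 2) \<cdot>\<^sub>m D) + f \<cdot>\<^sub>m F + of_real e \<cdot>\<^sub>m S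
        = P + of_real e \<cdot>\<^sub>m ((- \<i>) \<cdot>\<^sub>m A + \<i> \<cdot>\<^sub>m B + (S + (- 1 / 2) \<cdot>\<^sub>m C + (- 1 / 2) \<cdot>\<^sub>m D)) + f \<cdot>\<^sub>m F"
        if "A \<in> carrier_mat n n" "B \<in> carrier_mat n n" "C \<in> carrier_mat n n" "D \<in> carrier_mat n n" "F \<in> carrier_mat n n"
        for A B C D F :: "complex mat" and f
        using that Pc psd_carrier[OF S] by (intro eq_matI) (auto simp: algebra_simps)
      from this[OF cs mult_carrier_mat[OF GPc(1) Gac], of "of_real (e\<^sup>2)"] show ?thesis
        unfolding MPM TP unfolding GPe[symmetric] PGe[symmetric] .
    qed
    then show ?thesis using psd by simp
  qed
  then show thesis using that Gc by blast
qed

text \<open>Write R = P - Q with positive parts. The map \<Phi> = 1 + e T + \<Psi>, with \<Psi> of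
  order e^2, is positive, so (1 + e T) R is the difference of the positive matrices \<Phi> P +
  \<Psi> Q and \<Phi> Q + \<Psi> P. As the values of \<open>T\<close> have trace zero, their traces
  sum up to tr P + tr Q plus twice the trace of \<Psi> (P + Q), which gives the constant 2
  g.\<close>

lemma liouvillian_dissipative:
  assumes D: "D \<ge> 1" and T: "liouvillian D T" and lin: "linear_superop D T"
  shows "op_bound.dissipative (herm_bound D) (hat D T)"
proof -
  interpret op_bound "herm_bound D" by (rule op_bound_herm_bound[OF D])
  obtain G where G: "G \<in> carrier_mat D D"
    and GP: "\<And>P e. psd D P \<Longrightarrow> 0 \<le> e \<Longrightarrow> psd D (P + of_real e \<cdot>\<^sub>m T P + of_real (e\<^sup>2) \<cdot>\<^sub>m (G * P * mat_adjoint G))"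
    using liouvillian_quasi_positive[OF T] by blast
  have Ga: "mat_adjoint G \<in> carrier_mat D D" using G by simp
  define g where "g = (\<Sum>i<D. \<Sum>k<D. cmod ((mat_adjoint G * G) $$ (i, k)))"
  have g: "Re (mtr (G * P * mat_adjoint G)) \<le> g * Re (mtr P)" if P: "psd D P" for P
  proof -
    have Pc: "P \<in> carrier_mat D D" by (rule psd_carrier[OF P])
    have "mtr (G * P * mat_adjoint G) = mtr (mat_adjoint G * (G * P))"
      by (rule mtr_mult_commute[OF mult_carrier_mat[OF G Pc] Ga])
    also have "\<dots> = mtr (mat_adjoint G * G * P)" using assoc_mult_mat[OF Ga G Pc] by simp
    finally show ?thesis using mtr_mult_psd_le[OF P mult_carrier_mat[OF Ga G]] by (simp add: g_def)
  qed
  define \<Phi> where "\<Phi> e P = P + of_real e \<cdot>\<^sub>m T P + of_real (e\<^sup>2) \<cdot>\<^sub>m (G * P * mat_adjoint G)" for e :: real and P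
  define \<Psi> where "\<Psi> e P = of_real (e\<^sup>2) \<cdot>\<^sub>m (G * P * mat_adjoint G)" for e :: real and P
  have \<Phi>: "psd D (\<Phi> e P)" if "psd D P" "0 \<le> e" for P e unfolding \<Phi>_def by (rule GP[OF that])
  have \<Psi>: "psd D (\<Psi> e P)" if "psd D P" for P e unfolding \<Psi>_def by (intro psd_smult psd_conj[OF that G]) simp
  have tr\<Psi>: "Re (mtr (\<Psi> e P)) \<le> g * e\<^sup>2 * Re (mtr P)" if P: "psd D P" for P e
    unfolding \<Psi>_def using mtr_smult[OF psd_carrier[OF psd_conj[OF P G]], of "of_real (e\<^sup>2)"]
      mult_left_mono[OF g[OF P], of "e\<^sup>2"] by (simp add: mult_ac)
  have tr\<Phi>: "Re (mtr (\<Phi> e P)) = Re (mtr P) + Re (mtr (\<Psi> e P))" if P: "psd D P" for P e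
  proof -
    have Pc: "P \<in> carrier_mat D D" by (rule psd_carrier[OF P])
    have TPc: "T P \<in> carrier_mat D D" by (rule linear_superop_carrier[OF lin Pc])
    have "mtr (\<Phi> e P) = mtr P + of_real e * mtr (T P) + mtr (\<Psi> e P)"
      unfolding \<Phi>_def \<Psi>_def
      using mtr_add[OF add_carrier_mat[OF smult_carrier_mat[OF TPc]] psd_carrier[OF \<Psi>[OF P, unfolded \<Psi>_def]], of P "of_real e" e]
        mtr_add[OF Pc smult_carrier_mat[OF TPc]] mtr_smult[OF TPc] by simp
    then show ?thesis using liouvillian_mtr[OF T Pc] by simp
  qed
  have step: "\<exists>S. hermitian_mat D S \<and> app (1 + e *\<^sub>R hat D T) (enc D R) = enc D S \<and> trace_norm S \<le> (1 + 2 * g * e\<^sup>2) * trace_norm R"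
    if R: "hermitian_mat D R" and e: "0 \<le> e" for R e
  proof -
    obtain P Q where PQ: "psd D P" "psd D Q" "R = P - Q" "trace_norm R = Re (mtr P) + Re (mtr Q)"
      by (rule hermitian_jordan_decomposition[OF R])
    have c: "P \<in> carrier_mat D D" "Q \<in> carrier_mat D D" using PQ by (auto intro: psd_carrier)
    note Tc = c[THEN linear_superop_carrier[OF lin]]
    have \<Psi>c: "\<Psi> e P \<in> carrier_mat D D" "\<Psi> e Q \<in> carrier_mat D D" using \<Psi> PQ by (auto intro: psd_carrier)
    have Rc: "R \<in> carrier_mat D D" by (rule hermitian_carrier[OF R])
    define S where "S = R + of_real e \<cdot>\<^sub>m T R"
    have S: "S = (\<Phi> e P + \<Psi> e Q) - (\<Phi> e Q + \<Psi> e P)"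
      unfolding S_def \<Phi>_def \<Psi>_def[symmetric] PQ(3) linear_superop_minus[OF lin c]
      using c Tc \<Psi>c by (intro eq_matI) (auto simp: algebra_simps)
    have p: "psd D (\<Phi> e P + \<Psi> e Q)" "psd D (\<Phi> e Q + \<Psi> e P)"
      using \<Phi> \<Psi> PQ e by (auto intro: psd_add)
    have "trace_norm S \<le> Re (mtr (\<Phi> e P + \<Psi> e Q)) + Re (mtr (\<Phi> e Q + \<Psi> e P))"
      unfolding S by (rule trace_norm_le[OF p])
    also have "\<dots> = Re (mtr P) + Re (mtr Q) + 2 * (Re (mtr (\<Psi> e P)) + Re (mtr (\<Psi> e Q)))"
      using mtr_add[OF psd_carrier[OF \<Phi>[OF PQ(1) e]] \<Psi>c(2)] mtr_add[OF psd_carrier[OF \<Phi>[OF PQ(2) e]] \<Psi>c(1)]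
        tr\<Phi>[OF PQ(1), of e] tr\<Phi>[OF PQ(2), of e] by simp
    also have "\<dots> \<le> (1 + 2 * g * e\<^sup>2) * trace_norm R"
      using tr\<Psi>[OF PQ(1), of e] tr\<Psi>[OF PQ(2), of e] unfolding PQ(4) by (simp add: algebra_simps)
    finally have "trace_norm S \<le> (1 + 2 * g * e\<^sup>2) * trace_norm R" .
    moreover have "hermitian_mat D S" unfolding S using p by (intro hermitian_minus psd_hermitian)
    moreover have "app (1 + e *\<^sub>R hat D T) (enc D R) = enc D S"
      unfolding S_def using Rc linear_superop_carrier[OF lin Rc]
      by (simp add: app.add_left app.scaleR_left app_hat_enc[OF lin] enc_add enc_smult)
    ultimately show ?thesis by blast
  qed
  have b: "herm_bound D (1 + e *\<^sub>R hat D T) (1 + (2 * g) * e\<^sup>2)" if "0 \<le> e" for e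
    using step[OF _ that] by (intro herm_boundI) simp
  \<comment> \<open>The case e = 1, from which the identity is subtracted; any finite bound will
    do.\<close>
  have "herm_bound D (hat D T) (1 + (2 * g) * 1\<^sup>2 + 1)"
    using minus[OF b[of 1] one] by simp
  then show ?thesis unfolding dissipative_def using b by blast
qed

section \<open>Locally purified tensor networks\<close>

text \<open>Mixed radix expansion, which shows that an index is determined by its digits. The
  induction splits off the most significant remaining digit.\<close>

lemma mod_prod_site_index:
  assumes "l \<le> N"
  shows "i mod (\<Prod>k\<in>{l<..N}. f k) = (\<Sum>k\<in>{l<..N}. site_index f N k i * (\<Prod>k\<in>{k<..N}. f k))"
  using assms
proof (induction l rule: inc_induct)
  case base
  show ?case by simp
next
  case (step l)
  have e: "{l<..N} = insert (Suc l) {Suc l<..N}" using step by auto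
  have "i mod (\<Prod>k\<in>{l<..N}. f k) = i mod ((\<Prod>k\<in>{Suc l<..N}. f k) * f (Suc l))"
    unfolding e by (simp add: mult.commute)
  also have "\<dots> = (\<Prod>k\<in>{Suc l<..N}. f k) * site_index f N (Suc l) i + i mod (\<Prod>k\<in>{Suc l<..N}. f k)"
    by (simp add: mod_mult2_eq site_index_def)
  finally show ?case unfolding e step.IH by (simp add: mult.commute)
qed

text \<open>Both sides have the same number of elements, so it suffices that the digits determine
  the index.\<close>

lemma bij_betw_site_index:
  "bij_betw (\<lambda>i. \<lambda>l\<in>{1..N}. site_index f N l i) {..<\<Prod>k\<in>{1..N}. f k} (\<Pi>\<^sub>E l\<in>{1..N}. {..<f l})"
proof -
  define P where "P = (\<Prod>k\<in>{1..N}. f k)"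
  have P0: "P = (\<Prod>k\<in>{0<..N}. f k)" unfolding P_def by (rule prod.cong) auto
  define h where "h = (\<lambda>i. \<lambda>l\<in>{1..N}. site_index f N l i)"
  have inj: "inj_on h {..<P}"
  proof (rule inj_onI)
    fix i j assume ij: "i \<in> {..<P}" "j \<in> {..<P}" and e: "h i = h j"
    have "site_index f N l i = site_index f N l j" if "l \<in> {0<..N}" for l
      using fun_cong[OF e, of l] that by (simp add: h_def)
    then have "i mod P = j mod P"
      unfolding P0 mod_prod_site_index[OF le0] by (intro sum.cong) auto
    then show "i = j" using ij by simp
  qed
  have im: "h ` {..<P} \<subseteq> (\<Pi>\<^sub>E l\<in>{1..N}. {..<f l})"
  proof
    fix x assume "x \<in> h ` {..<P}"
    then obtain i where i: "i < P" "x = h i" by auto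
    then have "P \<noteq> 0" by auto
    then have "f l > 0" if "l \<in> {1..N}" for l using that by (auto simp: P_def)
    then show "x \<in> (\<Pi>\<^sub>E l\<in>{1..N}. {..<f l})" unfolding i(2) h_def by (auto simp: site_index_def)
  qed
  have "card (h ` {..<P}) = card (\<Pi>\<^sub>E l\<in>{1..N}. {..<f l})"
    unfolding card_image[OF inj] by (simp add: card_PiE P_def)
  then have "h ` {..<P} = (\<Pi>\<^sub>E l\<in>{1..N}. {..<f l})"
    by (intro card_subset_eq im) (auto intro!: finite_PiE)
  then show ?thesis using inj unfolding h_def P_def by (simp add: bij_betw_def)
qed

text \<open>The assumption makes \<open>g\<close> blind to values outside the chain, where the digit
  function and the extensional functions of the product set differ.\<close>

lemma sum_site_index:
  fixes g :: "(nat \<Rightarrow> nat) \<Rightarrow> 'b::comm_monoid_add"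
  assumes g: "\<And>s s'. (\<And>l. l \<in> {1..N} \<Longrightarrow> s l = s' l) \<Longrightarrow> g s = g s'"
  shows "(\<Sum>i<\<Prod>k\<in>{1..N}. f k. g (\<lambda>l. site_index f N l i)) = (\<Sum>s\<in>(\<Pi>\<^sub>E l\<in>{1..N}. {..<f l}). g s)"
proof -
  have "(\<Sum>i<\<Prod>k\<in>{1..N}. f k. g (\<lambda>l. site_index f N l i)) = (\<Sum>i<\<Prod>k\<in>{1..N}. f k. g (\<lambda>l\<in>{1..N}. site_index f N l i))"
    by (intro sum.cong refl g) simp
  also have "\<dots> = (\<Sum>s\<in>(\<Pi>\<^sub>E l\<in>{1..N}. {..<f l}). g s)"
    by (rule sum.reindex_bij_betw[OF bij_betw_site_index])
  finally show ?thesis .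
qed

text \<open>In \<open>T l n n' m m'\<close> the indices \<open>n, n'\<close> are the bond indices of the two networks to the left of site \<open>l\<close>,
  and \<open>m, m'\<close> those to the right.\<close>

definition chain_sum :: "(nat \<Rightarrow> nat) \<Rightarrow> (nat \<Rightarrow> nat \<Rightarrow> nat \<Rightarrow> nat \<Rightarrow> nat \<Rightarrow> complex) \<Rightarrow> nat \<Rightarrow> (nat \<Rightarrow> nat \<Rightarrow> complex) \<Rightarrow> complex" where
  "chain_sum D T k \<phi> = (\<Sum>b\<in>(\<Pi>\<^sub>E l\<in>{0..k}. {..<D l}). \<Sum>b'\<in>(\<Pi>\<^sub>E l\<in>{0..k}. {..<D l}).
     (\<Prod>l\<in>{1..k}. T l (b (l - 1)) (b' (l - 1)) (b l) (b' l)) * \<phi> (b k) (b' k))"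

lemma sum_PiE_Suc:
  fixes g :: "(nat \<Rightarrow> nat) \<Rightarrow> 'b::comm_monoid_add"
  shows "(\<Sum>b\<in>(\<Pi>\<^sub>E l\<in>{0..Suc k}. {..<D l}). g b) = (\<Sum>b\<in>(\<Pi>\<^sub>E l\<in>{0..k}. {..<D l}). \<Sum>m<D (Suc k). g (b(Suc k := m)))"
proof -
  have e: "{0..Suc k} = insert (Suc k) {0..k}" by auto
  have "(\<Sum>b\<in>(\<Pi>\<^sub>E l\<in>{0..Suc k}. {..<D l}). g b) =
    (\<Sum>p\<in>{..<D (Suc k)} \<times> (\<Pi>\<^sub>E l\<in>{0..k}. {..<D l}). g ((\<lambda>(y, b). b(Suc k := y)) p))"
    unfolding e PiE_insert_eq
    by (rule sum.reindex[unfolded o_def]) (use inj_combinator[of "Suc k" "{0..k}" "\<lambda>l. {..<D l}"] in simp)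
  also have "\<dots> = (\<Sum>m<D (Suc k). \<Sum>b\<in>(\<Pi>\<^sub>E l\<in>{0..k}. {..<D l}). g (b(Suc k := m)))"
    by (simp add: sum.cartesian_product case_prod_unfold)
  finally show ?thesis by (simp add: sum.swap[of _ "{..<D (Suc k)}"])
qed

lemma sum_rotate:
  "(\<Sum>a\<in>A. \<Sum>b\<in>B. \<Sum>c\<in>C. f a b c) = (\<Sum>b\<in>B. \<Sum>c\<in>C. \<Sum>a\<in>A. f a b c)"
proof -
  have "(\<Sum>a\<in>A. \<Sum>b\<in>B. \<Sum>c\<in>C. f a b c) = (\<Sum>b\<in>B. \<Sum>a\<in>A. \<Sum>c\<in>C. f a b c)" by (rule sum.swap)
  also have "\<dots> = (\<Sum>b\<in>B. \<Sum>c\<in>C. \<Sum>a\<in>A. f a b c)" by (intro sum.cong refl sum.swap)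
  finally show ?thesis .
qed

lemma chain_sum_0: "chain_sum D T 0 \<phi> = (\<Sum>m<D 0. \<Sum>m'<D 0. \<phi> m m')"
proof -
  have s: "(\<Sum>b\<in>(\<Pi>\<^sub>E l\<in>{0}. {..<D l}). g (b 0)) = (\<Sum>m<D 0. g m)" for g :: "nat \<Rightarrow> complex"
  proof -
    have "bij_betw (\<lambda>m. \<lambda>l\<in>{0::nat}. m) {..<D 0} (\<Pi>\<^sub>E l\<in>{0}. {..<D l})"
      by (rule bij_betwI[where g = "\<lambda>b. b 0"]) (auto simp: PiE_iff extensional_def)
    from sum.reindex_bij_betw[OF this, of "\<lambda>b. g (b 0)"] show ?thesis by simp
  qed
  show ?thesis
    unfolding chain_sum_def using s[of "\<lambda>m. \<Sum>m'<D 0. \<phi> m m'"] by (simp add: s[of "\<phi> _"])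
qed

text \<open>Transfer matrix step: the last site is absorbed into the boundary function on the
  remaining bond.\<close>

lemma chain_sum_Suc:
  "chain_sum D T (Suc k) \<phi> = chain_sum D T k (\<lambda>n n'. \<Sum>m<D (Suc k). \<Sum>m'<D (Suc k). T (Suc k) n n' m m' * \<phi> m m')"
proof -
  have p: "(\<Prod>l\<in>{1..Suc k}. T l ((b(Suc k := m)) (l - 1)) ((b'(Suc k := m')) (l - 1)) ((b(Suc k := m)) l) ((b'(Suc k := m')) l)) =
    (\<Prod>l\<in>{1..k}. T l (b (l - 1)) (b' (l - 1)) (b l) (b' l)) * T (Suc k) (b k) (b' k) m m'" for b b' m m'
    by (auto intro!: prod.cong)
  have "chain_sum D T (Suc k) \<phi> = (\<Sum>b\<in>(\<Pi>\<^sub>E l\<in>{0..k}. {..<D l}). \<Sum>m<D (Suc k). \<Sum>b'\<in>(\<Pi>\<^sub>E l\<in>{0..k}. {..<D l}). \<Sum>m'<D (Suc k).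
     (\<Prod>l\<in>{1..k}. T l (b (l - 1)) (b' (l - 1)) (b l) (b' l)) * T (Suc k) (b k) (b' k) m m' * \<phi> m m')"
    unfolding chain_sum_def sum_PiE_Suc p by simp
  also have "\<dots> = (\<Sum>b\<in>(\<Pi>\<^sub>E l\<in>{0..k}. {..<D l}). \<Sum>b'\<in>(\<Pi>\<^sub>E l\<in>{0..k}. {..<D l}). \<Sum>m<D (Suc k). \<Sum>m'<D (Suc k).
     (\<Prod>l\<in>{1..k}. T l (b (l - 1)) (b' (l - 1)) (b l) (b' l)) * T (Suc k) (b k) (b' k) m m' * \<phi> m m')"
    by (intro sum.cong refl sum.swap)
  finally show ?thesis
    unfolding chain_sum_def by (simp add: sum_distrib_left mult.assoc)
qed

lemma chain_sum_cong:
  assumes "\<And>m m'. m < D k \<Longrightarrow> m' < D k \<Longrightarrow> \<phi> m m' = \<psi> m m'"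
  shows "chain_sum D T k \<phi> = chain_sum D T k \<psi>"
  unfolding chain_sum_def using assms
  by (intro sum.cong refl arg_cong2[where f = "(*)"]) (auto simp: PiE_iff)

lemma sum_sum_delta:
  fixes f :: "nat \<Rightarrow> nat \<Rightarrow> complex"
  shows "(\<Sum>m<n. \<Sum>m'<n. f m m' * (if m = m' then 1 else 0)) = (\<Sum>m<n. f m m)"
  by (intro sum.cong refl) (simp add: if_distrib[of "(*) _"] cong: if_cong)

text \<open>Right canonical sites map the identity on a bond to the identity on the next bond to the
  left. At the right end the bond is one-dimensional, so the constant 1 is that identity.\<close>

lemma chain_sum_right:
  assumes DN: "D N = 1"
    and can: "\<And>l n n'. l0 < l \<Longrightarrow> l \<le> N \<Longrightarrow> n < D (l - 1) \<Longrightarrow> n' < D (l - 1) \<Longrightarrow>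
      (\<Sum>m<D l. T l n n' m m) = (if n = n' then 1 else 0)"
    and k: "l0 \<le> k" "k \<le> N"
  shows "chain_sum D T N (\<lambda>_ _. 1) = chain_sum D T k (\<lambda>m m'. if m = m' then 1 else 0)"
  using k(2,1)
proof (induction k rule: inc_induct)
  case base
  show ?case by (rule chain_sum_cong) (use DN in auto)
next
  case (step k)
  have "chain_sum D T N (\<lambda>_ _. 1) = chain_sum D T (Suc k) (\<lambda>m m'. if m = m' then 1 else 0)"
    using step by simp
  also have "\<dots> = chain_sum D T k (\<lambda>m m'. if m = m' then 1 else 0)"
    unfolding chain_sum_Suc sum_sum_delta using can[of "Suc k"] step
    by (intro chain_sum_cong) auto
  finally show ?case .
qed

text \<open>Mirror image of the contraction from the right: left canonical sites carry the trace
  over one bond pair to the trace over the next, whatever the boundary function is.\<close>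

lemma chain_sum_left:
  assumes D0: "D 0 = 1"
    and can: "\<And>l m m'. 1 \<le> l \<Longrightarrow> l \<le> k \<Longrightarrow> m < D l \<Longrightarrow> m' < D l \<Longrightarrow>
      (\<Sum>n<D (l - 1). T l n n m m') = (if m = m' then 1 else 0)"
  shows "chain_sum D T k \<phi> = (\<Sum>n<D k. \<phi> n n)"
  using can
proof (induction k arbitrary: \<phi>)
  case 0
  show ?case using D0 by (simp add: chain_sum_0)
next
  case (Suc k)
  have "chain_sum D T (Suc k) \<phi> = (\<Sum>n<D k. \<Sum>m<D (Suc k). \<Sum>m'<D (Suc k). T (Suc k) n n m m' * \<phi> m m')"
    unfolding chain_sum_Suc using Suc.prems by (intro Suc.IH) auto
  also have "\<dots> = (\<Sum>m<D (Suc k). \<Sum>m'<D (Suc k). (\<Sum>n<D k. T (Suc k) n n m m') * \<phi> m m')"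
    unfolding sum_distrib_right by (rule sum_rotate)
  also have "\<dots> = (\<Sum>m<D (Suc k). \<Sum>m'<D (Suc k). \<phi> m m' * (if m = m' then 1 else 0))"
    using Suc.prems[of "Suc k"] by (intro sum.cong refl) auto
  finally show ?case by (simp only: sum_sum_delta)
qed

definition frob_inner :: "nat \<Rightarrow> nat \<Rightarrow> complex mat \<Rightarrow> complex mat \<Rightarrow> complex" where
  "frob_inner n m X Y = (\<Sum>i<n. \<Sum>j<m. X $$ (i, j) * cnj (Y $$ (i, j)))"

lemma lpf_op_carrier [simp]: "lpf_op d N K D A \<in> carrier_mat (d ^ N) (\<Prod>k\<in>{1..N}. K k)"
  by (simp add: lpf_op_def)

text \<open>For fixed bond indices of both networks the sum over physical and Kraus indices
  factorizes over the sites, which leaves one transfer matrix per site.\<close>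

lemma frob_inner_lpf_op:
  "frob_inner (d ^ N) (\<Prod>k\<in>{1..N}. K k) (lpf_op d N K D A) (lpf_op d N K D B) =
    chain_sum D (\<lambda>l n n' m m'. \<Sum>s<d. \<Sum>r<K l. A l s r n m * cnj (B l s r n' m')) N (\<lambda>_ _. 1)"
proof -
  define \<B> where "\<B> = (\<Pi>\<^sub>E l\<in>{0..N}. {..<D l})"
  define F where "F A s r b = (\<Prod>l\<in>{1..N}. A l (s l) (r l) (b (l - 1)) (b l))" for A :: "nat \<Rightarrow> tensor" and s r b :: "nat \<Rightarrow> nat"
  define g where "g s r = (\<Sum>b\<in>\<B>. F A s r b) * cnj (\<Sum>b\<in>\<B>. F B s r b)" for s r
  have Fc: "F A s r b = F A s' r' b" if "\<And>l. l \<in> {1..N} \<Longrightarrow> s l = s' l" "\<And>l. l \<in> {1..N} \<Longrightarrow> r l = r' l" for A s s' r r' b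
    unfolding F_def using that by (intro prod.cong) auto
  have gc: "g s r = g s' r'" if "\<And>l. l \<in> {1..N} \<Longrightarrow> s l = s' l" "\<And>l. l \<in> {1..N} \<Longrightarrow> r l = r' l" for s s' r r'
    unfolding g_def using Fc[OF that] by simp
  have "frob_inner (d ^ N) (\<Prod>k\<in>{1..N}. K k) (lpf_op d N K D A) (lpf_op d N K D B) =
    (\<Sum>i<d ^ N. \<Sum>j<\<Prod>k\<in>{1..N}. K k. g (\<lambda>l. site_index (\<lambda>_. d) N l i) (\<lambda>l. site_index K N l j))"
    unfolding frob_inner_def g_def F_def \<B>_def by (intro sum.cong refl) (simp add: lpf_op_def)
  also have "\<dots> = (\<Sum>i<d ^ N. \<Sum>r\<in>(\<Pi>\<^sub>E l\<in>{1..N}. {..<K l}). g (\<lambda>l. site_index (\<lambda>_. d) N l i) r)"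
    by (intro sum.cong refl sum_site_index gc) auto
  also have "\<dots> = (\<Sum>i<\<Prod>k\<in>{1..N}. d. \<Sum>r\<in>(\<Pi>\<^sub>E l\<in>{1..N}. {..<K l}). g (\<lambda>l. site_index (\<lambda>_. d) N l i) r)"
    by simp
  also have "\<dots> = (\<Sum>s\<in>(\<Pi>\<^sub>E l\<in>{1..N}. {..<d}). \<Sum>r\<in>(\<Pi>\<^sub>E l\<in>{1..N}. {..<K l}). g s r)"
    by (rule sum_site_index[of N "\<lambda>s. \<Sum>r\<in>(\<Pi>\<^sub>E l\<in>{1..N}. {..<K l}). g s r"]) (intro sum.cong refl gc, auto)
  also have "\<dots> = (\<Sum>s\<in>(\<Pi>\<^sub>E l\<in>{1..N}. {..<d}). \<Sum>r\<in>(\<Pi>\<^sub>E l\<in>{1..N}. {..<K l}). \<Sum>b\<in>\<B>. \<Sum>b'\<in>\<B>. F A s r b * cnj (F B s r b'))"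
    unfolding g_def by (simp add: sum_product)
  also have "\<dots> = (\<Sum>s\<in>(\<Pi>\<^sub>E l\<in>{1..N}. {..<d}). \<Sum>b\<in>\<B>. \<Sum>b'\<in>\<B>. \<Sum>r\<in>(\<Pi>\<^sub>E l\<in>{1..N}. {..<K l}). F A s r b * cnj (F B s r b'))"
    by (intro sum.cong refl sum_rotate)
  also have "\<dots> = (\<Sum>b\<in>\<B>. \<Sum>b'\<in>\<B>. \<Sum>s\<in>(\<Pi>\<^sub>E l\<in>{1..N}. {..<d}). \<Sum>r\<in>(\<Pi>\<^sub>E l\<in>{1..N}. {..<K l}). F A s r b * cnj (F B s r b'))"
    by (rule sum_rotate)
  also have "\<dots> = (\<Sum>b\<in>\<B>. \<Sum>b'\<in>\<B>. \<Prod>l\<in>{1..N}. \<Sum>s<d. \<Sum>r<K l. A l s r (b (l - 1)) (b l) * cnj (B l s r (b' (l - 1)) (b' l)))"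
  proof (intro sum.cong refl)
    fix b b'
    have "(\<Prod>l\<in>{1..N}. \<Sum>s<d. \<Sum>r<K l. A l s r (b (l - 1)) (b l) * cnj (B l s r (b' (l - 1)) (b' l))) =
      (\<Sum>s\<in>(\<Pi>\<^sub>E l\<in>{1..N}. {..<d}). \<Prod>l\<in>{1..N}. \<Sum>r<K l. A l (s l) r (b (l - 1)) (b l) * cnj (B l (s l) r (b' (l - 1)) (b' l)))"
      by (rule prod_sum_PiE) auto
    also have "\<dots> = (\<Sum>s\<in>(\<Pi>\<^sub>E l\<in>{1..N}. {..<d}). \<Sum>r\<in>(\<Pi>\<^sub>E l\<in>{1..N}. {..<K l}).
        \<Prod>l\<in>{1..N}. A l (s l) (r l) (b (l - 1)) (b l) * cnj (B l (s l) (r l) (b' (l - 1)) (b' l)))"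
      by (intro sum.cong refl prod_sum_PiE) auto
    also have "\<dots> = (\<Sum>s\<in>(\<Pi>\<^sub>E l\<in>{1..N}. {..<d}). \<Sum>r\<in>(\<Pi>\<^sub>E l\<in>{1..N}. {..<K l}). F A s r b * cnj (F B s r b'))"
      unfolding F_def by (simp add: prod.distrib)
    finally show "(\<Sum>s\<in>(\<Pi>\<^sub>E l\<in>{1..N}. {..<d}). \<Sum>r\<in>(\<Pi>\<^sub>E l\<in>{1..N}. {..<K l}). F A s r b * cnj (F B s r b')) =
      (\<Prod>l\<in>{1..N}. \<Sum>s<d. \<Sum>r<K l. A l s r (b (l - 1)) (b l) * cnj (B l s r (b' (l - 1)) (b' l)))" by simp
  qed
  finally show ?thesis unfolding chain_sum_def \<B>_def by simp
qed

text \<open>All sites other than \<open>l\<close> contract to identities. Replacing the tensor at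
  \<open>l\<close> leaves the canonical conditions intact, as they concern the other sites only;
  hence overlaps of an old and a new purification are covered as well.\<close>

lemma frob_inner_lpf_op_canonical:
  assumes D: "bond_dims N D" and can: "mixed_canonical d N K D A l" and l: "1 \<le> l" "l \<le> N"
  shows "frob_inner (d ^ N) (\<Prod>k\<in>{1..N}. K k) (lpf_op d N K D (A(l := B))) (lpf_op d N K D (A(l := C))) =
    (\<Sum>n<D (l - 1). \<Sum>m<D l. \<Sum>s<d. \<Sum>r<K l. B s r n m * cnj (C s r n m))"
proof -
  define T where "T = (\<lambda>k n n' m m'. \<Sum>s<d. \<Sum>r<K k. (A(l := B)) k s r n m * cnj ((A(l := C)) k s r n' m'))"
  have L: "(\<Sum>n<D (k - 1). T k n n m m') = (if m = m' then 1 else 0)" if "1 \<le> k" "k \<le> l - 1" "m < D k" "m' < D k" for k m m'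
  proof -
    have "(\<Sum>n<D (k - 1). T k n n m m') = (\<Sum>s<d. \<Sum>r<K k. \<Sum>n<D (k - 1). A k s r n m * cnj (A k s r n m'))"
      unfolding T_def using that l
      by (subst sum_rotate) auto
    also have "\<dots> = (if m = m' then 1 else 0)"
      using can that l unfolding mixed_canonical_def by auto
    finally show ?thesis .
  qed
  have R: "(\<Sum>m<D k. T k n n' m m) = (if n = n' then 1 else 0)" if "l < k" "k \<le> N" "n < D (k - 1)" "n' < D (k - 1)" for k n n'
  proof -
    have "(\<Sum>m<D k. T k n n' m m) = (\<Sum>s<d. \<Sum>r<K k. \<Sum>m<D k. A k s r n m * cnj (A k s r n' m))"
      unfolding T_def using that l
      by (subst sum_rotate) auto
    also have "\<dots> = (if n = n' then 1 else 0)"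
      using can that unfolding mixed_canonical_def by auto
    finally show ?thesis .
  qed
  obtain k where k: "l = Suc k" using l by (cases l) auto
  have "chain_sum D T N (\<lambda>_ _. 1) = chain_sum D T (Suc k) (\<lambda>m m'. if m = m' then 1 else 0)"
    using D l k R by (intro chain_sum_right[of D N l]) (auto simp: bond_dims_def)
  also have "\<dots> = chain_sum D T k (\<lambda>n n'. \<Sum>m<D l. T l n n' m m)"
    unfolding chain_sum_Suc sum_sum_delta k ..
  also have "\<dots> = (\<Sum>n<D k. \<Sum>m<D l. T l n n m m)"
    using D k L by (intro chain_sum_left) (auto simp: bond_dims_def)
  finally show ?thesis
    unfolding frob_inner_lpf_op T_def[symmetric] by (simp add: T_def k)
qed

section \<open>Unfoldings of a tensor and their singular value decompositions\<close>

lemma sum_div_mod: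
  fixes g :: "nat \<Rightarrow> nat \<Rightarrow> 'b::comm_monoid_add"
  shows "(\<Sum>y<p * q. g (y div q) (y mod q)) = (\<Sum>u<p. \<Sum>v<q. g u v)"
proof -
  have "(\<Sum>(u, v)\<in>{..<p} \<times> {..<q}. g u v) = (\<Sum>y<p * q. g (y div q) (y mod q))"
  proof (rule sum.reindex_bij_witness[where i = "\<lambda>y. (y div q, y mod q)" and j = "\<lambda>(u, v). u * q + v"])
    fix y assume y: "y \<in> {..<p * q}"
    then have "q > 0" by (cases q) auto
    then show "(y div q, y mod q) \<in> {..<p} \<times> {..<q}" using y by (auto simp: less_mult_imp_div_less)
  qed (auto simp: pair_index_less)
  then show ?thesis by (simp add: sum.cartesian_product)
qed

lemma sum_div_mod_3:
  fixes g :: "nat \<Rightarrow> nat \<Rightarrow> nat \<Rightarrow> 'b::comm_monoid_add"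
  shows "(\<Sum>y<p * q * r. g (y div (q * r)) (y div r mod q) (y mod r)) = (\<Sum>u<p. \<Sum>v<q. \<Sum>w<r. g u v w)"
proof -
  have "y div (q * r) = y div r div q" for y by (simp add: div_mult2_eq mult.commute[of q])
  then have "(\<Sum>y<p * q * r. g (y div (q * r)) (y div r mod q) (y mod r)) =
    (\<Sum>x<p * q. \<Sum>w<r. g (x div q) (x mod q) w)"
    using sum_div_mod[of "\<lambda>x w. g (x div q) (x mod q) w" r "p * q"] by simp
  also have "\<dots> = (\<Sum>u<p. \<Sum>v<q. \<Sum>w<r. g u v w)" by (rule sum_div_mod)
  finally show ?thesis .
qed

text \<open>An unfolding only reorders the entries of a tensor. Its dimensions are hidden behind an
  existential quantifier so that the three virtual indices can be treated alike afterwards.\<close>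

lemma frob_inner_unfolding_mat:
  assumes j: "j \<in> {1, 2, 3}"
  shows "\<exists>n' m'. (\<forall>B. unfolding_mat j d k a b B \<in> carrier_mat n' m') \<and>
    (\<forall>B C. (\<Sum>n<a. \<Sum>m<b. \<Sum>s<d. \<Sum>r<k. B s r n m * cnj (C s r n m)) =
      frob_inner n' m' (unfolding_mat j d k a b B) (unfolding_mat j d k a b C))"
proof -
  have sw: "(\<Sum>n<a. \<Sum>m<b. \<Sum>s<d. \<Sum>r<k. g s r n m) = (\<Sum>n<a. \<Sum>s<d. \<Sum>r<k. \<Sum>m<b. g s r n m)"
    "(\<Sum>n<a. \<Sum>m<b. \<Sum>s<d. \<Sum>r<k. g s r n m) = (\<Sum>r<k. \<Sum>s<d. \<Sum>n<a. \<Sum>m<b. g s r n m)"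
    "(\<Sum>n<a. \<Sum>m<b. \<Sum>s<d. \<Sum>r<k. g s r n m) = (\<Sum>m<b. \<Sum>s<d. \<Sum>r<k. \<Sum>n<a. g s r n m)" for g :: "nat \<Rightarrow> nat \<Rightarrow> nat \<Rightarrow> nat \<Rightarrow> complex"
  proof -
    show 1: "(\<Sum>n<a. \<Sum>m<b. \<Sum>s<d. \<Sum>r<k. g s r n m) = (\<Sum>n<a. \<Sum>s<d. \<Sum>r<k. \<Sum>m<b. g s r n m)"
      by (intro sum.cong refl sum_rotate)
    have "(\<Sum>n<a. \<Sum>s<d. \<Sum>r<k. \<Sum>m<b. g s r n m) = (\<Sum>s<d. \<Sum>n<a. \<Sum>r<k. \<Sum>m<b. g s r n m)" by (rule sum.swap)
    also have "\<dots> = (\<Sum>s<d. \<Sum>r<k. \<Sum>n<a. \<Sum>m<b. g s r n m)" by (intro sum.cong refl sum.swap)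
    also have "\<dots> = (\<Sum>r<k. \<Sum>s<d. \<Sum>n<a. \<Sum>m<b. g s r n m)" by (rule sum.swap)
    finally show "(\<Sum>n<a. \<Sum>m<b. \<Sum>s<d. \<Sum>r<k. g s r n m) = (\<Sum>r<k. \<Sum>s<d. \<Sum>n<a. \<Sum>m<b. g s r n m)" using 1 by simp
    have "(\<Sum>n<a. \<Sum>m<b. \<Sum>s<d. \<Sum>r<k. g s r n m) = (\<Sum>m<b. \<Sum>n<a. \<Sum>s<d. \<Sum>r<k. g s r n m)" by (rule sum.swap)
    also have "\<dots> = (\<Sum>m<b. \<Sum>s<d. \<Sum>r<k. \<Sum>n<a. g s r n m)"
      by (intro sum.cong refl sum_rotate)
    finally show "(\<Sum>n<a. \<Sum>m<b. \<Sum>s<d. \<Sum>r<k. g s r n m) = (\<Sum>m<b. \<Sum>s<d. \<Sum>r<k. \<Sum>n<a. g s r n m)" .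
  qed
  consider "j = 1" | "j = 2" | "j = 3" using j by blast
  then show ?thesis
  proof cases
    case 1
    show ?thesis
    proof (rule exI[of _ a], rule exI[of _ "d * k * b"], intro conjI allI)
      fix B C :: tensor
      have "frob_inner a (d * k * b) (unfolding_mat j d k a b B) (unfolding_mat j d k a b C) =
        (\<Sum>n<a. \<Sum>y<d * k * b. (\<lambda>s r m. B s r n m * cnj (C s r n m)) (y div (k * b)) (y div b mod k) (y mod b))"
        unfolding frob_inner_def using 1 by (intro sum.cong refl) (simp add: unfolding_mat_def)
      then show "(\<Sum>n<a. \<Sum>m<b. \<Sum>s<d. \<Sum>r<k. B s r n m * cnj (C s r n m)) =
        frob_inner a (d * k * b) (unfolding_mat j d k a b B) (unfolding_mat j d k a b C)"
        unfolding sw(1) sum_div_mod_3[where g = "\<lambda>s r m. B s r n m * cnj (C s r n m)" and p = d and q = k and r = b for n, symmetric] by simp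
    qed (use 1 in \<open>simp add: unfolding_mat_def\<close>)
  next
    case 2
    show ?thesis
    proof (rule exI[of _ k], rule exI[of _ "d * a * b"], intro conjI allI)
      fix B C :: tensor
      have "frob_inner k (d * a * b) (unfolding_mat j d k a b B) (unfolding_mat j d k a b C) =
        (\<Sum>r<k. \<Sum>y<d * a * b. (\<lambda>s n m. B s r n m * cnj (C s r n m)) (y div (a * b)) (y div b mod a) (y mod b))"
        unfolding frob_inner_def using 2 by (intro sum.cong refl) (simp add: unfolding_mat_def)
      then show "(\<Sum>n<a. \<Sum>m<b. \<Sum>s<d. \<Sum>r<k. B s r n m * cnj (C s r n m)) =
        frob_inner k (d * a * b) (unfolding_mat j d k a b B) (unfolding_mat j d k a b C)"
        unfolding sw(2) sum_div_mod_3[where g = "\<lambda>s n m. B s r n m * cnj (C s r n m)" and p = d and q = a and r = b for r, symmetric] by simp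
    qed (use 2 in \<open>simp add: unfolding_mat_def\<close>)
  next
    case 3
    show ?thesis
    proof (rule exI[of _ b], rule exI[of _ "d * k * a"], intro conjI allI)
      fix B C :: tensor
      have "frob_inner b (d * k * a) (unfolding_mat j d k a b B) (unfolding_mat j d k a b C) =
        (\<Sum>m<b. \<Sum>y<d * k * a. (\<lambda>s r n. B s r n m * cnj (C s r n m)) (y div (k * a)) (y div a mod k) (y mod a))"
        unfolding frob_inner_def using 3 by (intro sum.cong refl) (simp add: unfolding_mat_def)
      then show "(\<Sum>n<a. \<Sum>m<b. \<Sum>s<d. \<Sum>r<k. B s r n m * cnj (C s r n m)) =
        frob_inner b (d * k * a) (unfolding_mat j d k a b B) (unfolding_mat j d k a b C)"
        unfolding sw(3) sum_div_mod_3[where g = "\<lambda>s r n. B s r n m * cnj (C s r n m)" and p = d and q = k and r = a for m, symmetric] by simp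
    qed (use 3 in \<open>simp add: unfolding_mat_def\<close>)
  qed
qed

lemma frob_inner_mtr:
  assumes "X \<in> carrier_mat n m" "Y \<in> carrier_mat n m"
  shows "frob_inner n m X Y = mtr (X * mat_adjoint Y)"
  using assms by (simp add: frob_inner_def mtr_mult[of _ n m])

lemma frob_inner_self:
  assumes "X \<in> carrier_mat n m"
  shows "frob_inner n m X X = of_real ((frob_norm X)\<^sup>2)"
  unfolding frob_inner_mtr[OF assms assms] by (rule mtr_self_mult_adjoint[OF assms])

text \<open>The orthonormal columns of \<open>U\<close> cancel in the middle of the product, those
  of \<open>V\<close> by cyclicity of the trace.\<close>

lemma frob_inner_svd:
  fixes V U :: "complex mat"
  assumes V: "V \<in> carrier_mat n q" "mat_adjoint V * V = 1\<^sub>m q"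
    and U: "U \<in> carrier_mat m q" "mat_adjoint U * U = 1\<^sub>m q"
  shows "frob_inner n m (V * mat_diag q f * mat_adjoint U) (V * mat_diag q g * mat_adjoint U) = (\<Sum>i<q. f i * cnj (g i))"
proof -
  have Va: "mat_adjoint V \<in> carrier_mat q n" and Ua: "mat_adjoint U \<in> carrier_mat q m" using V U by auto
  have F: "mat_diag q f \<in> carrier_mat q q" and G: "mat_diag q (\<lambda>i. cnj (g i)) \<in> carrier_mat q q" and G': "mat_diag q g \<in> carrier_mat q q" by auto
  note VF = mult_carrier_mat[OF V(1) F] and VG = mult_carrier_mat[OF V(1) G']
  have "mat_adjoint (V * mat_diag q g * mat_adjoint U) = U * mat_adjoint (V * mat_diag q g)"
    using mat_adjoint_mult[OF VG Ua] by simp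
  also have "mat_adjoint (V * mat_diag q g) = mat_diag q (\<lambda>i. cnj (g i)) * mat_adjoint V"
    using mat_adjoint_mult[OF V(1) G'] by (simp add: mat_adjoint_diag)
  finally have ad: "mat_adjoint (V * mat_diag q g * mat_adjoint U) = U * (mat_diag q (\<lambda>i. cnj (g i)) * mat_adjoint V)" .
  note GV = mult_carrier_mat[OF G Va]
  have "V * mat_diag q f * mat_adjoint U * (U * (mat_diag q (\<lambda>i. cnj (g i)) * mat_adjoint V))
    = V * mat_diag q f * (mat_adjoint U * U * (mat_diag q (\<lambda>i. cnj (g i)) * mat_adjoint V))"
    using assoc_mult_mat[OF VF Ua mult_carrier_mat[OF U(1) GV]] assoc_mult_mat[OF Ua U(1) GV] by simp
  also have "\<dots> = V * (mat_diag q f * (mat_diag q (\<lambda>i. cnj (g i)) * mat_adjoint V))"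
    unfolding U(2) left_mult_one_mat[OF GV] by (rule assoc_mult_mat[OF V(1) F GV])
  also have "mat_diag q f * (mat_diag q (\<lambda>i. cnj (g i)) * mat_adjoint V) = mat_diag q (\<lambda>i. f i * cnj (g i)) * mat_adjoint V"
    using assoc_mult_mat[OF F G Va] by simp
  finally have e: "V * mat_diag q f * mat_adjoint U * (U * (mat_diag q (\<lambda>i. cnj (g i)) * mat_adjoint V)) =
    V * (mat_diag q (\<lambda>i. f i * cnj (g i)) * mat_adjoint V)" .
  have H: "mat_diag q (\<lambda>i. f i * cnj (g i)) \<in> carrier_mat q q" by simp
  have "frob_inner n m (V * mat_diag q f * mat_adjoint U) (V * mat_diag q g * mat_adjoint U) =
     mtr (V * (mat_diag q (\<lambda>i. f i * cnj (g i)) * mat_adjoint V))"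
    unfolding frob_inner_mtr[OF mult_carrier_mat[OF VF Ua] mult_carrier_mat[OF VG Ua]] ad e ..
  also have "\<dots> = mtr (mat_diag q (\<lambda>i. f i * cnj (g i)) * mat_adjoint V * V)"
    by (rule mtr_mult_commute[OF V(1) mult_carrier_mat[OF H Va]])
  also have "mat_diag q (\<lambda>i. f i * cnj (g i)) * mat_adjoint V * V = mat_diag q (\<lambda>i. f i * cnj (g i))"
    using assoc_mult_mat[OF H Va V(1)] V(2) right_mult_one_mat[OF H] by simp
  finally show ?thesis by (simp add: mtr_def mat_diag_def)
qed

lemma frob_norm_diff_sum:
  assumes X: "X \<in> carrier_mat n m" and Y: "Y \<in> carrier_mat n m"
  shows "(frob_norm (X - Y))\<^sup>2 = (frob_norm X)\<^sup>2 + (frob_norm Y)\<^sup>2 - 2 * Re (frob_inner n m X Y)"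
    "(frob_norm (X + Y))\<^sup>2 = (frob_norm X)\<^sup>2 + (frob_norm Y)\<^sup>2 + 2 * Re (frob_inner n m X Y)"
proof -
  have XY: "X - Y \<in> carrier_mat n m" "X + Y \<in> carrier_mat n m" using X Y by (auto simp: minus_carrier_mat)
  have m: "(cmod (x - y))\<^sup>2 = (cmod x)\<^sup>2 + (cmod y)\<^sup>2 - 2 * Re (x * cnj y)"
    "(cmod (x + y))\<^sup>2 = (cmod x)\<^sup>2 + (cmod y)\<^sup>2 + 2 * Re (x * cnj y)" for x y
    by (simp_all add: cmod_power2, simp_all add: power2_eq_square algebra_simps)
  have "(frob_norm (X - Y))\<^sup>2 = (\<Sum>i<n. \<Sum>j<m. (cmod (X $$ (i, j)))\<^sup>2 + (cmod (Y $$ (i, j)))\<^sup>2 - 2 * Re (X $$ (i, j) * cnj (Y $$ (i, j))))"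
    unfolding frob_norm_sq[OF XY(1)] using X Y by (intro sum.cong refl) (simp add: m(1))
  then show "(frob_norm (X - Y))\<^sup>2 = (frob_norm X)\<^sup>2 + (frob_norm Y)\<^sup>2 - 2 * Re (frob_inner n m X Y)"
    unfolding frob_norm_sq[OF X] frob_norm_sq[OF Y] frob_inner_def
    by (simp only: sum.distrib sum_subtractf sum_distrib_left Re_sum)
  have "(frob_norm (X + Y))\<^sup>2 = (\<Sum>i<n. \<Sum>j<m. (cmod (X $$ (i, j)))\<^sup>2 + (cmod (Y $$ (i, j)))\<^sup>2 + 2 * Re (X $$ (i, j) * cnj (Y $$ (i, j))))"
    unfolding frob_norm_sq[OF XY(2)] using X Y by (intro sum.cong refl) (simp add: m(2))
  then show "(frob_norm (X + Y))\<^sup>2 = (frob_norm X)\<^sup>2 + (frob_norm Y)\<^sup>2 + 2 * Re (frob_inner n m X Y)"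
    unfolding frob_norm_sq[OF X] frob_norm_sq[OF Y] frob_inner_def
    by (simp only: sum.distrib sum_distrib_left Re_sum)
qed

section \<open>Kronecker products and isometries on the Kraus index\<close>

lemma kron_dim [simp]: "dim_row (kron A B) = dim_row A * dim_row B" "dim_col (kron A B) = dim_col A * dim_col B"
  by (simp_all add: kron_def)

lemma kron_mult:
  assumes "dim_col A = dim_row C" "dim_col B = dim_row E"
  shows "kron A B * kron C E = kron (A * C) (B * E)"
proof (rule eq_matI)
  fix i j assume "i < dim_row (kron (A * C) (B * E))" "j < dim_col (kron (A * C) (B * E))"
  then have ij: "i < dim_row A * dim_row B" "j < dim_col C * dim_col E" by simp_all
  then have pos: "dim_row B > 0" "dim_col E > 0" by (metis gr0I mult_0_right not_less_zero)+
  have i2: "i div dim_row B < dim_row A" "i mod dim_row B < dim_row B"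
    and j2: "j div dim_col E < dim_col C" "j mod dim_col E < dim_col E"
    using ij pos by (auto simp: less_mult_imp_div_less)
  have "(kron A B * kron C E) $$ (i, j) = (\<Sum>k<dim_col A * dim_col B. kron A B $$ (i, k) * kron C E $$ (k, j))"
    using ij assms by (subst index_mult_mat_sum) auto
  also have "\<dots> = (\<Sum>k<dim_col A * dim_col B. (\<lambda>u v. A $$ (i div dim_row B, u) * B $$ (i mod dim_row B, v) *
      (C $$ (u, j div dim_col E) * E $$ (v, j mod dim_col E))) (k div dim_col B) (k mod dim_col B))"
    using ij assms by (intro sum.cong refl) (auto simp: kron_def)
  also have "\<dots> = (\<Sum>u<dim_col A. \<Sum>v<dim_col B. A $$ (i div dim_row B, u) * B $$ (i mod dim_row B, v) *
      (C $$ (u, j div dim_col E) * E $$ (v, j mod dim_col E)))"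
    by (rule sum_div_mod)
  also have "\<dots> = (\<Sum>u<dim_col A. A $$ (i div dim_row B, u) * C $$ (u, j div dim_col E)) *
      (\<Sum>v<dim_col B. B $$ (i mod dim_row B, v) * E $$ (v, j mod dim_col E))"
    by (simp add: sum_product mult_ac)
  also have "\<dots> = (A * C) $$ (i div dim_row B, j div dim_col E) * (B * E) $$ (i mod dim_row B, j mod dim_col E)"
    using i2 j2 assms by (simp add: index_mult_mat_sum del: index_mult_mat(1))
  also have "\<dots> = kron (A * C) (B * E) $$ (i, j)"
    using ij by (simp add: kron_def del: index_mult_mat(1))
  finally show "(kron A B * kron C E) $$ (i, j) = kron (A * C) (B * E) $$ (i, j)" .
qed simp_all

lemma kron_adjoint: "mat_adjoint (kron A B) = kron (mat_adjoint A) (mat_adjoint B)"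
proof (rule eq_matI)
  fix i j assume "i < dim_row (kron (mat_adjoint A) (mat_adjoint B))" "j < dim_col (kron (mat_adjoint A) (mat_adjoint B))"
  then have ij: "i < dim_col A * dim_col B" "j < dim_row A * dim_row B" by simp_all
  then have pos: "dim_col B > 0" "dim_row B > 0" by (metis gr0I mult_0_right not_less_zero)+
  show "mat_adjoint (kron A B) $$ (i, j) = kron (mat_adjoint A) (mat_adjoint B) $$ (i, j)"
    using ij pos by (simp add: kron_def less_mult_imp_div_less)
qed simp_all

lemma kron_one: "kron (1\<^sub>m n) (1\<^sub>m m) = 1\<^sub>m (n * m)"
proof (rule eq_matI)
  fix i j assume "i < dim_row (1\<^sub>m (n * m) :: complex mat)" "j < dim_col (1\<^sub>m (n * m) :: complex mat)"
  then have ij: "i < n * m" "j < n * m" by simp_all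
  then have pos: "m > 0" by (metis gr0I mult_0_right not_less_zero)
  have "(i div m = j div m \<and> i mod m = j mod m) = (i = j)" by (metis div_mult_mod_eq)
  then show "kron (1\<^sub>m n) (1\<^sub>m m) $$ (i, j) = 1\<^sub>m (n * m) $$ (i, j)"
    using ij pos by (auto simp: kron_def less_mult_imp_div_less)
qed simp_all

lemma prod_split_site:
  fixes K :: "nat \<Rightarrow> nat"
  assumes "1 \<le> l" "l \<le> N"
  shows "(\<Prod>k\<in>{1..<l}. K k) * K l * (\<Prod>k\<in>{l<..N}. K k) = (\<Prod>k\<in>{1..N}. K k)"
proof -
  have "{1..N} = {1..<l} \<union> ({l} \<union> {l<..N})" using assms by auto
  then have "(\<Prod>k\<in>{1..N}. K k) = (\<Prod>k\<in>{1..<l}. K k) * (\<Prod>k\<in>{l} \<union> {l<..N}. K k)"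
    by (simp only:) (intro prod.union_disjoint, auto)
  also have "(\<Prod>k\<in>{l} \<union> {l<..N}. K k) = K l * (\<Prod>k\<in>{l<..N}. K k)" by (subst prod.union_disjoint) auto
  finally show ?thesis by simp
qed

lemma on_sites_isometry:
  assumes W: "W * mat_adjoint W = 1\<^sub>m p" "W \<in> carrier_mat p q"
  shows "on_sites K N l l W \<in> carrier_mat ((\<Prod>k\<in>{1..<l}. K k) * p * (\<Prod>k\<in>{l<..N}. K k)) ((\<Prod>k\<in>{1..<l}. K k) * q * (\<Prod>k\<in>{l<..N}. K k))"
    "on_sites K N l l W * mat_adjoint (on_sites K N l l W) = 1\<^sub>m ((\<Prod>k\<in>{1..<l}. K k) * p * (\<Prod>k\<in>{l<..N}. K k))"
  using W by (auto simp: on_sites_def kron_adjoint kron_mult kron_one intro!: carrier_matI)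

lemma mult_isometry_adjoint:
  fixes Y W :: "complex mat"
  assumes Y: "Y \<in> carrier_mat n p" and W: "W \<in> carrier_mat p q" "W * mat_adjoint W = 1\<^sub>m p"
  shows "(Y * W) * mat_adjoint (Y * W) = Y * mat_adjoint Y"
proof -
  have Wa: "mat_adjoint W \<in> carrier_mat q p" and Ya: "mat_adjoint Y \<in> carrier_mat p n" using W Y by auto
  have "(Y * W) * mat_adjoint (Y * W) = (Y * W) * (mat_adjoint W * mat_adjoint Y)"
    unfolding mat_adjoint_mult[OF Y W(1)] ..
  also have "\<dots> = Y * (W * (mat_adjoint W * mat_adjoint Y))"
    by (rule assoc_mult_mat[OF Y W(1) mult_carrier_mat[OF Wa Ya]])
  also have "W * (mat_adjoint W * mat_adjoint Y) = mat_adjoint Y"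
    using assoc_mult_mat[OF W(1) Wa Ya] unfolding W(2) left_mult_one_mat[OF Ya] by simp
  finally show ?thesis .
qed

text \<open>The two cases are the same identity with the roles of the old and the new purification
  exchanged.\<close>

lemma kraus_isometry_state:
  assumes "kraus_isometry d N l (K, Y) (K', X)" and Y: "Y \<in> carrier_mat (d ^ N) (\<Prod>k\<in>{1..N}. K k)"
    and l: "1 \<le> l" "l \<le> N"
  shows "X \<in> carrier_mat (d ^ N) (\<Prod>k\<in>{1..N}. K' k)" "X * mat_adjoint X = Y * mat_adjoint Y"
proof -
  obtain k' W where K': "K' = K(l := k')" and X: "X \<in> carrier_mat (d ^ N) (\<Prod>k\<in>{1..N}. K' k)"
    and c: "W \<in> carrier_mat (K l) k' \<and> W * mat_adjoint W = 1\<^sub>m (K l) \<and> X = Y * on_sites K N l l W \<or>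
      W \<in> carrier_mat k' (K l) \<and> W * mat_adjoint W = 1\<^sub>m k' \<and> Y = X * on_sites K N l l W"
    using assms(1) unfolding kraus_isometry_def prod.case by blast
  show "X \<in> carrier_mat (d ^ N) (\<Prod>k\<in>{1..N}. K' k)" by (rule X)
  have pK: "(\<Prod>k\<in>{1..N}. K k) = (\<Prod>k\<in>{1..<l}. K k) * K l * (\<Prod>k\<in>{l<..N}. K k)"
    using prod_split_site[OF l, of K] by simp
  have pK': "(\<Prod>k\<in>{1..N}. K' k) = (\<Prod>k\<in>{1..<l}. K k) * k' * (\<Prod>k\<in>{l<..N}. K k)"
  proof -
    have "prod K' {1..<l} = prod K {1..<l}" "prod K' {l<..N} = prod K {l<..N}"
      unfolding K' by (auto intro!: prod.cong)
    then show ?thesis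
      unfolding prod_split_site[OF l, of K', symmetric] by (simp add: K')
  qed
  from c show "X * mat_adjoint X = Y * mat_adjoint Y"
  proof (elim disjE conjE)
    assume W: "W \<in> carrier_mat (K l) k'" "W * mat_adjoint W = 1\<^sub>m (K l)" and e: "X = Y * on_sites K N l l W"
    show ?thesis
      unfolding e by (rule mult_isometry_adjoint[OF Y[unfolded pK] on_sites_isometry[OF W(2,1)]])
  next
    assume W: "W \<in> carrier_mat k' (K l)" "W * mat_adjoint W = 1\<^sub>m k'" and e: "Y = X * on_sites K N l l W"
    show ?thesis
      unfolding e by (rule mult_isometry_adjoint[OF X[unfolded pK'] on_sites_isometry[OF W(2,1)], symmetric])
  qed
qed

lemma frob_norm_cong_state:
  assumes "X \<in> carrier_mat n m" "Y \<in> carrier_mat n m'" "X * mat_adjoint X = Y * mat_adjoint Y"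
  shows "frob_norm X = frob_norm Y"
proof -
  have "(frob_norm X)\<^sup>2 = (frob_norm Y)\<^sup>2"
    using mtr_self_mult_adjoint[OF assms(1)] mtr_self_mult_adjoint[OF assms(2)] assms(3)
    by (metis of_real_eq_iff)
  then show ?thesis by (simp add: power2_eq_iff_nonneg)
qed

text \<open>The step acts isometrically on the tensor at site \<open>l\<close>, so all scalar products can be read off the
  singular values; the overlap of the two purifications is \<open>sqrt (1 - \<delta>\<^sup>2)\<close>.\<close>

lemma compression_error:
  assumes comp: "compression d N l j \<delta> (K, X) (K', X')" and l: "1 \<le> l" "l \<le> N" and j: "j \<in> {1, 2, 3}"
    and X1: "frob_norm X = 1"
  shows "X' \<in> carrier_mat (d ^ N) (\<Prod>k\<in>{1..N}. K' k)" "frob_norm X' = 1"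
    "trace_norm (X * mat_adjoint X - X' * mat_adjoint X') \<le> 2 * \<delta>"
    "X \<in> carrier_mat (d ^ N) (\<Prod>k\<in>{1..N}. K k)"
proof -
  define n m where "n = d ^ N" and "m = (\<Prod>k\<in>{1..N}. K k)"
  obtain D A A' q V s U Z c Y where D: "bond_dims N D" and X: "X = lpf_op d N K D A"
    and can: "mixed_canonical d N K D A l"
    and svd: "is_svd (unfolding_mat j d (K l) (D (l - 1)) (D l) (A l)) q V s U"
    and Z: "Z \<subseteq> {..<q}" and \<delta>: "\<delta> = sqrt (\<Sum>i\<in>Z. (s i)\<^sup>2)" and c: "0 < (c::real)"
    and A': "unfolding_mat j d (K l) (D (l - 1)) (D l) A' =
       complex_of_real c \<cdot>\<^sub>m (V * mat_diag q (\<lambda>i. if i \<in> Z then 0 else complex_of_real (s i)) * mat_adjoint U)"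
    and Y: "Y = lpf_op d N K D (A(l := A'))" and Y1: "frob_norm Y = 1"
    and P': "if j = 2 then kraus_isometry d N l (K, Y) (K', X') else (K', X') = (K, Y)"
    using comp unfolding compression_def by auto
  have Xc: "X \<in> carrier_mat n m" and Yc: "Y \<in> carrier_mat n m" unfolding X Y n_def m_def by (rule lpf_op_carrier)+
  then show "X \<in> carrier_mat (d ^ N) (\<Prod>k\<in>{1..N}. K k)" by (simp add: n_def m_def)
  obtain n' m' where uc: "\<forall>B. unfolding_mat j d (K l) (D (l - 1)) (D l) B \<in> carrier_mat n' m'"
    and ui': "\<forall>B C. (\<Sum>n<D (l - 1). \<Sum>m<D l. \<Sum>s<d. \<Sum>r<K l. B s r n m * cnj (C s r n m)) =
      frob_inner n' m' (unfolding_mat j d (K l) (D (l - 1)) (D l) B) (unfolding_mat j d (K l) (D (l - 1)) (D l) C)"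
    using frob_inner_unfolding_mat[OF j, of d "K l" "D (l - 1)" "D l"] by (elim exE conjE)
  note ui = ui'[rule_format]
  have V: "V \<in> carrier_mat n' q" "mat_adjoint V * V = 1\<^sub>m q" and U: "U \<in> carrier_mat m' q" "mat_adjoint U * U = 1\<^sub>m q"
    and M: "unfolding_mat j d (K l) (D (l - 1)) (D l) (A l) = V * mat_diag q (\<lambda>i. complex_of_real (s i)) * mat_adjoint U"
    using svd[unfolded is_svd_def carrier_matD[OF spec[OF uc]]] by blast+
  define f where "f i = complex_of_real (s i)" for i
  \<comment> \<open>The new tensor has the same singular vectors as the old one, with
    \<open>g\<close> on the diagonal.\<close>
  define g where "g i = (if i \<in> Z then 0 else complex_of_real (c * s i))" for i
  have Ua: "mat_adjoint U \<in> carrier_mat q m'" using U by simp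
  have "of_real c \<cdot>\<^sub>m mat_diag q (\<lambda>i. if i \<in> Z then 0 else complex_of_real (s i)) = mat_diag q g"
    by (rule eq_matI) (auto simp: mat_diag_def g_def)
  then have M': "unfolding_mat j d (K l) (D (l - 1)) (D l) A' = V * mat_diag q g * mat_adjoint U"
    unfolding A' using mult_smult_distrib[OF V(1) mat_diag_dim[of q "\<lambda>i. if i \<in> Z then 0 else complex_of_real (s i)"], of "of_real c"]
      mult_smult_assoc_mat[OF mult_carrier_mat[OF V(1) mat_diag_dim[of q "\<lambda>i. if i \<in> Z then 0 else complex_of_real (s i)"]] Ua, of "of_real c"]
    by simp
  have Mf: "unfolding_mat j d (K l) (D (l - 1)) (D l) (A l) = V * mat_diag q f * mat_adjoint U"
    unfolding M f_def ..
  have "A = A(l := A l)" by simp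
  then have X': "X = lpf_op d N K D (A(l := A l))" using X by metis
  note ip = frob_inner_lpf_op_canonical[OF D can l, folded n_def m_def]
  \<comment> \<open>The kept weight. Normalization of both purifications gives \<delta>^2 = 1 -
    \<kappa> and c^2 \<kappa> = 1, so the overlap c \<kappa> has the square \<kappa>.\<close>
  define \<kappa> where "\<kappa> = (\<Sum>i\<in>{..<q} - Z. (s i)\<^sup>2)"
  have sp: "(\<Sum>i<q. h i) = (\<Sum>i\<in>Z. h i) + (\<Sum>i\<in>{..<q} - Z. h i)" for h :: "nat \<Rightarrow> complex"
    using sum.subset_diff[OF Z, of h] by (simp add: add.commute)
  have XX: "frob_inner n m X X = of_real ((\<Sum>i\<in>Z. (s i)\<^sup>2) + \<kappa>)"
  proof -
    have "frob_inner n m X X = (\<Sum>i<q. f i * cnj (f i))"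
      unfolding X' ip ui Mf by (rule frob_inner_svd[OF V U])
    also have "\<dots> = of_real ((\<Sum>i\<in>Z. (s i)\<^sup>2) + \<kappa>)"
      unfolding sp by (simp add: f_def \<kappa>_def power2_eq_square)
    finally show ?thesis .
  qed
  have YY: "frob_inner n m Y Y = of_real (c\<^sup>2 * \<kappa>)"
  proof -
    have "frob_inner n m Y Y = (\<Sum>i<q. g i * cnj (g i))"
      unfolding Y ip ui M' by (rule frob_inner_svd[OF V U])
    also have "\<dots> = (\<Sum>i\<in>{..<q} - Z. of_real (c\<^sup>2 * (s i)\<^sup>2))"
      unfolding sp by (simp add: g_def power2_eq_square mult_ac)
    finally show ?thesis by (simp add: \<kappa>_def sum_distrib_left)
  qed
  have XY: "frob_inner n m X Y = of_real (c * \<kappa>)"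
  proof -
    have "frob_inner n m X Y = (\<Sum>i<q. f i * cnj (g i))"
      unfolding X' Y ip ui Mf M' by (rule frob_inner_svd[OF V U])
    also have "\<dots> = (\<Sum>i\<in>{..<q} - Z. of_real (c * (s i)\<^sup>2))"
      unfolding sp by (simp add: f_def g_def power2_eq_square mult_ac)
    finally show ?thesis by (simp add: \<kappa>_def sum_distrib_left)
  qed
  have 1: "(\<Sum>i\<in>Z. (s i)\<^sup>2) + \<kappa> = 1"
    using XX frob_inner_self[OF Xc] X1 by (metis of_real_eq_iff one_power2)
  have 2: "c\<^sup>2 * \<kappa> = 1"
    using YY frob_inner_self[OF Yc] Y1 by (metis of_real_eq_iff one_power2)
  have d2: "\<delta>\<^sup>2 = 1 - \<kappa>" "0 \<le> \<delta>"
    using 1 unfolding \<delta> by (simp_all add: sum_nonneg)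
  \<comment> \<open>For unit vectors with real overlap o the product of the squared norms is (2 - 2
    o) (2 + 2 o) = 4 - 4 o^2, here 4 - 4 \<kappa> = 4 \<delta>^2.\<close>
  have "(frob_norm (X - Y) * frob_norm (X + Y))\<^sup>2 = (2 - 2 * (c * \<kappa>)) * (2 + 2 * (c * \<kappa>))"
    unfolding power_mult_distrib frob_norm_diff_sum[OF Xc Yc] XY X1 Y1 by simp
  also have "\<dots> = 4 - 4 * (c\<^sup>2 * \<kappa>) * \<kappa>" by (simp add: power2_eq_square algebra_simps)
  also have "\<dots> = (2 * \<delta>)\<^sup>2" unfolding 2 by (simp add: power_mult_distrib d2)
  finally have "frob_norm (X - Y) * frob_norm (X + Y) = 2 * \<delta>"
    by (rule power2_eq_imp_eq) (use d2(2) in auto)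
  then have tn: "trace_norm (X * mat_adjoint X - Y * mat_adjoint Y) \<le> 2 * \<delta>"
    using trace_norm_purification_diff[OF Xc Yc] by simp
  have "X' \<in> carrier_mat (d ^ N) (\<Prod>k\<in>{1..N}. K' k) \<and> X' * mat_adjoint X' = Y * mat_adjoint Y"
  proof (cases "j = 2")
    case True
    then show ?thesis using P' kraus_isometry_state[OF _ _ l] Yc unfolding n_def m_def by simp
  next
    case False
    then show ?thesis using P' Yc unfolding n_def m_def by simp
  qed
  then show "X' \<in> carrier_mat (d ^ N) (\<Prod>k\<in>{1..N}. K' k)" "frob_norm X' = 1"
    "trace_norm (X * mat_adjoint X - X' * mat_adjoint X') \<le> 2 * \<delta>"
    using tn Y1 frob_norm_cong_state[of X' "d ^ N" "\<Prod>k\<in>{1..N}. K' k" Y m] Yc by (auto simp: n_def)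
qed

section \<open>Locality of the generators\<close>

text \<open>In the digits of \<open>ampl\<close>, with an outer block, a middle digit below
  \<open>k\<close> and an inner digit below \<open>e\<close>, the middle digit of \<open>i\<close>
  is replaced by \<open>p\<close>.\<close>

definition block_update :: "nat \<Rightarrow> nat \<Rightarrow> nat \<Rightarrow> nat \<Rightarrow> nat" where
  "block_update k e i p = i div (k * e) * (k * e) + p * e + i mod e"

text \<open>Expansion of \<open>M\<close> in matrix units turns the amplification into a finite sum
  over digit replacements, from which linearity and commutation can be read off.\<close>

lemma ampl_index:
  assumes M: "linear_superop k M" and ij: "i < c * k * e" "j < c * k * e"
  shows "ampl c k e M R $$ (i, j) = (\<Sum>p<k. \<Sum>q<k. R $$ (block_update k e i p, block_update k e j q) *
    M (unit_mat k (p, q)) $$ (i div e mod k, j div e mod k))"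
proof -
  have "k > 0" using ij by (cases k) auto
  then have k: "i div e mod k < k" "j div e mod k < k" by simp_all
  define B where "B = Matrix.mat k k (\<lambda>(p, q). R $$ (block_update k e i p, block_update k e j q))"
  have B: "B \<in> carrier_mat k k" by (simp add: B_def)
  have "ampl c k e M R $$ (i, j) = M B $$ (i div e mod k, j div e mod k)"
    using ij by (simp add: ampl_def block_update_def B_def)
  also have "\<dots> = (\<Sum>p<k. \<Sum>q<k. B $$ (p, q) * M (unit_mat k (p, q)) $$ (i div e mod k, j div e mod k))"
    by (rule linear_superop_index[OF M B k])
  also have "\<dots> = (\<Sum>p<k. \<Sum>q<k. R $$ (block_update k e i p, block_update k e j q) *
      M (unit_mat k (p, q)) $$ (i div e mod k, j div e mod k))"
    by (intro sum.cong refl) (simp add: B_def)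
  finally show ?thesis .
qed

lemma block_offset_less: "p < k \<Longrightarrow> 0 < e \<Longrightarrow> p * e + i mod e < k * (e::nat)"
  using pair_index_less[of p k "i mod e" e] by simp

lemma block_update_less:
  assumes "i < c * k * e" "p < k"
  shows "block_update k e i p < c * k * e"
proof -
  have e: "0 < e" using assms by (cases e) auto
  have "i div (k * e) < c" using assms by (simp add: less_mult_imp_div_less mult.assoc)
  from pair_index_less[OF this block_offset_less[OF assms(2) e, of i]]
  show ?thesis by (simp add: block_update_def add.assoc mult.assoc)
qed

lemma ampl_linear_superop:
  assumes M: "linear_superop k M"
  shows "linear_superop (c * k * e) (ampl c k e M)"
  unfolding linear_superop_def
proof (intro conjI ballI allI)
  fix R S :: "complex mat" and a assume R: "R \<in> carrier_mat (c * k * e) (c * k * e)"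
  show "ampl c k e M R \<in> carrier_mat (c * k * e) (c * k * e)" by (simp add: ampl_def)
  have dim: "dim_row (ampl c k e M Q) = c * k * e" "dim_col (ampl c k e M Q) = c * k * e" for Q
    by (simp_all add: ampl_def)
  have less: "block_update k e i p < dim_row R" "block_update k e i p < dim_col R" if "i < c * k * e" "p < k" for i p
    using block_update_less[OF that] R by auto
  show "ampl c k e M (a \<cdot>\<^sub>m R) = a \<cdot>\<^sub>m ampl c k e M R"
    by (rule eq_matI) (auto simp: dim ampl_index[OF M] less sum_distrib_left mult.assoc intro!: sum.cong)
  assume S: "S \<in> carrier_mat (c * k * e) (c * k * e)"
  have less': "block_update k e i p < dim_row S" "block_update k e i p < dim_col S" if "i < c * k * e" "p < k" for i p
    using block_update_less[OF that] S by auto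
  show "ampl c k e M (R + S) = ampl c k e M R + ampl c k e M S"
    by (rule eq_matI) (auto simp: dim ampl_index[OF M] less less' sum.distrib distrib_right)
qed

lemma block_update_div:
  assumes "p < k" "0 < e"
  shows "block_update k e i p div (k * e) = i div (k * e)"
  using block_offset_less[OF assms, of i] assms by (simp add: block_update_def add.assoc)

lemma block_update_mod: "block_update k e i p mod e = i mod e"
proof -
  have "block_update k e i p = (i div (k * e) * k + p) * e + i mod e"
    by (simp add: block_update_def algebra_simps)
  then show ?thesis by simp
qed

text \<open>Block \<open>2\<close> consists of less significant digits than block \<open>1\<close>.\<close>

context
  fixes k1 e1 k2 e2 w :: nat
  assumes e1: "e1 = w * (k2 * e2)" and pos: "0 < e1"
begin

lemma inner_pos: "0 < k2" "0 < e2" "0 < w"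
  using e1 pos by auto

lemma inner_update_div_outer: "q < k2 \<Longrightarrow> block_update k2 e2 i q div e1 = i div e1"
proof -
  assume q: "q < k2"
  have "x div e1 = x div (k2 * e2) div w" for x by (simp add: e1 div_mult2_eq mult.commute[of w])
  then show ?thesis using block_update_div[OF q inner_pos(2)] by simp
qed

lemma outer_digit_inner_update: "q < k2 \<Longrightarrow> block_update k2 e2 i q div e1 mod k1 = i div e1 mod k1"
  by (simp add: inner_update_div_outer)

lemma inner_digit_outer_update: "block_update k1 e1 i p div e2 mod k2 = i div e2 mod k2"
proof -
  have d: "x div e2 mod k2 = x mod e1 mod (k2 * e2) div e2" for x
  proof -
    have "x mod e1 mod (k2 * e2) = x mod (k2 * e2)" by (rule mod_mod_cancel) (simp add: e1)
    moreover have "x mod (e2 * k2) = e2 * (x div e2 mod k2) + x mod e2" by (rule mod_mult2_eq)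
    ultimately show ?thesis using inner_pos by (simp add: mult.commute)
  qed
  show ?thesis unfolding d block_update_mod ..
qed

text \<open>The part of \<open>i\<close> above e1 is a multiple of k2 e2 and passes through the
  replacement unchanged.\<close>

lemma inner_update_mod_outer: "block_update k2 e2 i q mod e1 = block_update k2 e2 (i mod e1) q mod e1"
proof -
  have i: "i = (i div e1 * w) * (k2 * e2) + i mod e1" using e1 by (metis div_mult_mod_eq mult.assoc)
  define y where "y = i mod e1"
  have "i div (k2 * e2) = i div e1 * w + y div (k2 * e2)"
    by (subst i) (use inner_pos in \<open>simp add: y_def\<close>)
  moreover have "i mod e2 = y mod e2"
  proof -
    have "y mod e2 = i mod e2" unfolding y_def by (rule mod_mod_cancel) (simp add: e1)
    then show ?thesis by simp
  qed
  ultimately have "block_update k2 e2 i q = block_update k2 e2 y q + i div e1 * e1"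
    by (simp add: block_update_def e1 algebra_simps)
  then show ?thesis by (simp add: y_def)
qed

text \<open>Two indices agree if their quotients and remainders modulo e1 do. The outer replacement
  changes only the quotient, the inner one only the remainder.\<close>

lemma block_updates_commute:
  assumes q: "q < k2" and p: "p < k1"
  shows "block_update k1 e1 (block_update k2 e2 i q) p = block_update k2 e2 (block_update k1 e1 i p) q"
proof -
  have l: "block_update k1 e1 x p div e1 = x div e1 div k1 * k1 + p" for x
  proof -
    have "x div (k1 * e1) = x div e1 div k1" by (simp add: div_mult2_eq mult.commute[of k1])
    then have "block_update k1 e1 x p = (x div e1 div k1 * k1 + p) * e1 + x mod e1"
      by (simp add: block_update_def algebra_simps)
    then show ?thesis using pos by simp
  qed
  have "block_update k1 e1 (block_update k2 e2 i q) p div e1 = block_update k2 e2 (block_update k1 e1 i p) q div e1"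
    unfolding l inner_update_div_outer[OF q] ..
  moreover have "block_update k1 e1 (block_update k2 e2 i q) p mod e1 = block_update k2 e2 (block_update k1 e1 i p) q mod e1"
    unfolding block_update_mod inner_update_mod_outer[of "block_update k1 e1 i p"]
    unfolding inner_update_mod_outer[of i] ..
  ultimately show ?thesis by (metis div_mult_mod_eq)
qed

text \<open>Each replacement leaves the digit that the other superoperator acts on unchanged, so
  both sides are the same fourfold sum in a different order.\<close>

lemma ampl_commute:
  assumes M1: "linear_superop k1 M1" and M2: "linear_superop k2 M2" and c: "c1 * k1 * e1 = c2 * k2 * e2"
    and R: "R \<in> carrier_mat (c1 * k1 * e1) (c1 * k1 * e1)"
  shows "ampl c1 k1 e1 M1 (ampl c2 k2 e2 M2 R) = ampl c2 k2 e2 M2 (ampl c1 k1 e1 M1 R)"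
proof (rule eq_matI)
  fix i j assume "i < dim_row (ampl c2 k2 e2 M2 (ampl c1 k1 e1 M1 R))" "j < dim_col (ampl c2 k2 e2 M2 (ampl c1 k1 e1 M1 R))"
  then have ij2: "i < c2 * k2 * e2" "j < c2 * k2 * e2" by (simp_all add: ampl_def)
  then have ij1: "i < c1 * k1 * e1" "j < c1 * k1 * e1" using c by simp_all
  define \<mu> where "\<mu> p p' = M1 (unit_mat k1 (p, p')) $$ (i div e1 mod k1, j div e1 mod k1)" for p p'
  define \<nu> where "\<nu> q q' = M2 (unit_mat k2 (q, q')) $$ (i div e2 mod k2, j div e2 mod k2)" for q q'
  define r where "r p p' q q' = R $$ (block_update k2 e2 (block_update k1 e1 i p) q, block_update k2 e2 (block_update k1 e1 j p') q')" for p p' q q'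
  have "ampl c1 k1 e1 M1 (ampl c2 k2 e2 M2 R) $$ (i, j) =
    (\<Sum>p<k1. \<Sum>p'<k1. (\<Sum>q<k2. \<Sum>q'<k2. r p p' q q' * \<nu> q q') * \<mu> p p')"
    unfolding ampl_index[OF M1 ij1] \<mu>_def
  proof (intro sum.cong refl arg_cong2[where f = "(*)"])
    fix p p' assume "p \<in> {..<k1}" "p' \<in> {..<k1}"
    then have b: "block_update k1 e1 i p < c2 * k2 * e2" "block_update k1 e1 j p' < c2 * k2 * e2"
      using ij1 block_update_less c by (metis lessThan_iff)+
    show "ampl c2 k2 e2 M2 R $$ (block_update k1 e1 i p, block_update k1 e1 j p') = (\<Sum>q<k2. \<Sum>q'<k2. r p p' q q' * \<nu> q q')"
      unfolding ampl_index[OF M2 b] inner_digit_outer_update r_def \<nu>_def ..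
  qed
  also have "\<dots> = (\<Sum>p<k1. \<Sum>p'<k1. \<Sum>q<k2. \<Sum>q'<k2. r p p' q q' * \<nu> q q' * \<mu> p p')"
    by (simp add: sum_distrib_right)
  also have "\<dots> = (\<Sum>p<k1. \<Sum>q<k2. \<Sum>q'<k2. \<Sum>p'<k1. r p p' q q' * \<nu> q q' * \<mu> p p')"
    by (intro sum.cong refl sum_rotate)
  also have "\<dots> = (\<Sum>q<k2. \<Sum>q'<k2. \<Sum>p<k1. \<Sum>p'<k1. r p p' q q' * \<nu> q q' * \<mu> p p')"
    by (rule sum_rotate)
  also have "\<dots> = (\<Sum>q<k2. \<Sum>q'<k2. (\<Sum>p<k1. \<Sum>p'<k1. r p p' q q' * \<mu> p p') * \<nu> q q')"
    by (simp add: sum_distrib_left sum_distrib_right mult_ac)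
  also have "\<dots> = ampl c2 k2 e2 M2 (ampl c1 k1 e1 M1 R) $$ (i, j)"
    unfolding ampl_index[OF M2 ij2] \<nu>_def
  proof (intro sum.cong refl arg_cong2[where f = "(*)"])
    fix q q' assume "q \<in> {..<k2}" "q' \<in> {..<k2}"
    then have q: "q < k2" "q' < k2" by auto
    then have b: "block_update k2 e2 i q < c1 * k1 * e1" "block_update k2 e2 j q' < c1 * k1 * e1"
      using ij2 block_update_less c by metis+
    show "(\<Sum>p<k1. \<Sum>p'<k1. r p p' q q' * \<mu> p p') = ampl c1 k1 e1 M1 R $$ (block_update k2 e2 i q, block_update k2 e2 j q')"
      unfolding ampl_index[OF M1 b] outer_digit_inner_update[OF q(1)] outer_digit_inner_update[OF q(2)] r_def \<mu>_def
      using q by (intro sum.cong refl) (simp add: block_updates_commute)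
  qed
  finally show "ampl c1 k1 e1 M1 (ampl c2 k2 e2 M2 R) $$ (i, j) = ampl c2 k2 e2 M2 (ampl c1 k1 e1 M1 R) $$ (i, j)" .
qed (simp_all add: ampl_def c)

end

section \<open>Terms acting on neighbouring sites\<close>

lemma chain_dim:
  fixes d :: nat
  assumes "1 \<le> l" "l < N"
  shows "d ^ (l - 1) * d ^ 2 * d ^ (N - (l + 1)) = d ^ N"
proof -
  have "l - 1 + 2 + (N - (l + 1)) = N" using assms by auto
  then show ?thesis by (metis power_add)
qed

lemma acts_on_pair_linear:
  assumes T: "acts_on_pair d N l T" and l: "1 \<le> l" "l < N"
  shows "linear_superop (d ^ N) T"
proof -
  obtain M where M: "linear_superop (d ^ 2) M"
    and TR: "\<And>R. R \<in> carrier_mat (d ^ N) (d ^ N) \<Longrightarrow> T R = ampl (d ^ (l - 1)) (d ^ 2) (d ^ (N - (l + 1))) M R"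
    using T unfolding acts_on_pair_def by blast
  have "linear_superop (d ^ N) (ampl (d ^ (l - 1)) (d ^ 2) (d ^ (N - (l + 1))) M)"
    using ampl_linear_superop[OF M] chain_dim[OF l, of d] by metis
  then show ?thesis unfolding linear_superop_def using TR by simp
qed

lemma acts_on_pair_commute:
  assumes d: "1 \<le> d" and T: "acts_on_pair d N l T" and T': "acts_on_pair d N l' T'"
    and l: "1 \<le> l" "l + 2 \<le> l'" "l' < N" and R: "R \<in> carrier_mat (d ^ N) (d ^ N)"
  shows "T (T' R) = T' (T R)"
proof -
  obtain M where M: "linear_superop (d ^ 2) M"
    and TR: "\<And>R. R \<in> carrier_mat (d ^ N) (d ^ N) \<Longrightarrow> T R = ampl (d ^ (l - 1)) (d ^ 2) (d ^ (N - (l + 1))) M R"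
    using T unfolding acts_on_pair_def by blast
  obtain M' where M': "linear_superop (d ^ 2) M'"
    and TR': "\<And>R. R \<in> carrier_mat (d ^ N) (d ^ N) \<Longrightarrow> T' R = ampl (d ^ (l' - 1)) (d ^ 2) (d ^ (N - (l' + 1))) M' R"
    using T' unfolding acts_on_pair_def by blast
  have dims: "d ^ (l - 1) * d ^ 2 * d ^ (N - (l + 1)) = d ^ N" "d ^ (l' - 1) * d ^ 2 * d ^ (N - (l' + 1)) = d ^ N"
    by (rule chain_dim; use l in linarith)+
  \<comment> \<open>The factor w of the digit calculus is the dimension of the l' - l - 2 sites
    between the two pairs; for l' = l + 2 it is 1.\<close>
  have "N - (l + 1) = (l' - l - 2) + (2 + (N - (l' + 1)))" using l by auto
  then have e: "d ^ (N - (l + 1)) = d ^ (l' - l - 2) * (d ^ 2 * d ^ (N - (l' + 1)))"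
    by (metis power_add)
  have c: "T R \<in> carrier_mat (d ^ N) (d ^ N)" "T' R \<in> carrier_mat (d ^ N) (d ^ N)"
    using linear_superop_carrier[OF acts_on_pair_linear[OF T] R] linear_superop_carrier[OF acts_on_pair_linear[OF T'] R] l by auto
  have "T (T' R) = ampl (d ^ (l - 1)) (d ^ 2) (d ^ (N - (l + 1))) M (ampl (d ^ (l' - 1)) (d ^ 2) (d ^ (N - (l' + 1))) M' R)"
    using TR[OF c(2)] TR'[OF R] by simp
  also have "\<dots> = ampl (d ^ (l' - 1)) (d ^ 2) (d ^ (N - (l' + 1))) M' (ampl (d ^ (l - 1)) (d ^ 2) (d ^ (N - (l + 1))) M R)"
    by (rule ampl_commute[OF e _ M M']) (use d R dims in auto)
  also have "\<dots> = T' (T R)" using TR'[OF c(1)] TR[OF R] by simp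
  finally show ?thesis .
qed

lemma hat_commute:
  assumes "linear_superop D T" "linear_superop D T'"
    and "\<And>R. R \<in> carrier_mat D D \<Longrightarrow> T (T' R) = T' (T R)"
  shows "hat D T * hat D T' = hat D T' * hat D T"
  by (rule endo_eqI)
    (simp add: app_hat[OF assms(1)] app_hat[OF assms(2)] linear_superop_carrier[OF assms(1)]
      linear_superop_carrier[OF assms(2)] assms(3))

lemma linear_superop_mat_sum:
  assumes "\<And>l. l \<in> I \<Longrightarrow> linear_superop D (L l)"
  shows "linear_superop D (\<lambda>R. mat_sum D D (\<lambda>l. L l R) I)"
  unfolding linear_superop_def
proof (intro conjI ballI allI)
  fix R S :: "complex mat" and a assume R: "R \<in> carrier_mat D D"
  note Rc = linear_superop_carrier[OF assms R]
  show "mat_sum D D (\<lambda>l. L l R) I \<in> carrier_mat D D" by simp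
  show "mat_sum D D (\<lambda>l. L l (a \<cdot>\<^sub>m R)) I = a \<cdot>\<^sub>m mat_sum D D (\<lambda>l. L l R) I"
    by (rule eq_matI)
      (use carrier_matD[OF Rc] in \<open>auto simp: mat_sum_index linear_superop_smult[OF assms R] sum_distrib_left intro!: sum.cong\<close>)
  assume S: "S \<in> carrier_mat D D"
  note Sc = linear_superop_carrier[OF assms S]
  show "mat_sum D D (\<lambda>l. L l (R + S)) I = mat_sum D D (\<lambda>l. L l R) I + mat_sum D D (\<lambda>l. L l S) I"
  proof (rule eq_matI)
    fix i j assume "i < dim_row (mat_sum D D (\<lambda>l. L l R) I + mat_sum D D (\<lambda>l. L l S) I)"
      "j < dim_col (mat_sum D D (\<lambda>l. L l R) I + mat_sum D D (\<lambda>l. L l S) I)"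
    then have ij: "i < D" "j < D" by simp_all
    have "L l (R + S) $$ (i, j) = L l R $$ (i, j) + L l S $$ (i, j)" if "l \<in> I" for l
      using linear_superop_add[OF assms[OF that] R S] carrier_matD[OF Sc[OF that]] ij by simp
    then show "mat_sum D D (\<lambda>l. L l (R + S)) I $$ (i, j) = (mat_sum D D (\<lambda>l. L l R) I + mat_sum D D (\<lambda>l. L l S) I) $$ (i, j)"
      using ij by (simp add: mat_sum_index sum.distrib)
  qed simp_all
qed

lemma hat_mat_sum:
  assumes "finite I" "\<And>l. l \<in> I \<Longrightarrow> linear_superop D (L l)"
  shows "hat D (\<lambda>R. mat_sum D D (\<lambda>l. L l R) I) = (\<Sum>l\<in>I. hat D (L l))"
proof (rule endo_eqI)
  have lin: "linear_superop D (\<lambda>R. mat_sum D D (\<lambda>l. L l R) I)"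
    by (rule linear_superop_mat_sum[OF assms(2)])
  fix v
  have "enc D (mat_sum D D (\<lambda>l. L l (dec D v)) I) = (\<Sum>l\<in>I. app (hat D (L l)) v)"
    using assms
  proof (induction I rule: finite_induct)
    case empty
    have "0\<^sub>m D D = of_real 0 \<cdot>\<^sub>m (0\<^sub>m D D :: complex mat)" by (rule eq_matI) auto
    then show ?case using enc_smult[of "0\<^sub>m D D" D 0] by simp
  next
    case (insert l I)
    have c: "L l (dec D v) \<in> carrier_mat D D" using insert by (auto intro: linear_superop_carrier)
    have "app (hat D (L l)) v = enc D (L l (dec D v))" using insert by (intro app_hat) auto
    then show ?case using insert c by (simp add: mat_sum_insert[where f = "\<lambda>l. L l (dec D v)", OF insert(1,2) c] enc_add)
  qed
  then show "app (hat D (\<lambda>R. mat_sum D D (\<lambda>l. L l R) I)) v = app (\<Sum>l\<in>I. hat D (L l)) v"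
    unfolding app_hat[OF lin] app.sum_left .
qed

lemma ampl_trivial:
  assumes T: "linear_superop D T" and R: "R \<in> carrier_mat D D"
  shows "ampl 1 D 1 T R = T R"
proof (rule eq_matI)
  fix i j assume "i < dim_row (T R)" "j < dim_col (T R)"
  then have ij: "i < D" "j < D" using linear_superop_carrier[OF T R] by auto
  have "Matrix.mat D D (\<lambda>(p, q). R $$ (p, q)) = R" by (rule eq_matI) (use R in auto)
  then show "ampl 1 D 1 T R $$ (i, j) = T R $$ (i, j)"
    using ij by (simp add: ampl_def)
qed (use linear_superop_carrier[OF T R] in \<open>simp_all add: ampl_def\<close>)

text \<open>The one-dimensional ancilla in the supremum already gives the bound, once
  \<open>R\<close> is rescaled to trace norm one.\<close>

lemma trace_norm_le_diamond_norm:
  assumes T: "linear_superop D T" and b: "diamond_norm D T \<le> ereal b" and R: "hermitian_mat D R"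
    and TR: "hermitian_mat D (T R)"
  shows "trace_norm (T R) \<le> b * trace_norm R"
proof -
  have Rc: "R \<in> carrier_mat D D" by (rule hermitian_carrier[OF R])
  show ?thesis
  proof (cases "trace_norm R = 0")
    \<comment> \<open>A matrix of trace norm zero cannot be rescaled, but it is zero and so is its
      image.\<close>
    case True
    have "R = of_real 0 \<cdot>\<^sub>m 0\<^sub>m D D"
      by (rule eq_matI) (use trace_norm_index_le[OF R] True Rc in auto)
    then have "T R = of_real 0 \<cdot>\<^sub>m T (0\<^sub>m D D)" using linear_superop_smult[OF T, of "0\<^sub>m D D"] by simp
    also have "\<dots> = 0\<^sub>m D D" using linear_superop_carrier[OF T, of "0\<^sub>m D D"] by (intro eq_matI) auto
    finally show ?thesis by (simp add: True trace_norm_zero)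
  next
    case False
    define r where "r = 1 / trace_norm R"
    have pos: "trace_norm R > 0" using False trace_norm_nonneg[OF R] by simp
    define R0 where "R0 = of_real r \<cdot>\<^sub>m R"
    have R0: "R0 \<in> carrier_mat D D" using Rc by (simp add: R0_def)
    have "trace_norm R0 = 1" unfolding R0_def trace_norm_smult[OF R] using pos by (simp add: r_def)
    then have "ereal (trace_norm (ampl 1 D 1 T R0)) \<le> norm_1_1 (D * 1) (ampl 1 D 1 T)"
      unfolding norm_1_1_def using R0 by (intro SUP_upper) auto
    also have "\<dots> \<le> diamond_norm D T"
      unfolding diamond_norm_def by (rule SUP_upper) simp
    also note b
    finally have "trace_norm (T R0) \<le> b" unfolding ampl_trivial[OF T R0] by simp
    moreover have "T R0 = of_real r \<cdot>\<^sub>m T R" unfolding R0_def by (rule linear_superop_smult[OF T Rc])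
    ultimately have "r * trace_norm (T R) \<le> b"
      using trace_norm_smult[OF TR, of r] pos by (simp add: r_def)
    then show ?thesis using pos by (simp add: r_def divide_simps mult.commute)
  qed
qed

text \<open>Two sources are combined: a bound with some constant, which the Lindblad form provides,
  gives preservation of Hermiticity, and the diamond norm then supplies the constant
  \<open>b\<close>.\<close>

lemma herm_bound_diamond:
  assumes T: "linear_superop D T" and b: "diamond_norm D T \<le> ereal b" and h: "herm_bound D (hat D T) a"
  shows "herm_bound D (hat D T) b"
proof (rule herm_boundI)
  fix R assume R: "hermitian_mat D R"
  have Rc: "R \<in> carrier_mat D D" by (rule hermitian_carrier[OF R])
  obtain S where S: "hermitian_mat D S" "app (hat D T) (enc D R) = enc D S"
    by (rule herm_boundE[OF h R])
  have "enc D S = enc D (T R)" unfolding S(2)[symmetric] by (rule app_hat_enc[OF T Rc])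
  then have "S = T R"
    unfolding enc_inject[OF hermitian_carrier[OF S(1)] linear_superop_carrier[OF T Rc]] .
  then show "\<exists>S. hermitian_mat D S \<and> app (hat D T) (enc D R) = enc D S \<and> trace_norm S \<le> b * trace_norm R"
    using S trace_norm_le_diamond_norm[OF T b R] by blast
qed

section \<open>Accumulated error of the compressions\<close>

lemma mtr_state_frob_norm:
  assumes "mtr (X * mat_adjoint X) = 1"
  shows "frob_norm X = 1"
proof -
  have "X \<in> carrier_mat (dim_row X) (dim_col X)" by auto
  from mtr_self_mult_adjoint[OF this] have "(frob_norm X)\<^sup>2 = 1"
    using assms by (metis of_real_eq_1_iff)
  then show ?thesis using frob_norm_nonneg[of X] by (simp add: power2_eq_1_iff)
qed

lemma mat_diff_telescope:
  fixes A B C :: "complex mat"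
  assumes "A \<in> carrier_mat n m" "B \<in> carrier_mat n m" "C \<in> carrier_mat n m"
  shows "A - C = (A - B) + (B - C)"
  by (rule eq_matI) (use assms in auto)

text \<open>Each step starts from a normalized purification, so the single errors of at most 2
  \<delta>m add up by the triangle inequality. The Kraus dimensions change along the sweep, hence
  the number of columns is only asserted to exist.\<close>

lemma compression_sweep_error:
  assumes "compression_sweep d N \<delta> xs (K, X) (K', X')"
    and "\<And>l j. (l, j) \<in> set xs \<Longrightarrow> 1 \<le> l \<and> l \<le> N \<and> j \<in> {1, 2, 3} \<and> \<delta> l j \<le> \<delta>m"
    and "frob_norm X = 1" "X \<in> carrier_mat (d ^ N) p"
  shows "\<exists>p'. X' \<in> carrier_mat (d ^ N) p' \<and> frob_norm X' = 1 \<and>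
    trace_norm (X * mat_adjoint X - X' * mat_adjoint X') \<le> 2 * real (length xs) * \<delta>m"
  using assms
proof (induction xs arbitrary: K X p)
  case Nil
  then have "X' = X" by simp
  moreover have "X * mat_adjoint X - X * mat_adjoint X = 0\<^sub>m (d ^ N) (d ^ N)"
    using Nil.prems(4) by (intro eq_matI) (auto simp del: index_mult_mat(1))
  ultimately have "trace_norm (X * mat_adjoint X - X' * mat_adjoint X') = 0"
    by (simp only: trace_norm_zero)
  then show ?case using Nil.prems \<open>X' = X\<close> by auto
next
  case (Cons x xs)
  obtain l j where x: "x = (l, j)" by (cases x)
  obtain KQ XQ where Q: "compression d N l j (\<delta> l j) (K, X) (KQ, XQ)" "compression_sweep d N \<delta> xs (KQ, XQ) (K', X')"
    using Cons.prems(1) unfolding x by auto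
  have lj: "1 \<le> l" "l \<le> N" "j \<in> {1, 2, 3}" "\<delta> l j \<le> \<delta>m" using Cons.prems(2)[of l j] x by auto
  note ce = compression_error[OF Q(1) lj(1,2,3) Cons.prems(3)]
  obtain p' where p': "X' \<in> carrier_mat (d ^ N) p'" "frob_norm X' = 1"
    "trace_norm (XQ * mat_adjoint XQ - X' * mat_adjoint X') \<le> 2 * real (length xs) * \<delta>m"
    using Cons.IH[OF Q(2) _ ce(2) ce(1)] Cons.prems(2) by auto
  have h: "hermitian_mat (d ^ N) (X * mat_adjoint X)" "hermitian_mat (d ^ N) (XQ * mat_adjoint XQ)"
    "hermitian_mat (d ^ N) (X' * mat_adjoint X')"
    using hermitian_self_adjoint Cons.prems(4) ce(1) p'(1) by blast+
  have "X * mat_adjoint X - X' * mat_adjoint X' = (X * mat_adjoint X - XQ * mat_adjoint XQ) + (XQ * mat_adjoint XQ - X' * mat_adjoint X')"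
    by (rule mat_diff_telescope[OF h[THEN hermitian_carrier]])
  then have "trace_norm (X * mat_adjoint X - X' * mat_adjoint X') \<le> 2 * \<delta>m + 2 * real (length xs) * \<delta>m"
    using trace_norm_triangle[OF hermitian_minus[OF h(1,2)] hermitian_minus[OF h(2,3)]] ce(3) p'(3) lj(4) by simp
  then show ?case using p' by (auto simp: algebra_simps)
qed

section \<open>The error bound\<close>

context op_bound
begin

text \<open>Only neighbouring pairs contribute to the commutator of the two layers, at most two for each even
  index, so the single commutator is of order \<open>N\<close> and the double ones of order \<open>N\<^sup>2\<close>.\<close>

lemma strang_nearest_neighbour:
  fixes h :: "nat \<Rightarrow> 'a"
  assumes b: "\<And>l. l \<in> {1..<N} \<Longrightarrow> bnd (h l) b" and dis: "\<And>l. l \<in> {1..<N} \<Longrightarrow> dissipative (h l)"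
    and comm: "\<And>l l'. l \<in> {1..<N} \<Longrightarrow> l' \<in> {1..<N} \<Longrightarrow> l + 2 \<le> l' \<Longrightarrow> h l * h l' = h l' * h l"
    and N: "2 \<le> N" and \<tau>: "0 \<le> \<tau>"
  defines "A \<equiv> (\<Sum>l\<in>{l \<in> {1..<N}. odd l}. h l)" and "B \<equiv> (\<Sum>l\<in>{l \<in> {1..<N}. even l}. h l)"
  shows "bnd (exp (\<tau> *\<^sub>R ((1/2) *\<^sub>R A)) * exp (\<tau> *\<^sub>R B) * exp (\<tau> *\<^sub>R ((1/2) *\<^sub>R A)) -
    exp (\<tau> *\<^sub>R (\<Sum>l\<in>{1..<N}. h l))) ((\<tau> * b) ^ 3 * (real N)\<^sup>2 / 4)"
proof -
  define Od Ev where "Od = {l \<in> {1..<N}. odd l}" and "Ev = {l \<in> {1..<N}. even l}"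
  have fin: "finite Od" "finite Ev" by (auto simp: Od_def Ev_def)
  have disj: "Od \<inter> Ev = {}" "Od \<union> Ev = {1..<N}" by (auto simp: Od_def Ev_def)
  define x y where "x = real (card Ev)" and "y = real (card Od)"
  have xy: "x + y = real N - 1"
  proof -
    have "card Od + card Ev = card {1..<N}" unfolding disj(2)[symmetric] by (rule card_Un_disjoint[symmetric, OF fin disj(1)])
    then show ?thesis using N by (simp add: x_def y_def)
  qed
  \<comment> \<open>As the numbering of the bonds starts at 1, the even ones are at most half of
    them; the single commutator is counted along these.\<close>
  have x: "2 * x \<le> real N - 1"
  proof -
    have "Ev \<subseteq> (\<lambda>k. 2 * k) ` {1..(N - 1) div 2}"
    proof
      fix l assume "l \<in> Ev"
      then obtain k where "l = 2 * k" "1 \<le> l" "l < N" by (auto simp: Ev_def elim: evenE)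
      then show "l \<in> (\<lambda>k. 2 * k) ` {1..(N - 1) div 2}" by (intro image_eqI[of _ _ k]) auto
    qed
    then have "card Ev \<le> card ((\<lambda>k. 2 * k) ` {1..(N - 1) div 2})" by (intro card_mono) auto
    also have "\<dots> \<le> (N - 1) div 2" using card_image_le[of "{1..(N - 1) div 2}" "\<lambda>k. 2 * k"] by simp
    finally have "2 * card Ev \<le> N - 1" by linarith
    then show ?thesis using N by (simp add: x_def of_nat_diff flip: of_nat_mult)
  qed
  have b0: "0 \<le> b" using nonneg[OF b[of 1]] N by simp
  have A: "bnd A (y * b)"
    using sum[OF fin(1), of h "\<lambda>_. b"] b by (simp add: A_def Od_def y_def)
  have B: "bnd B (x * b)"
    using sum[OF fin(2), of h "\<lambda>_. b"] b by (simp add: B_def Ev_def x_def)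
  have dA: "dissipative A" "dissipative B"
    unfolding A_def B_def using dis by (auto intro!: dissipative_sum)
  define C0 where "C0 = A * B - B * A"
  have C0: "bnd C0 (4 * b\<^sup>2 * x)"
  proof -
    have "C0 = (\<Sum>l'\<in>Ev. \<Sum>l\<in>Od. h l * h l' - h l' * h l)"
      unfolding C0_def A_def B_def Od_def[symmetric] Ev_def[symmetric]
      by (simp add: sum_product sum_subtractf sum.swap[of _ Od])
    moreover have "bnd (\<Sum>l'\<in>Ev. \<Sum>l\<in>Od. h l * h l' - h l' * h l) (\<Sum>l'\<in>Ev. 4 * b\<^sup>2)"
    proof (rule sum[OF fin(2)])
      fix l' assume l': "l' \<in> Ev"
      \<comment> \<open>An even bond overlaps with at most two odd ones, each of which contributes a
        commutator of size 2 b^2.\<close>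
      define near where "near = {l \<in> Od. l = l' + 1 \<or> l + 1 = l'}"
      have "bnd (\<Sum>l\<in>Od. h l * h l' - h l' * h l) (\<Sum>l\<in>Od. if l \<in> near then 2 * b\<^sup>2 else 0)"
      proof (rule sum[OF fin(1)])
        fix l assume l: "l \<in> Od"
        have ll: "l \<in> {1..<N}" "l' \<in> {1..<N}" using l l' by (auto simp: Od_def Ev_def)
        show "bnd (h l * h l' - h l' * h l) (if l \<in> near then 2 * b\<^sup>2 else 0)"
        proof (cases "l \<in> near")
          case True
          then show ?thesis using commutator[OF b[OF ll(1)] b[OF ll(2)]] by (simp add: power2_eq_square mult.assoc)
        next
          case False
          have "l \<noteq> l'" using l l' by (auto simp: Od_def Ev_def)
          then have "l + 2 \<le> l' \<or> l' + 2 \<le> l" using False l unfolding near_def by (simp, linarith)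
          then have "h l * h l' = h l' * h l" using comm[of l l'] comm[of l' l] ll by metis
          then show ?thesis using False zero by simp
        qed
      qed
      moreover have "(\<Sum>l\<in>Od. if l \<in> near then 2 * b\<^sup>2 else 0) \<le> 4 * b\<^sup>2"
      proof -
        have "near \<subseteq> {l' + 1, l' - 1}" by (auto simp: near_def)
        then have "card near \<le> card {l' + 1, l' - 1}" by (intro card_mono) auto
        also have "\<dots> \<le> 2" by (simp add: card_insert_if)
        finally have "real (card near) \<le> 2" by simp
        then have "real (card near) * (2 * b\<^sup>2) \<le> 2 * (2 * b\<^sup>2)" by (intro mult_right_mono) auto
        moreover have "(\<Sum>l\<in>Od. if l \<in> near then 2 * b\<^sup>2 else 0) = real (card near) * (2 * b\<^sup>2)"
        proof -
          have "Od \<inter> near = near" by (auto simp: near_def)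
          then show ?thesis using fin(1) by (simp add: sum.inter_restrict[symmetric])
        qed
        ultimately show ?thesis by simp
      qed
      ultimately show "bnd (\<Sum>l\<in>Od. h l * h l' - h l' * h l) (4 * b\<^sup>2)" by (rule mono)
    qed
    ultimately show ?thesis by (simp add: x_def mult.commute)
  qed
  define P where "P = (1/2) *\<^sub>R A"
  \<comment> \<open>The half step puts a factor 1/2 into \<open>P\<close>: the double commutators of
    the splitting lemma become [C0, A] / 4 and [C0, B] / 2, which with \<tau>^3 / 6 yields \<tau>^3
    / 24 and \<tau>^3 / 12.\<close>
  have PC: "P * B - B * P = (1/2) *\<^sub>R C0"
    by (simp add: P_def C0_def scaleR_diff_right)
  have PPB: "P + P + B = (\<Sum>l\<in>{1..<N}. h l)"
  proof -
    have "P + P = A" by (simp add: P_def scaleR_add_left[symmetric])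
    moreover have "A + B = (\<Sum>l\<in>Od \<union> Ev. h l)"
      unfolding A_def B_def Od_def[symmetric] Ev_def[symmetric] by (rule sum.union_disjoint[symmetric, OF fin disj(1)])
    ultimately show ?thesis using disj by simp
  qed
  have "bnd ((1/2) *\<^sub>R C0 * P - P * ((1/2) *\<^sub>R C0)) (\<bar>1/4\<bar> * (2 * (4 * b\<^sup>2 * x) * (y * b)))"
  proof -
    have "(1/2) *\<^sub>R C0 * P - P * ((1/2) *\<^sub>R C0) = (1/4) *\<^sub>R (C0 * A - A * C0)"
      by (simp add: P_def scaleR_diff_right)
    then show ?thesis using scale[OF commutator[OF C0 A], of "1/4"] by simp
  qed
  moreover have "bnd ((1/2) *\<^sub>R C0 * B - B * ((1/2) *\<^sub>R C0)) (\<bar>1/2\<bar> * (2 * (4 * b\<^sup>2 * x) * (x * b)))"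
  proof -
    have "(1/2) *\<^sub>R C0 * B - B * ((1/2) *\<^sub>R C0) = (1/2) *\<^sub>R (C0 * B - B * C0)"
      by (simp add: scaleR_diff_right)
    then show ?thesis using scale[OF commutator[OF C0 B], of "1/2"] by simp
  qed
  moreover have "contractive P" "contractive B"
    unfolding P_def using dA[THEN dissipative_imp_contractive] contractive_scale[of A "1/2"] by simp_all
  moreover have "contractive (P + P + B)"
    unfolding PPB using dis by (intro dissipative_imp_contractive dissipative_sum) auto
  ultimately have "bnd (exp (\<tau> *\<^sub>R P) * exp (\<tau> *\<^sub>R B) * exp (\<tau> *\<^sub>R P) - exp (\<tau> *\<^sub>R (P + P + B)))
    (\<tau> ^ 3 / 6 * (\<bar>1/4\<bar> * (2 * (4 * b\<^sup>2 * x) * (y * b)) + \<bar>1/2\<bar> * (2 * (4 * b\<^sup>2 * x) * (x * b))))"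
    using strang_splitting[of P B \<tau>] \<tau> unfolding PC by blast
  note splitting = this
  have simplify: "\<tau> ^ 3 / 6 * (\<bar>1/4\<bar> * (2 * (4 * b\<^sup>2 * x) * (y * b)) + \<bar>1/2\<bar> * (2 * (4 * b\<^sup>2 * x) * (x * b))) =
    (\<tau> * b) ^ 3 * (x * (y + 2 * x) / 3)"
    by (simp add: power3_eq_cube power2_eq_square field_simps)
  have "(\<tau> * b) ^ 3 * (x * (y + 2 * x) / 3) \<le> (\<tau> * b) ^ 3 * ((real N)\<^sup>2 / 4)"
  proof (rule mult_left_mono)
    \<comment> \<open>x is at most N / 2, and y + 2 x = N - 1 + x is at most 3 N / 2.\<close>
    have "x * (y + 2 * x) \<le> (real N / 2) * (3 * real N / 2)"
      using x xy by (intro mult_mono) (auto simp: x_def y_def)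
    then show "x * (y + 2 * x) / 3 \<le> (real N)\<^sup>2 / 4" by (simp add: power2_eq_square)
    show "0 \<le> (\<tau> * b) ^ 3" using \<tau> b0 by simp
  qed
  with splitting have "bnd (exp (\<tau> *\<^sub>R P) * exp (\<tau> *\<^sub>R B) * exp (\<tau> *\<^sub>R P) - exp (\<tau> *\<^sub>R (P + P + B)))
    ((\<tau> * b) ^ 3 * ((real N)\<^sup>2 / 4))"
    unfolding simplify by (rule mono)
  then show ?thesis unfolding PPB by (simp add: P_def)
qed

end

text \<open>Adjacent half steps of consecutive Strang steps are merged into one odd layer, which
  appears as the square of exp (\<tau> P). After 2 j + 1 layers, for j < m, the product consists of
  j full steps and one further half step.\<close>

lemma layer_product:
  fixes P B :: "'a::{real_normed_algebra_1,banach}" and \<tau> :: real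
  assumes y0: "y 0 = 1"
    and ys: "\<And>k. 1 \<le> k \<Longrightarrow> k \<le> 2 * m + 1 \<Longrightarrow> y k = (if even k then exp (\<tau> *\<^sub>R B)
      else if k = 1 \<or> k = 2 * m + 1 then exp (\<tau> *\<^sub>R P) else exp (\<tau> *\<^sub>R P) * exp (\<tau> *\<^sub>R P)) * y (k - 1)"
    and m: "1 \<le> m"
  shows "y (2 * m + 1) = (exp (\<tau> *\<^sub>R P) * exp (\<tau> *\<^sub>R B) * exp (\<tau> *\<^sub>R P)) ^ m"
proof -
  define S where "S = exp (\<tau> *\<^sub>R P) * exp (\<tau> *\<^sub>R B) * exp (\<tau> *\<^sub>R P)"
  have ind: "y (2 * j + 1) = exp (\<tau> *\<^sub>R P) * S ^ j" if "j < m" for j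
    using that
  proof (induction j)
    case 0
    then show ?case using ys[of 1] y0 by simp
  next
    case (Suc j)
    have "y (2 * Suc j + 1) = exp (\<tau> *\<^sub>R P) * exp (\<tau> *\<^sub>R P) * y (2 * Suc j)"
      using ys[of "2 * Suc j + 1"] Suc.prems by simp
    also have "y (2 * Suc j) = exp (\<tau> *\<^sub>R B) * y (2 * j + 1)"
      using ys[of "2 * Suc j"] Suc.prems by simp
    also have "y (2 * j + 1) = exp (\<tau> *\<^sub>R P) * S ^ j" using Suc by simp
    finally show ?case by (simp add: S_def mult.assoc)
  qed
  obtain j where j: "m = Suc j" using m by (cases m) auto
  have "y (2 * m + 1) = exp (\<tau> *\<^sub>R P) * y (2 * m)" using ys[of "2 * m + 1"] by simp
  also have "y (2 * m) = exp (\<tau> *\<^sub>R B) * y (2 * j + 1)" using ys[of "2 * m"] by (simp add: j)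
  also have "y (2 * j + 1) = exp (\<tau> *\<^sub>R P) * S ^ j" using ind j by simp
  finally show ?thesis unfolding S_def[symmetric] j by (simp add: S_def mult.assoc)
qed

text \<open>\<open>S\<close> is the ideal Trotter state and \<open>X\<close> the simulated
  purification. Contractivity carries their distance through the exact layer; trace preservation
  keeps the purification normalized, as the next compressions require.\<close>

lemma layer_step_error:
  assumes D: "d ^ N \<ge> 1" and T: "linear_superop (d ^ N) T" and tr: "\<forall>S\<in>carrier_mat (d ^ N) (d ^ N). mtr (T S) = 0"
    and con: "herm_bound (d ^ N) (exp (\<tau> *\<^sub>R hat (d ^ N) T)) 1"
    and X: "X \<in> carrier_mat (d ^ N) p" "frob_norm X = 1"
    and S: "hermitian_mat (d ^ N) S" "trace_norm (S - X * mat_adjoint X) \<le> \<epsilon>"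
    and Q: "XQ * mat_adjoint XQ = superop_exp (d ^ N) \<tau> T (X * mat_adjoint X)"
  shows "frob_norm XQ = 1" "dim_row XQ = d ^ N"
    "\<exists>S'. hermitian_mat (d ^ N) S' \<and> app (exp (\<tau> *\<^sub>R hat (d ^ N) T)) (enc (d ^ N) S) = enc (d ^ N) S' \<and>
      trace_norm (S' - XQ * mat_adjoint XQ) \<le> \<epsilon>"
proof -
  let ?n = "d ^ N" and ?e = "exp (\<tau> *\<^sub>R hat (d ^ N) T)"
  have h: "hermitian_mat ?n (X * mat_adjoint X)" by (rule hermitian_self_adjoint[OF X(1)])
  have c: "X * mat_adjoint X \<in> carrier_mat ?n ?n" by (rule hermitian_carrier[OF h])
  have "mtr (XQ * mat_adjoint XQ) = 1"
  proof -
    have "mtr (superop_exp ?n \<tau> T (X * mat_adjoint X)) = mtr (X * mat_adjoint X)"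
      by (rule superop_exp_mtr[OF T c]) (use tr in blast)
    then show ?thesis unfolding Q mtr_self_mult_adjoint[OF X(1)] X(2) by simp
  qed
  then show "frob_norm XQ = 1" by (rule mtr_state_frob_norm)
  have "dim_row (XQ * mat_adjoint XQ) = ?n" unfolding Q by (simp add: superop_exp_def)
  then show "dim_row XQ = ?n" by simp
  obtain R where R: "hermitian_mat ?n R" "app ?e (enc ?n (X * mat_adjoint X)) = enc ?n R"
    by (rule herm_boundE[OF con h])
  have RQ: "R = XQ * mat_adjoint XQ"
    unfolding Q superop_exp_eq[OF T c] R(2) using hermitian_carrier[OF R(1)] by simp
  obtain S' where S': "hermitian_mat ?n S'" "app ?e (enc ?n S) = enc ?n S'"
    by (rule herm_boundE[OF con S(1)])
  obtain U where U: "hermitian_mat ?n U" "app ?e (enc ?n (S - X * mat_adjoint X)) = enc ?n U"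
    "trace_norm U \<le> 1 * trace_norm (S - X * mat_adjoint X)"
    by (rule herm_boundE[OF con hermitian_minus[OF S(1) h]])
  have "enc ?n U = enc ?n (S' - R)"
    using U(2) S'(2) R(2) enc_minus[OF hermitian_carrier[OF S(1)] c]
      enc_minus[OF hermitian_carrier[OF S'(1)] hermitian_carrier[OF R(1)]]
    by (simp add: app.diff_right)
  then have "U = S' - R"
    using enc_inject[OF hermitian_carrier[OF U(1)]] hermitian_carrier[OF R(1)] minus_carrier_mat by blast
  then show "\<exists>S'. hermitian_mat ?n S' \<and> app ?e (enc ?n S) = enc ?n S' \<and> trace_norm (S' - XQ * mat_adjoint XQ) \<le> \<epsilon>"
    using S' U(3) S(2) RQ by auto
qed

theorem theorem7:
  fixes N d m :: nat
    and b t \<delta>max :: real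
    and L :: "nat \<Rightarrow> superop"
    and K D K' :: "nat \<Rightarrow> nat"
    and A :: "nat \<Rightarrow> tensor"
    and X X' \<rho> :: "complex mat"
    and \<delta> :: "nat \<Rightarrow> nat \<Rightarrow> nat \<Rightarrow> real"
  assumes "N \<ge> 2" and "d \<ge> 1" and "m \<ge> 1" and "t \<ge> 0"
    and "\<And>l. l \<in> {1..<N} \<Longrightarrow> liouvillian (d ^ N) (L l)"
    and "\<And>l. l \<in> {1..<N} \<Longrightarrow> acts_on_pair d N l (L l)"
    and "\<And>l. l \<in> {1..<N} \<Longrightarrow> diamond_norm (d ^ N) (L l) \<le> ereal b"
    and "bond_dims N D" and "X = lpf_op d N K D A"
    and "\<rho> = X * mat_adjoint X" and "is_state (d ^ N) \<rho>"
    and "lpf_simulation d N L t m \<delta> (K, X) (K', X')"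
    and "\<And>k l j. k \<in> {1..2 * m + 1} \<Longrightarrow> l \<in> {1..N} \<Longrightarrow> j \<in> {1, 2, 3} \<Longrightarrow> \<delta> k l j \<le> \<delta>max"
  shows "trace_norm (superop_exp (d ^ N) t (local_sum d N L {1..<N}) \<rho> - X' * mat_adjoint X')
    \<le> (t * b) ^ 3 * (real N) ^ 2 / (4 * (real m) ^ 2) + 6 * (2 * real m + 1) * real N * \<delta>max"
proof -
  let ?n = "d ^ N"
  have n1: "?n \<ge> 1" using assms(2) by simp
  interpret op_bound "herm_bound ?n" by (rule op_bound_herm_bound[OF n1])
  have lin: "linear_superop ?n (L l)" if "l \<in> {1..<N}" for l
    using acts_on_pair_linear[OF assms(6)[OF that]] that by simp
  define h where "h l = hat ?n (L l)" for l
  have dis: "dissipative (h l)" if "l \<in> {1..<N}" for l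
    unfolding h_def by (rule liouvillian_dissipative[OF n1 assms(5)[OF that] lin[OF that]])
  have hb: "herm_bound ?n (h l) b" if l: "l \<in> {1..<N}" for l
  proof -
    obtain a where "herm_bound ?n (h l) a" using dis[OF l] unfolding dissipative_def by blast
    then show ?thesis unfolding h_def by (rule herm_bound_diamond[OF lin[OF l] assms(7)[OF l]])
  qed
  have comm: "h l * h l' = h l' * h l" if "l \<in> {1..<N}" "l' \<in> {1..<N}" "l + 2 \<le> l'" for l l'
    unfolding h_def using that
    by (intro hat_commute[OF lin[OF that(1)] lin[OF that(2)]] acts_on_pair_commute[OF assms(2) assms(6)[OF that(1)] assms(6)[OF that(2)]]) auto
  have ls: "local_sum d N L I = (\<lambda>R. mat_sum ?n ?n (\<lambda>l. L l R) I)" for I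
    by (rule ext) (simp add: local_sum_def)
  have linI: "linear_superop ?n (local_sum d N L I)" if "I \<subseteq> {1..<N}" for I
    unfolding ls using lin that by (intro linear_superop_mat_sum) auto
  have hatI: "hat ?n (local_sum d N L I) = (\<Sum>l\<in>I. h l)" if "I \<subseteq> {1..<N}" for I
    unfolding ls h_def using lin that finite_subset[OF that] by (intro hat_mat_sum) auto
  have conI: "contractive (\<Sum>l\<in>I. h l)" if "I \<subseteq> {1..<N}" for I
    using that finite_subset[OF that] dis by (intro dissipative_imp_contractive dissipative_sum) auto
  have trI: "\<forall>R\<in>carrier_mat ?n ?n. mtr (local_sum d N L I R) = 0" if I: "I \<subseteq> {1..<N}" for I
  proof
    fix R :: "complex mat" assume R: "R \<in> carrier_mat ?n ?n"
    have "mtr (local_sum d N L I R) = (\<Sum>l\<in>I. mtr (L l R))"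
      unfolding local_sum_def using lin I linear_superop_carrier[OF _ R] by (intro mtr_mat_sum) auto
    also have "\<dots> = 0" using liouvillian_mtr[OF assms(5) R] I by (intro sum.neutral) auto
    finally show "mtr (local_sum d N L I R) = 0" .
  qed
  have \<rho>: "psd ?n \<rho>" "mtr \<rho> = 1" using assms(11) by (auto simp: is_state_def)
  have \<rho>h: "hermitian_mat ?n \<rho>" by (rule psd_hermitian[OF \<rho>(1)])
  have \<rho>c: "\<rho> \<in> carrier_mat ?n ?n" by (rule hermitian_carrier[OF \<rho>h])
  have \<rho>1: "trace_norm \<rho> = 1" using trace_norm_psd[OF \<rho>(1)] \<rho>(2) by simp
  obtain F where F0: "F 0 = (K, X)" and Fm: "F (2 * m + 1) = (K', X')"
    and Fs: "\<And>k. k \<in> {1..2 * m + 1} \<Longrightarrow> \<exists>Q.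
        layer_update d N L (layer_time t m k) (layer_bonds N k) (F (k - 1)) Q \<and>
        compression_sweep d N (\<delta> k) (List.product [1..<N + 1] [1, 2, 3]) Q (F k)"
    using assms(12) unfolding lpf_simulation_def by blast
  define I where "I k = set (layer_bonds N k)" for k
  have I: "I k = {l \<in> {1..<N}. even l = even k}" for k by (auto simp: I_def layer_bonds_def)
  have IN: "I k \<subseteq> {1..<N}" for k by (auto simp: I)
  define e where "e k = exp (layer_time t m k *\<^sub>R (\<Sum>l\<in>I k. h l))" for k
  have lt: "0 \<le> layer_time t m k" for k using assms(4) by (simp add: layer_time_def)
  have econ: "herm_bound ?n (e k) 1" for k
    unfolding e_def by (rule contractive_exp[OF conI[OF IN] lt])
  \<comment> \<open>The product of the first k layers, later ones to the left: the Trotter evolution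
    without compressions.\<close>
  define y where "y = rec_nat 1 (\<lambda>k z. e (Suc k) * z)"
  have y0: "y 0 = 1" and ySuc: "y (Suc k) = e (Suc k) * y k" for k by (simp_all add: y_def)
  \<comment> \<open>The cost of one sweep: 3 N compressions at 2 \<delta>max each.\<close>
  define \<epsilon> where "\<epsilon> = 6 * real N * \<delta>max"
  \<comment> \<open>Invariant: the distance of the simulated state from the ideal Trotter state
    grows by at most \<epsilon> per layer.\<close>
  have run: "\<exists>S p. snd (F k) \<in> carrier_mat ?n p \<and> frob_norm (snd (F k)) = 1 \<and> hermitian_mat ?n S \<and>
      app (y k) (enc ?n \<rho>) = enc ?n S \<and> trace_norm (S - snd (F k) * mat_adjoint (snd (F k))) \<le> real k * \<epsilon>"
    if "k \<le> 2 * m + 1" for k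
    using that
  proof (induction k)
    case 0
    have "X \<in> carrier_mat ?n (\<Prod>k\<in>{1..N}. K k)" unfolding assms(9) by (rule lpf_op_carrier)
    moreover have "frob_norm X = 1" using mtr_state_frob_norm \<rho>(2) assms(10) by simp
    moreover have "\<rho> - \<rho> = 0\<^sub>m ?n ?n" using \<rho>c by (intro eq_matI) auto
    then have "trace_norm (\<rho> - X * mat_adjoint X) = 0" unfolding assms(10) by (simp only: trace_norm_zero)
    ultimately show ?case
      using \<rho>h by (intro exI[of _ \<rho>] exI[of _ "\<Prod>k\<in>{1..N}. K k"]) (simp add: F0 y0)
  next
    case (Suc k)
    obtain S p where IH: "snd (F k) \<in> carrier_mat ?n p" "frob_norm (snd (F k)) = 1" "hermitian_mat ?n S"
      "app (y k) (enc ?n \<rho>) = enc ?n S" "trace_norm (S - snd (F k) * mat_adjoint (snd (F k))) \<le> real k * \<epsilon>"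
      using Suc by auto
    obtain Q where Q: "layer_update d N L (layer_time t m (Suc k)) (layer_bonds N (Suc k)) (F k) Q"
      "compression_sweep d N (\<delta> (Suc k)) (List.product [1..<N + 1] [1, 2, 3]) Q (F (Suc k))"
      using Fs[of "Suc k"] Suc.prems by auto
    obtain KQ XQ where KQ: "Q = (KQ, XQ)" by (cases Q)
    obtain KF XF where KF: "F (Suc k) = (KF, XF)" by (cases "F (Suc k)")
    have up: "XQ * mat_adjoint XQ = superop_exp ?n (layer_time t m (Suc k)) (local_sum d N L (I (Suc k)))
      (snd (F k) * mat_adjoint (snd (F k)))"
      using Q(1) by (simp add: layer_update_def KQ I_def)
    have con: "herm_bound ?n (exp (layer_time t m (Suc k) *\<^sub>R hat ?n (local_sum d N L (I (Suc k))))) 1"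
      using econ[of "Suc k"] by (simp add: e_def hatI[OF IN])
    note ls = layer_step_error[OF n1 linI[OF IN] trI[OF IN] con IH(1,2,3,5) up]
    obtain S' where S': "hermitian_mat ?n S'" "app (e (Suc k)) (enc ?n S) = enc ?n S'"
      "trace_norm (S' - XQ * mat_adjoint XQ) \<le> real k * \<epsilon>"
      using ls(3) by (auto simp: e_def hatI[OF IN])
    have XQc: "XQ \<in> carrier_mat ?n (dim_col XQ)" using ls(2) by auto
    have "\<exists>p'. XF \<in> carrier_mat ?n p' \<and> frob_norm XF = 1 \<and>
      trace_norm (XQ * mat_adjoint XQ - XF * mat_adjoint XF) \<le> 2 * real (length (List.product [1..<N + 1] [1, 2, 3::nat])) * \<delta>max"
    proof (rule compression_sweep_error[OF Q(2)[unfolded KQ KF] _ ls(1) XQc])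
      fix l j assume "(l, j) \<in> set (List.product [1..<N + 1] [1, 2, 3::nat])"
      then show "1 \<le> l \<and> l \<le> N \<and> j \<in> {1, 2, 3} \<and> \<delta> (Suc k) l j \<le> \<delta>max"
        using assms(13)[of "Suc k" l j] Suc.prems by auto
    qed
    moreover have "2 * real (length (List.product [1..<N + 1] [1, 2, 3::nat])) * \<delta>max = \<epsilon>"
      by (simp add: \<epsilon>_def length_product del: upt_Suc)
    ultimately obtain p' where p': "XF \<in> carrier_mat ?n p'" "frob_norm XF = 1"
      "trace_norm (XQ * mat_adjoint XQ - XF * mat_adjoint XF) \<le> \<epsilon>"
      by metis
    have hs: "hermitian_mat ?n (XQ * mat_adjoint XQ)" "hermitian_mat ?n (XF * mat_adjoint XF)"
      using hermitian_self_adjoint XQc p'(1) by blast+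
    have "S' - XF * mat_adjoint XF = (S' - XQ * mat_adjoint XQ) + (XQ * mat_adjoint XQ - XF * mat_adjoint XF)"
      by (rule mat_diff_telescope[OF hermitian_carrier[OF S'(1)] hs[THEN hermitian_carrier]])
    then have "trace_norm (S' - XF * mat_adjoint XF) \<le> real (Suc k) * \<epsilon>"
      using trace_norm_triangle[OF hermitian_minus[OF S'(1) hs(1)] hermitian_minus[OF hs]] S'(3) p'(3)
      by (simp add: algebra_simps)
    then show ?case
      using p' S' IH(4) by (intro exI[of _ S'] exI[of _ p']) (auto simp: KF ySuc)
  qed
  define \<tau> where "\<tau> = t / real m"
  have \<tau>: "0 \<le> \<tau>" "real m * \<tau> = t" using assms(3,4) by (auto simp: \<tau>_def)
  define P where "P = (1/2) *\<^sub>R (\<Sum>l\<in>{l \<in> {1..<N}. odd l}. h l)"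
  define B where "B = (\<Sum>l\<in>{l \<in> {1..<N}. even l}. h l)"
  define G where "G = (\<Sum>l\<in>{1..<N}. h l)"
  define St where "St = exp (\<tau> *\<^sub>R P) * exp (\<tau> *\<^sub>R B) * exp (\<tau> *\<^sub>R P)"
  have strang: "herm_bound ?n (St - exp (\<tau> *\<^sub>R G)) ((\<tau> * b) ^ 3 * (real N)\<^sup>2 / 4)"
    unfolding St_def P_def B_def G_def
    by (rule strang_nearest_neighbour[OF hb dis comm assms(1) \<tau>(1)])
  have yS: "y (2 * m + 1) = St ^ m"
    unfolding St_def
  proof (rule layer_product[where y = y, OF y0 _ assms(3)])
    fix k assume k: "1 \<le> k" "k \<le> 2 * m + 1"
    have "e k = (if even k then exp (\<tau> *\<^sub>R B) else if k = 1 \<or> k = 2 * m + 1 then exp (\<tau> *\<^sub>R P) else exp (\<tau> *\<^sub>R P) * exp (\<tau> *\<^sub>R P))"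
    proof (cases "even k")
      case True
      \<comment> \<open>The two layers of half duration, 1 and 2 m + 1, are odd.\<close>
      then have "k \<noteq> 1" "k \<noteq> 2 * m + 1" by auto
      then show ?thesis using True by (simp add: e_def I layer_time_def \<tau>_def B_def)
    next
      case False
      \<comment> \<open>Half of the odd generator is \<open>P\<close>, so a layer of time \<tau> / 2
        is exp (\<tau> P) and one of time \<tau> is its square.\<close>
      then have sI: "(\<Sum>l\<in>I k. h l) = 2 *\<^sub>R P" by (simp add: I P_def)
      have "exp (\<tau> *\<^sub>R P) * exp (\<tau> *\<^sub>R P) = exp ((2 * \<tau>) *\<^sub>R P)"
        by (simp add: exp_scaleR_add[symmetric])
      then show ?thesis using False by (auto simp: e_def sI layer_time_def \<tau>_def mult.commute)
    qed
    moreover obtain k' where "k = Suc k'" using k by (cases k) auto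
    ultimately show "y k = (if even k then exp (\<tau> *\<^sub>R B) else if k = 1 \<or> k = 2 * m + 1 then exp (\<tau> *\<^sub>R P)
      else exp (\<tau> *\<^sub>R P) * exp (\<tau> *\<^sub>R P)) * y (k - 1)"
      using ySuc[of k'] by simp
  qed
  have contr: "herm_bound ?n St 1" "herm_bound ?n (exp (\<tau> *\<^sub>R G)) 1"
  proof -
    have "contractive P" unfolding P_def by (rule contractive_scale[OF conI]) auto
    moreover have "contractive B" unfolding B_def by (rule conI) auto
    moreover have "contractive G" unfolding G_def by (rule conI) simp
    ultimately have con: "contractive P" "contractive B" "contractive G" by blast+
    have "herm_bound ?n St (1 * 1 * 1)"
      unfolding St_def by (intro mult contractive_exp con \<tau>(1))
    then show "herm_bound ?n St 1" by simp
    show "herm_bound ?n (exp (\<tau> *\<^sub>R G)) 1" by (rule contractive_exp[OF con(3) \<tau>(1)])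
  qed
  have et: "exp (t *\<^sub>R G) = exp (\<tau> *\<^sub>R G) ^ m"
    using exp_scaleR_of_nat[of m \<tau> G] \<tau>(2) by simp
  have "herm_bound ?n (exp (\<tau> *\<^sub>R G) - St) ((\<tau> * b) ^ 3 * (real N)\<^sup>2 / 4)"
    using scale[OF strang, of "- 1"] by simp
  \<comment> \<open>The m-th powers of two contractions differ by at most m times the difference of
    the contractions.\<close>
  then have "herm_bound ?n (exp (t *\<^sub>R G) - y (2 * m + 1)) (real m * ((\<tau> * b) ^ 3 * (real N)\<^sup>2 / 4))"
    unfolding yS et by (rule power_diff[OF contr(2,1)])
  moreover have "real m * ((\<tau> * b) ^ 3 * (real N)\<^sup>2 / 4) = (t * b) ^ 3 * (real N) ^ 2 / (4 * (real m) ^ 2)"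
    using assms(3) by (simp add: \<tau>_def power3_eq_cube power2_eq_square field_simps)
  ultimately obtain U where U: "hermitian_mat ?n U" "app (exp (t *\<^sub>R G) - y (2 * m + 1)) (enc ?n \<rho>) = enc ?n U"
    "trace_norm U \<le> (t * b) ^ 3 * (real N) ^ 2 / (4 * (real m) ^ 2)"
    using \<rho>h \<rho>1 by (auto elim: herm_boundE)
  obtain S p where S: "X' \<in> carrier_mat ?n p" "hermitian_mat ?n S" "app (y (2 * m + 1)) (enc ?n \<rho>) = enc ?n S"
    "trace_norm (S - X' * mat_adjoint X') \<le> real (2 * m + 1) * \<epsilon>"
    using run[OF order_refl, unfolded Fm snd_conv] by blast
  have Sc: "S \<in> carrier_mat ?n ?n" and Uc: "U \<in> carrier_mat ?n ?n" using S(2) U(1) by (auto intro: hermitian_carrier)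
  have hX: "hermitian_mat ?n (X' * mat_adjoint X')" by (rule hermitian_self_adjoint[OF S(1)])
  \<comment> \<open>The exact state is the ideal Trotter state \<open>S\<close> plus the splitting
    error \<open>U\<close>.\<close>
  have "app (exp (t *\<^sub>R G)) (enc ?n \<rho>) = enc ?n (U + S)"
    using U(2) S(3) enc_add[OF Uc Sc] by (simp add: app.diff_left algebra_simps)
  then have "dec ?n (app (exp (t *\<^sub>R G)) (enc ?n \<rho>)) = U + S" using Uc Sc by simp
  then have "superop_exp ?n t (local_sum d N L {1..<N}) \<rho> = U + S"
    unfolding superop_exp_eq[OF linI[OF order_refl] \<rho>c] hatI[OF order_refl] G_def .
  moreover have "U + S - X' * mat_adjoint X' = U + (S - X' * mat_adjoint X')"
  proof -
    have "U + S - C = U + (S - C)" if "C \<in> carrier_mat ?n ?n" for C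
      using Uc Sc that by (intro eq_matI) auto
    then show ?thesis using hermitian_carrier[OF hX] by blast
  qed
  ultimately have "trace_norm (superop_exp ?n t (local_sum d N L {1..<N}) \<rho> - X' * mat_adjoint X') \<le>
    trace_norm U + trace_norm (S - X' * mat_adjoint X')"
    using trace_norm_triangle[OF U(1) hermitian_minus[OF S(2) hX]] by simp
  also have "\<dots> \<le> (t * b) ^ 3 * (real N) ^ 2 / (4 * (real m) ^ 2) + real (2 * m + 1) * \<epsilon>"
    using U(3) S(4) by simp
  also have "real (2 * m + 1) * \<epsilon> = 6 * (2 * real m + 1) * real N * \<delta>max"
    by (simp add: \<epsilon>_def algebra_simps)
  finally show ?thesis .
qed

end
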